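(* Let $(R,\mathfrak m,k)$ be a commutative noetherian local ring which is not a field. If $k$ is a direct summand of $\Omega^4(M)$ for every non-free finitely generated $R$-module $M$, then $R$ is a Burch ring with $\operatorname{depth}(R)=0$.
   Context: For a finitely generated $R$-module $M$, $\Omega^4(M)$ denotes the fourth syzygy of $M$ in its minimal $R$-free resolution. Let $R$ be a local ring of depth $0$ that is not a field, and let $\widehat R\cong S/I$ be a minimal Cohen presentation of its completion, with $(S,\mathfrak n,k)$ a regular local ring and $I\subseteq\mathfrak n^2$ an ideal. The Burch index of $R$ is $\operatorname{Burch}(R)=\dim_k\bigl(\mathfrak n/(I\mathfrak n:_S(I:_S\mathfrak n))\bigr)$, and $R$ is a Burch ring if $\operatorname{Burch}(R)\ge1$ (equivalently, $\mathfrak n(I:_S\mathfrak n)\neq\mathfrak nI$). *)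

theory Defs
  imports
    "HOL-Algebra.Ideal_Product"
    "HOL-Algebra.Ring_Divisibility"
    "HOL-Algebra.QuotRing"
    "HOL-Algebra.Module"
    "HOL-Library.Extended_Nat"
begin

section \<open>Modules over a commutative ring\<close>

text \<open>
  Modules are the records of \<^theory>\<open>HOL-Algebra.Module\<close>. That record type extends \<open>ring\<close>,
  but the fields \<open>mult\<close> and \<open>one\<close> of a module carry no meaning and are never used below
  (except in \<open>self_module\<close>, where they are inherited from the ring).
\<close>

definition self_module :: "('a, 'b) ring_scheme \<Rightarrow> ('a, 'a) module" where
  "self_module R =
    \<lparr>carrier = carrier R, monoid.mult = monoid.mult R, one = one R, zero = zero R, add = add R,
     smult = monoid.mult R\<rparr>"

definition quot_module ::
    "('a, 'b) ring_scheme \<Rightarrow> ('a, 'c, 'd) module_scheme \<Rightarrow> 'c set \<Rightarrow> ('a, 'c set) module" where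
  "quot_module R M N =
    \<lparr>carrier = a_rcosets\<^bsub>M\<^esub> N, monoid.mult = undefined, one = undefined, zero = N, add = set_add M,
     smult = (\<lambda>a X. \<Union>x\<in>X. N +>\<^bsub>M\<^esub> (a \<odot>\<^bsub>M\<^esub> x))\<rparr>"

lemma (in cring) module_self: "module R (self_module R)"
  by (rule moduleI)
     (auto simp: self_module_def l_distr r_distr m_assoc is_cring
       intro!: abelian_groupI a_assoc a_comm intro: l_neg a_inv_closed add.l_inv_ex)

lemma (in module) quot_module_smult:
  assumes N: "submodule N R M" and a: "a \<in> carrier R" and x: "x \<in> carrier M"
  shows "a \<odot>\<^bsub>quot_module R M N\<^esub> (N +>\<^bsub>M\<^esub> x) = N +>\<^bsub>M\<^esub> (a \<odot>\<^bsub>M\<^esub> x)"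
proof -
  interpret N: submodule N R M by fact
  interpret AN: abelian_subgroup N M
    by (intro abelian_subgroupI3 additive_subgroupI N.subgroup_axioms M.abelian_group_axioms)
  have "N +>\<^bsub>M\<^esub> (a \<odot>\<^bsub>M\<^esub> y) = N +>\<^bsub>M\<^esub> (a \<odot>\<^bsub>M\<^esub> x)" if "y \<in> N +>\<^bsub>M\<^esub> x" for y
  proof -
    from that obtain h where h: "h \<in> N" "y = h \<oplus>\<^bsub>M\<^esub> x"
      by (auto simp: a_r_coset_def r_coset_def)
    have hc: "h \<in> carrier M" using h(1) by (rule AN.a_Hcarr)
    have e: "a \<odot>\<^bsub>M\<^esub> y = a \<odot>\<^bsub>M\<^esub> h \<oplus>\<^bsub>M\<^esub> a \<odot>\<^bsub>M\<^esub> x" using h hc a x by (simp add: smult_r_distr)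
    have "a \<odot>\<^bsub>M\<^esub> y \<in> N +>\<^bsub>M\<^esub> (a \<odot>\<^bsub>M\<^esub> x)"
      unfolding e a_r_coset_def r_coset_def using N.smult_closed[OF a h(1)] by auto
    moreover have "a \<odot>\<^bsub>M\<^esub> x \<in> carrier M" using a x by (rule smult_closed)
    ultimately show ?thesis
      using M.a_repr_independence[OF _ _ N.subgroup_axioms] by simp
  qed
  moreover have "x \<in> N +>\<^bsub>M\<^esub> x" using x by (rule AN.a_rcos_self)
  ultimately have "(\<Union>y\<in>N +>\<^bsub>M\<^esub> x. N +>\<^bsub>M\<^esub> (a \<odot>\<^bsub>M\<^esub> y)) = N +>\<^bsub>M\<^esub> (a \<odot>\<^bsub>M\<^esub> x)"
    by blast
  thus ?thesis by (simp add: quot_module_def)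
qed

text \<open>\<open>R\<^sup>n\<close>, with vectors as functions on \<open>{..<n}\<close> that are \<open>undefined\<close> elsewhere.\<close>

definition free_module :: "('a, 'b) ring_scheme \<Rightarrow> nat \<Rightarrow> ('a, nat \<Rightarrow> 'a) module" where
  "free_module R n =
    \<lparr>carrier = {..<n} \<rightarrow>\<^sub>E carrier R, monoid.mult = undefined, one = undefined,
     zero = (\<lambda>i\<in>{..<n}. \<zero>\<^bsub>R\<^esub>),
     add = (\<lambda>x y. \<lambda>i\<in>{..<n}. x i \<oplus>\<^bsub>R\<^esub> y i),
     smult = (\<lambda>a x. \<lambda>i\<in>{..<n}. a \<otimes>\<^bsub>R\<^esub> x i)\<rparr>"

lemma (in cring) module_free: "module R (free_module R n)"
proof (rule moduleI)
  show "abelian_group (free_module R n)"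
  proof (rule abelian_groupI)
    fix x assume x: "x \<in> carrier (free_module R n)"
    show "\<exists>y\<in>carrier (free_module R n). y \<oplus>\<^bsub>free_module R n\<^esub> x = \<zero>\<^bsub>free_module R n\<^esub>"
      using x by (intro bexI[of _ "\<lambda>i\<in>{..<n}. \<ominus> x i"])
        (auto simp: free_module_def PiE_iff l_neg intro!: restrict_ext)
  next
    fix x y z
    assume "x \<in> carrier (free_module R n)" "y \<in> carrier (free_module R n)"
      "z \<in> carrier (free_module R n)"
    then show "x \<oplus>\<^bsub>free_module R n\<^esub> y \<oplus>\<^bsub>free_module R n\<^esub> z =
        x \<oplus>\<^bsub>free_module R n\<^esub> (y \<oplus>\<^bsub>free_module R n\<^esub> z)"
      by (auto simp: free_module_def PiE_iff a_assoc intro!: restrict_ext)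
  next
    fix x y assume "x \<in> carrier (free_module R n)" "y \<in> carrier (free_module R n)"
    then show "x \<oplus>\<^bsub>free_module R n\<^esub> y = y \<oplus>\<^bsub>free_module R n\<^esub> x"
      by (auto simp: free_module_def PiE_iff intro!: restrict_ext a_comm)
  qed (auto simp: free_module_def PiE_iff extensional_def fun_eq_iff restrict_def)
qed (auto simp: free_module_def PiE_iff extensional_def l_distr r_distr m_assoc fun_eq_iff restrict_def is_cring)

definition mod_hom ::
    "('a, 'b) ring_scheme \<Rightarrow> ('a, 'c, 'd) module_scheme \<Rightarrow> ('a, 'e, 'f) module_scheme \<Rightarrow> ('c \<Rightarrow> 'e) set"
  where
  "mod_hom R M N =
    {f \<in> carrier M \<rightarrow> carrier N.
       (\<forall>x\<in>carrier M. \<forall>y\<in>carrier M. f (x \<oplus>\<^bsub>M\<^esub> y) = f x \<oplus>\<^bsub>N\<^esub> f y) \<and>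
       (\<forall>a\<in>carrier R. \<forall>x\<in>carrier M. f (a \<odot>\<^bsub>M\<^esub> x) = a \<odot>\<^bsub>N\<^esub> f x)}"

definition mod_iso ::
    "('a, 'b) ring_scheme \<Rightarrow> ('a, 'c, 'd) module_scheme \<Rightarrow> ('a, 'e, 'f) module_scheme \<Rightarrow> bool" where
  "mod_iso R M N \<longleftrightarrow> (\<exists>f \<in> mod_hom R M N. bij_betw f (carrier M) (carrier N))"

definition mod_fin_gen :: "('a, 'b) ring_scheme \<Rightarrow> ('a, 'c, 'd) module_scheme \<Rightarrow> bool" where
  "mod_fin_gen R M \<longleftrightarrow>
    (\<exists>A. finite A \<and> A \<subseteq> carrier M \<and>
       (\<forall>x\<in>carrier M. \<exists>c \<in> A \<rightarrow> carrier R. x = (\<Oplus>\<^bsub>M\<^esub>a\<in>A. c a \<odot>\<^bsub>M\<^esub> a)))"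

text \<open>
  Every finitely generated \<open>R\<close>-module is isomorphic to one whose elements have type
  \<open>(nat \<Rightarrow> 'a) set\<close>. Quantifying over modules with elements of this type thus covers all
  finitely generated modules.
\<close>

lemma fin_gen_module_representative:
  fixes R :: "('a, 'b) ring_scheme" and M :: "('a, 'c, 'd) module_scheme"
  assumes M: "module R M" and fg: "mod_fin_gen R M"
  obtains M' :: "('a, (nat \<Rightarrow> 'a) set) module" where "module R M'" "mod_iso R M M'"
proof -
  interpret M: module R M by fact
  obtain A where A: "finite A" "A \<subseteq> carrier M"
    "\<forall>x\<in>carrier M. \<exists>c \<in> A \<rightarrow> carrier R. x = (\<Oplus>\<^bsub>M\<^esub>a\<in>A. c a \<odot>\<^bsub>M\<^esub> a)"
    using fg unfolding mod_fin_gen_def by blast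
  obtain e where e: "bij_betw e A {..<card A}"
    using ex_bij_betw_finite_nat[OF A(1)] by (auto simp: atLeast0LessThan)
  define g where "g x = {c. x = (\<Oplus>\<^bsub>M\<^esub>a\<in>A. c (e a) \<odot>\<^bsub>M\<^esub> a) \<and> (\<forall>a\<in>A. c (e a) \<in> carrier R)}" for x
  have ne: "g x \<noteq> {}" if x: "x \<in> carrier M" for x
  proof -
    obtain c where c: "c \<in> A \<rightarrow> carrier R" "x = (\<Oplus>\<^bsub>M\<^esub>a\<in>A. c a \<odot>\<^bsub>M\<^esub> a)" using A x by blast
    have inv: "inv_into A e (e a) = a" if "a \<in> A" for a
      using e that by (meson bij_betw_def inv_into_f_f)
    have "(\<Oplus>\<^bsub>M\<^esub>a\<in>A. c (inv_into A e (e a)) \<odot>\<^bsub>M\<^esub> a) = (\<Oplus>\<^bsub>M\<^esub>a\<in>A. c a \<odot>\<^bsub>M\<^esub> a)"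
      using c A by (intro M.M.finsum_cong') (auto simp: inv)
    then have "c \<circ> inv_into A e \<in> g x" unfolding g_def using c by (auto simp: inv)
    thus ?thesis by blast
  qed
  have inj: "inj_on g (carrier M)"
  proof (rule inj_onI)
    fix x y assume "x \<in> carrier M" "y \<in> carrier M" "g x = g y"
    with ne obtain c where "c \<in> g x" "c \<in> g y" by blast
    thus "x = y" unfolding g_def by blast
  qed
  define h where "h = inv_into (carrier M) g"
  have h: "h (g x) = x" if "x \<in> carrier M" for x
    unfolding h_def using inj that by simp
  define M' :: "('a, (nat \<Rightarrow> 'a) set) module" where "M' = \<lparr>carrier = g ` carrier M, monoid.mult = undefined, one = undefined,
    zero = g \<zero>\<^bsub>M\<^esub>, add = (\<lambda>x y. g (h x \<oplus>\<^bsub>M\<^esub> h y)), smult = (\<lambda>a x. g (a \<odot>\<^bsub>M\<^esub> h x))\<rparr>"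
  have "module R M'"
  proof (rule moduleI)
    show "abelian_group M'"
    proof (rule abelian_groupI)
      fix x assume "x \<in> carrier M'"
      thus "\<exists>y\<in>carrier M'. y \<oplus>\<^bsub>M'\<^esub> x = \<zero>\<^bsub>M'\<^esub>"
        by (auto simp: M'_def h M.M.l_neg intro!: bexI[of _ "\<ominus>\<^bsub>M\<^esub> h x"])
    next
      fix x y assume "x \<in> carrier M'" "y \<in> carrier M'"
      thus "x \<oplus>\<^bsub>M'\<^esub> y = y \<oplus>\<^bsub>M'\<^esub> x"
        by (auto simp: M'_def h intro!: arg_cong[of _ _ g] M.M.a_comm)
    qed (auto simp: M'_def h M.M.a_assoc)
  qed (auto simp: M'_def h M.R.is_cring M.smult_l_distr M.smult_r_distr M.smult_assoc1)
  moreover have "g \<in> mod_hom R M M'" "bij_betw g (carrier M) (carrier M')"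
    using inj by (auto simp: mod_hom_def M'_def h bij_betw_def)
  ultimately show thesis using that unfolding mod_iso_def by blast
qed

text \<open>Coefficient families are extensional, so that uniqueness refers to their values on \<open>B\<close>.\<close>

definition finite_basis ::
    "('a, 'b) ring_scheme \<Rightarrow> ('a, 'c, 'd) module_scheme \<Rightarrow> 'c set \<Rightarrow> bool" where
  "finite_basis R M B \<longleftrightarrow>
    finite B \<and> B \<subseteq> carrier M \<and>
    (\<forall>x\<in>carrier M. \<exists>!c. c \<in> B \<rightarrow>\<^sub>E carrier R \<and> x = (\<Oplus>\<^bsub>M\<^esub>b\<in>B. c b \<odot>\<^bsub>M\<^esub> b))"

text \<open>For finitely generated modules over a nonzero ring every basis is finite, so this is
  freeness for such modules.\<close>

definition fin_free :: "('a, 'b) ring_scheme \<Rightarrow> ('a, 'c, 'd) module_scheme \<Rightarrow> bool" where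
  "fin_free R M \<longleftrightarrow> (\<exists>B. finite_basis R M B)"

definition vector_dim :: "('a, 'b) ring_scheme \<Rightarrow> ('a, 'c, 'd) module_scheme \<Rightarrow> nat" where
  "vector_dim K V = (THE d. \<exists>B. finite_basis K V B \<and> card B = d)"

definition direct_summand ::
    "('a, 'b) ring_scheme \<Rightarrow> ('a, 'c, 'd) module_scheme \<Rightarrow> ('a, 'e, 'f) module_scheme \<Rightarrow> bool" where
  "direct_summand R K N \<longleftrightarrow>
    (\<exists>A B. submodule A R N \<and> submodule B R N \<and>
       A \<inter> B = {\<zero>\<^bsub>N\<^esub>} \<and> A <+>\<^bsub>N\<^esub> B = carrier N \<and> mod_iso R K (N\<lparr>carrier := A\<rparr>))"


section \<open>Local rings, depth, dimension\<close>

locale noetherian_local_ring = cring R + noetherian_ring R for R (structure) +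
  fixes \<mm> :: "'a set"
  assumes maximal: "maximalideal \<mm> R"
    and unique_maximal: "maximalideal J R \<Longrightarrow> J = \<mm>"

definition residue_module :: "('a, 'b) ring_scheme \<Rightarrow> 'a set \<Rightarrow> ('a, 'a set) module" where
  "residue_module R \<mm> = quot_module R (self_module R) \<mm>"

definition regular_sequence :: "('a, 'b) ring_scheme \<Rightarrow> 'a list \<Rightarrow> bool" where
  "regular_sequence R xs \<longleftrightarrow>
    set xs \<subseteq> carrier R \<and> Idl\<^bsub>R\<^esub> (set xs) \<noteq> carrier R \<and>
    (\<forall>i<length xs. \<forall>a\<in>carrier R.
       xs ! i \<otimes>\<^bsub>R\<^esub> a \<in> Idl\<^bsub>R\<^esub> (set (take i xs)) \<longrightarrow> a \<in> Idl\<^bsub>R\<^esub> (set (take i xs)))"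

definition ring_depth :: "('a, 'b) ring_scheme \<Rightarrow> 'a set \<Rightarrow> enat" where
  "ring_depth R \<mm> = Sup {enat (length xs) | xs. set xs \<subseteq> \<mm> \<and> regular_sequence R xs}"

definition krull_dim :: "('a, 'b) ring_scheme \<Rightarrow> enat" where
  "krull_dim R =
    Sup {enat n | n. \<exists>P. (\<forall>i\<le>n. primeideal (P i) R) \<and> (\<forall>i<n. P i \<subset> P (Suc i))}"

abbreviation ideal_power :: "('a, 'b) ring_scheme \<Rightarrow> 'a set \<Rightarrow> nat \<Rightarrow> 'a set" where
  "ideal_power R I n \<equiv> I [^]\<^bsub>ideals_set R\<^esub> n"

text \<open>
  The \<open>R/\<mm>\<close>-module structure of an \<open>R\<close>-module \<open>V\<close> with \<open>\<mm>V = 0\<close>. A coset acts through any of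
  its representatives; the image under \<open>the_elem\<close> is a singleton because \<open>\<mm>V = 0\<close>.
\<close>

definition residue_space ::
    "('a, 'b) ring_scheme \<Rightarrow> ('a, 'c, 'd) module_scheme \<Rightarrow> ('a set, 'c) module" where
  "residue_space R V =
    \<lparr>carrier = carrier V, monoid.mult = monoid.mult V, one = one V, zero = zero V, add = add V,
     smult = (\<lambda>X v. the_elem ((\<lambda>a. a \<odot>\<^bsub>V\<^esub> v) ` X))\<rparr>"

lemma (in noetherian_local_ring) residue_space_smult:
  assumes V: "module R V" and ann: "\<And>a x. a \<in> \<mm> \<Longrightarrow> x \<in> carrier V \<Longrightarrow> a \<odot>\<^bsub>V\<^esub> x = \<zero>\<^bsub>V\<^esub>"
    and a: "a \<in> carrier R" and x: "x \<in> carrier V"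
  shows "(\<mm> +> a) \<odot>\<^bsub>residue_space R V\<^esub> x = a \<odot>\<^bsub>V\<^esub> x"
proof -
  interpret V: module R V by fact
  interpret I: maximalideal \<mm> R by (rule maximal)
  have "(h \<oplus> a) \<odot>\<^bsub>V\<^esub> x = a \<odot>\<^bsub>V\<^esub> x" if "h \<in> \<mm>" for h
    using that a x ann I.a_Hcarr[OF that] by (simp add: V.smult_l_distr)
  moreover have "a \<in> \<mm> +> a" using a by (rule I.a_rcos_self)
  ultimately have "(\<lambda>a. a \<odot>\<^bsub>V\<^esub> x) ` (\<mm> +> a) = {a \<odot>\<^bsub>V\<^esub> x}"
    by (auto simp: a_r_coset_def r_coset_def)
  thus ?thesis by (simp add: residue_space_def)
qed

text \<open>\<open>dim\<^sub>k (\<mm>/J)\<close> for an ideal \<open>J\<close> with \<open>\<mm>\<^sup>2 \<subseteq> J \<subseteq> \<mm>\<close>, where \<open>k = R/\<mm>\<close>.\<close>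

definition dim_max_quot :: "('a, 'b) ring_scheme \<Rightarrow> 'a set \<Rightarrow> 'a set \<Rightarrow> nat" where
  "dim_max_quot R \<mm> J =
    vector_dim (R Quot \<mm>)
      (residue_space R (quot_module R ((self_module R)\<lparr>carrier := \<mm>\<rparr>) J))"

definition regular_local_ring :: "('a, 'b) ring_scheme \<Rightarrow> 'a set \<Rightarrow> bool" where
  "regular_local_ring S \<nn> \<longleftrightarrow>
    noetherian_local_ring S \<nn> \<and> krull_dim S = enat (dim_max_quot S \<nn> (ideal_power S \<nn> 2))"


section \<open>Syzygies in minimal free resolutions\<close>

text \<open>
  \<open>\<dots> \<rightarrow> R\<^bsup>b 2\<^esup> \<rightarrow> R\<^bsup>b 1\<^esup> \<rightarrow> R\<^bsup>b 0\<^esup> \<rightarrow> M \<rightarrow> 0\<close> with augmentation \<open>\<epsilon>\<close> and differentials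
  \<open>d i : R\<^bsup>b i\<^esup> \<rightarrow> R\<^bsup>b (i-1)\<^esup>\<close> for \<open>i \<ge> 1\<close>; the value \<open>d 0\<close> is irrelevant.
  Minimality is \<open>d i (R\<^bsup>b i\<^esup>) \<subseteq> \<mm> R\<^bsup>b (i-1)\<^esup>\<close>, and \<open>\<mm> R\<^sup>n\<close> consists of the vectors with all
  entries in \<open>\<mm>\<close>.
\<close>

definition minimal_free_resolution ::
    "('a, 'b) ring_scheme \<Rightarrow> 'a set \<Rightarrow> ('a, 'c, 'd) module_scheme \<Rightarrow>
     (nat \<Rightarrow> nat) \<Rightarrow> ((nat \<Rightarrow> 'a) \<Rightarrow> 'c) \<Rightarrow> (nat \<Rightarrow> (nat \<Rightarrow> 'a) \<Rightarrow> (nat \<Rightarrow> 'a)) \<Rightarrow> bool" where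
  "minimal_free_resolution R \<mm> M b \<epsilon> d \<longleftrightarrow>
    (let F = (\<lambda>i. free_module R (b i)) in
      \<epsilon> \<in> mod_hom R (F 0) M \<and>
      (\<forall>i. d (Suc i) \<in> mod_hom R (F (Suc i)) (F i)) \<and>
      \<epsilon> ` carrier (F 0) = carrier M \<and>
      d 1 ` carrier (F 1) = {x \<in> carrier (F 0). \<epsilon> x = \<zero>\<^bsub>M\<^esub>} \<and>
      (\<forall>i. d (Suc (Suc i)) ` carrier (F (Suc (Suc i))) =
           {x \<in> carrier (F (Suc i)). d (Suc i) x = \<zero>\<^bsub>F i\<^esub>}) \<and>
      (\<forall>i. d (Suc i) ` carrier (F (Suc i)) \<subseteq> {..<b i} \<rightarrow>\<^sub>E \<mm>))"

text \<open>
  \<open>is_syzygy R \<mm> n M Z\<close>, for \<open>n \<ge> 1\<close>: \<open>Z\<close> is the \<open>n\<close>-th syzygy \<open>\<Omega>\<^sup>n(M)\<close>, the image of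
  \<open>d n\<close> in \<open>R\<^bsup>b (n-1)\<^esup>\<close>, computed from some minimal free resolution of \<open>M\<close>. Over a noetherian
  local ring, every finitely generated module has a minimal free resolution and any two are
  isomorphic, so \<open>Z\<close> exists and is determined up to isomorphism.
\<close>

definition is_syzygy ::
    "('a, 'b) ring_scheme \<Rightarrow> 'a set \<Rightarrow> nat \<Rightarrow> ('a, 'c, 'd) module_scheme \<Rightarrow>
     ('a, nat \<Rightarrow> 'a) module \<Rightarrow> bool" where
  "is_syzygy R \<mm> n M Z \<longleftrightarrow>
    (\<exists>b \<epsilon> d. minimal_free_resolution R \<mm> M b \<epsilon> d \<and>
       Z = (free_module R (b (n - 1)))\<lparr>carrier := d n ` carrier (free_module R (b n))\<rparr>)"


section \<open>Completion, Cohen presentations and the Burch index\<close>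

text \<open>
  The \<open>\<mm>\<close>-adic completion, as the inverse limit of the rings \<open>R/\<mm>\<^sup>n\<close>. For cosets, the inclusion
  \<open>f (Suc n) \<subseteq> f n\<close> says that \<open>R/\<mm>\<^bsup>n+1\<^esup> \<rightarrow> R/\<mm>\<^sup>n\<close> maps \<open>f (Suc n)\<close> to \<open>f n\<close>.
\<close>

definition adic_completion :: "('a, 'b) ring_scheme \<Rightarrow> 'a set \<Rightarrow> (nat \<Rightarrow> 'a set) ring" where
  "adic_completion R \<mm> =
    (let Q = (\<lambda>n. R Quot (ideal_power R \<mm> n)) in
      \<lparr>carrier = {f. \<forall>n. f n \<in> carrier (Q n) \<and> f (Suc n) \<subseteq> f n},
       monoid.mult = (\<lambda>f g n. f n \<otimes>\<^bsub>Q n\<^esub> g n), one = (\<lambda>n. \<one>\<^bsub>Q n\<^esub>),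
       zero = (\<lambda>n. \<zero>\<^bsub>Q n\<^esub>), add = (\<lambda>f g n. f n \<oplus>\<^bsub>Q n\<^esub> g n)\<rparr>)"

definition minimal_cohen_presentation ::
    "('a, 'b) ring_scheme \<Rightarrow> 'a set \<Rightarrow> ('s, 't) ring_scheme \<Rightarrow> 's set \<Rightarrow> 's set \<Rightarrow> bool" where
  "minimal_cohen_presentation R \<mm> S \<nn> I \<longleftrightarrow>
    regular_local_ring S \<nn> \<and> ideal I S \<and> I \<subseteq> ideal_power S \<nn> 2 \<and>
    adic_completion R \<mm> \<simeq> S Quot I"

definition ideal_colon :: "('a, 'b) ring_scheme \<Rightarrow> 'a set \<Rightarrow> 'a set \<Rightarrow> 'a set" where
  "ideal_colon S I J = {s \<in> carrier S. \<forall>j\<in>J. s \<otimes>\<^bsub>S\<^esub> j \<in> I}"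

definition burch_index :: "('s, 't) ring_scheme \<Rightarrow> 's set \<Rightarrow> 's set \<Rightarrow> nat" where
  "burch_index S \<nn> I =
    dim_max_quot S \<nn> (ideal_colon S (ideal_prod S I \<nn>) (ideal_colon S I \<nn>))"

text \<open>
  The Burch index of a local ring of depth \<open>0\<close> is computed from a minimal Cohen presentation
  \<open>S/I\<close> of the completion and does not depend on its choice. Hence \<open>R\<close> is Burch if the index
  is at least \<open>1\<close> for every presentation. HOL cannot quantify over the type of elements
  of \<open>S\<close>, so this type is a parameter, given by the first argument. A presentation exists by
  Cohen's structure theorem, and on cardinality grounds \<open>S\<close> can be chosen with
  elements in \<open>nat \<Rightarrow> 'a\<close>.
\<close>

definition burch_ring :: "'s itself \<Rightarrow> ('a, 'b) ring_scheme \<Rightarrow> 'a set \<Rightarrow> bool" where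
  "burch_ring _ R \<mm> \<longleftrightarrow>
    (\<forall>(S :: 's ring) \<nn> I. minimal_cohen_presentation R \<mm> S \<nn> I \<longrightarrow> burch_index S \<nn> I \<ge> 1)"

end

theory Submission
  imports Defs
begin

text \<open>
  Let \<open>y\<close> be a minimal system of generators of \<open>\<mm>\<close>, of length \<open>e\<close>. The complex
  \<open>R \<rightarrow> R\<^sup>e\<close> given by \<open>y\<close> has the socle of \<open>R\<close> as its kernel. So the second syzygy of
  \<open>M = R\<^sup>e/Ry\<close> is \<open>k\<^sup>r\<close>, where \<open>r\<close> is the dimension of the socle, and its fourth syzygy is
  \<open>\<Omega>\<^sup>2(k)\<^sup>r\<close>. If \<open>k\<close> is a summand of it, then the socle is nonzero (depth \<open>0\<close>), and some vector
  \<open>a\<close> of socle elements does not lie in \<open>\<mm>\<Omega>\<^sup>2(k)\<close>.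

  Suppose now that \<open>\<nn>(I : \<nn>) \<subseteq> I\<nn>\<close> for a minimal presentation \<open>S/I\<close> of the completion. Lift \<open>y\<close> to
  generators \<open>x\<close> of \<open>\<nn>\<close> and \<open>a\<close> to elements \<open>s\<^sub>i \<in> (I : \<nn>)\<close>. Then \<open>\<Sum> s\<^sub>i x\<^sub>i = \<Sum> b\<^sub>i x\<^sub>i\<close> with
  \<open>b\<^sub>i \<in> I\<close>, and \<open>s - b\<close> is a combination of Koszul relations because \<open>x\<close> is a regular sequence. Its
  coefficients lie in \<open>\<nn>\<close> because the entries of \<open>s - b\<close> lie in \<open>\<nn>\<^sup>2\<close>. Modulo \<open>I\<close> this puts \<open>a\<close> into
  \<open>\<mm>\<Omega>\<^sup>2(k)\<close>, up to an error in an arbitrarily high power of \<open>\<mm>\<close>, a contradiction.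
\<close>

section \<open>Ideals saturated at a prime\<close>

text \<open>The syzygies live over \<open>R\<close>, while the Burch condition lives in a regular
  ring that presents only the completion. The two are compared by the relation
  \<open>rep n s r\<close>, modulo one power \<mm>^n at a time, so an identity carried from
  \<open>S\<close> to \<open>R\<close> has an error term. The error is harmless because the
  submodule that separates the socle vector from \<mm> times the syzygies can be enlarged until it
  contains all vectors with entries in some \<mm>^t (\<open>socle_element_avoided\<close>). That the
  lifted socle entries lie in \<nn>^2 is not automatic: it follows from the assumption on \<nn>(I :
  \<nn>) by a first use of the Koszul relations (\<open>socle_in_square\<close>), before the main
  one. The inclusion of \<open>I\<close> in \<nn>^2 makes the lifts of \<open>y\<close> a minimal
  system of generators of \<nn>. Their number is then the embedding dimension of \<open>S\<close>,
  which by regularity is its Krull dimension. Krull's principal ideal theorem turns this count into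
  regularity of the sequence, and it is the reason for the theory of primes that opens the
  proof.\<close>

locale noetherian_cring = cring R + noetherian_ring R for R (structure)

context cring begin

lemma ideal_criterion:
  assumes "I \<subseteq> carrier R" "\<zero> \<in> I" "\<And>a b. a \<in> I \<Longrightarrow> b \<in> I \<Longrightarrow> a \<oplus> b \<in> I"
    "\<And>a r. a \<in> I \<Longrightarrow> r \<in> carrier R \<Longrightarrow> r \<otimes> a \<in> I"
  shows "ideal I R"
proof (rule idealI)
  show "subgroup I (add_monoid R)"
  proof (rule add.subgroupI)
    fix a assume a: "a \<in> I"
    have "\<ominus> a = (\<ominus> \<one>) \<otimes> a" using a assms(1) by (auto simp: l_minus)
    then show "\<ominus> a \<in> I" using assms(4)[OF a] by simp
  qed (use assms in auto)
  fix a x assume "a \<in> I" "x \<in> carrier R"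
  then show "x \<otimes> a \<in> I" "a \<otimes> x \<in> I" using assms(1,4) m_comm by (auto simp: subset_iff)
qed (rule ring_axioms)

lemma ideal_finsum_closed:
  assumes "ideal I R" "\<And>i. i \<in> A \<Longrightarrow> f i \<in> I"
  shows "(\<Oplus>i\<in>A. f i) \<in> I"
proof -
  interpret ideal I R by fact
  from assms(2) show ?thesis
  proof (induct A rule: infinite_finite_induct)
    case (insert x F)
    then show ?case using Icarr by (subst finsum_insert) auto
  qed auto
qed

lemma mem_ideal_add_cgenideal:
  "a \<in> L <+>\<^bsub>R\<^esub> PIdl g \<longleftrightarrow> (\<exists>l\<in>L. \<exists>r\<in>carrier R. a = l \<oplus> r \<otimes> g)"
  by (auto simp: set_add_def' cgenideal_def)

lemma ideal_add_cgenideal: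
  assumes "ideal L R" "g \<in> carrier R"
  shows "ideal (L <+>\<^bsub>R\<^esub> PIdl g) R" "L \<subseteq> L <+>\<^bsub>R\<^esub> PIdl g" "g \<in> L <+>\<^bsub>R\<^esub> PIdl g"
proof -
  interpret L: ideal L R by fact
  show "ideal (L <+>\<^bsub>R\<^esub> PIdl g) R" using assms by (simp add: add_ideals cgenideal_ideal)
  show "L \<subseteq> L <+>\<^bsub>R\<^esub> PIdl g"
  proof
    fix a assume a: "a \<in> L"
    then have "a = a \<oplus> \<zero> \<otimes> g" using assms(2) L.Icarr by simp
    then show "a \<in> L <+>\<^bsub>R\<^esub> PIdl g" unfolding mem_ideal_add_cgenideal using a by blast
  qed
  show "g \<in> L <+>\<^bsub>R\<^esub> PIdl g"
    unfolding mem_ideal_add_cgenideal using assms(2) by (intro bexI[of _ \<zero>] bexI[of _ \<one>]) auto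
qed

lemma ideal_colon_ideal:
  assumes "ideal L R" "J \<subseteq> carrier R"
  shows "ideal (ideal_colon R L J) R"
proof -
  interpret L: ideal L R by fact
  show ?thesis
    by (rule ideal_criterion) (use assms(2) in \<open>auto simp: ideal_colon_def l_distr m_assoc L.I_l_closed subset_iff\<close>)
qed

text \<open>The contraction to \<open>R\<close> of the extension of \<open>J\<close> to the
  localization at \<open>P\<close>. For prime \<open>P\<close>, the ideals fixed by this operation
  stand for the ideals of the local ring.\<close>

definition local_sat :: "'a set \<Rightarrow> 'a set \<Rightarrow> 'a set" where
  "local_sat P J = {a \<in> carrier R. \<exists>t\<in>carrier R - P. t \<otimes> a \<in> J}"

lemma local_satI: "a \<in> carrier R \<Longrightarrow> t \<in> carrier R \<Longrightarrow> t \<notin> P \<Longrightarrow> t \<otimes> a \<in> J \<Longrightarrow> a \<in> local_sat P J"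
  by (auto simp: local_sat_def)

lemma local_sat_mono: "J \<subseteq> K \<Longrightarrow> local_sat P J \<subseteq> local_sat P K"
  by (auto simp: local_sat_def)

lemma local_sat_superset:
  assumes "primeideal P R" "ideal J R"
  shows "J \<subseteq> local_sat P J"
proof
  interpret P: primeideal P R by fact
  interpret J: ideal J R by fact
  fix a assume "a \<in> J"
  then show "a \<in> local_sat P J"
    using P.one_imp_carrier P.I_notcarr J.Icarr by (intro local_satI[of _ \<one>]) auto
qed

lemma local_sat_ideal:
  assumes "primeideal P R" "ideal J R"
  shows "ideal (local_sat P J) R"
proof (rule ideal_criterion)
  interpret P: primeideal P R by fact
  interpret J: ideal J R by fact
  show "local_sat P J \<subseteq> carrier R" by (auto simp: local_sat_def)
  show "\<zero> \<in> local_sat P J" using local_sat_superset[OF assms] by auto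
  fix a assume "a \<in> local_sat P J"
  then obtain t where t: "t \<in> carrier R" "t \<notin> P" "t \<otimes> a \<in> J" "a \<in> carrier R"
    by (auto simp: local_sat_def)
  {
    fix b assume "b \<in> local_sat P J"
    then obtain u where u: "u \<in> carrier R" "u \<notin> P" "u \<otimes> b \<in> J" "b \<in> carrier R"
      by (auto simp: local_sat_def)
    have "t \<otimes> u \<notin> P" using P.I_prime t u by blast
    moreover have "(t \<otimes> u) \<otimes> (a \<oplus> b) = u \<otimes> (t \<otimes> a) \<oplus> t \<otimes> (u \<otimes> b)" using t u by algebra
    ultimately show "a \<oplus> b \<in> local_sat P J"
      using t u by (intro local_satI[of _ "t \<otimes> u"]) (auto simp: J.I_l_closed)
  }
  fix r assume r: "r \<in> carrier R"
  have "t \<otimes> (r \<otimes> a) = r \<otimes> (t \<otimes> a)" using t r by algebra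
  then show "r \<otimes> a \<in> local_sat P J" using t r by (intro local_satI[of _ t]) (auto simp: J.I_l_closed)
qed

lemma local_sat_idem:
  assumes "primeideal P R"
  shows "local_sat P (local_sat P J) = local_sat P J"
proof
  interpret P: primeideal P R by fact
  show "local_sat P (local_sat P J) \<subseteq> local_sat P J"
  proof
    fix a assume "a \<in> local_sat P (local_sat P J)"
    then obtain t u where t: "t \<in> carrier R" "t \<notin> P" "a \<in> carrier R" "u \<in> carrier R" "u \<notin> P" "u \<otimes> (t \<otimes> a) \<in> J"
      by (auto simp: local_sat_def)
    then show "a \<in> local_sat P J"
      using P.I_prime[of u t] by (intro local_satI[of _ "u \<otimes> t"]) (auto simp: m_assoc)
  qed
  show "local_sat P J \<subseteq> local_sat P (local_sat P J)"
  proof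
    fix a assume a: "a \<in> local_sat P J"
    then have "a \<in> carrier R" by (auto simp: local_sat_def)
    then show "a \<in> local_sat P (local_sat P J)"
      using a P.one_imp_carrier P.I_notcarr by (intro local_satI[of a \<one>]) auto
  qed
qed

text \<open>A larger prime allows fewer denominators. This lets one symbolic power be used both at
  its own prime and at a larger one.\<close>

lemma local_sat_smaller:
  assumes "primeideal P R" "P \<subseteq> P'" "local_sat P L = L"
  shows "local_sat P' L \<subseteq> L"
  using assms by (auto simp: local_sat_def)

end

context noetherian_cring begin

text \<open>A nonempty chain of ideals in a noetherian ring contains its own union, so Zorn's lemma
  applies. The noetherian inductions on ideals below take a maximal counterexample from
  here.\<close>

lemma maximal_ideal_in_family:
  assumes "F \<noteq> {}" "\<And>I. I \<in> F \<Longrightarrow> ideal I R"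
  obtains L where "L \<in> F" "\<And>I. I \<in> F \<Longrightarrow> L \<subseteq> I \<Longrightarrow> I = L"
proof -
  have "\<exists>M\<in>F. \<forall>X\<in>F. M \<subseteq> X \<longrightarrow> X = M"
  proof (rule subset_Zorn)
    fix C assume C: "subset.chain F C"
    show "\<exists>U\<in>F. \<forall>X\<in>C. X \<subseteq> U"
    proof (cases "C = {}")
      case False
      have "subset.chain {I. ideal I R} C" using C assms(2) unfolding pred_on.chain_def by blast
      from ideal_chain_is_trivial[OF False this] have "\<Union>C \<in> C" .
      moreover have "C \<subseteq> F" using C unfolding pred_on.chain_def by blast
      ultimately show ?thesis by (intro bexI[of _ "\<Union>C"]) auto
    qed (use assms(1) in auto)
  qed
  then obtain M where "M \<in> F" "\<forall>X\<in>F. M \<subseteq> X \<longrightarrow> X = M" by blast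
  then show thesis by (intro that[of M]) auto
qed

text \<open>Localising at \<open>P\<close> is replaced by passing to \<open>local_sat P\<close>, so that everything happens
  among the ideals of one ring.\<close>

lemma local_nakayama:
  assumes P: "primeideal P R" and N: "ideal N R" and Nsat: "local_sat P N = N"
    and M: "ideal M R" and MN: "M \<subseteq> local_sat P (N <+>\<^bsub>R\<^esub> P \<cdot>\<^bsub>R\<^esub> M)"
  shows "M \<subseteq> N"
proof (rule ccontr)
  interpret P: primeideal P R by fact
  assume nMN: "\<not> M \<subseteq> N"
  \<comment> \<open>Modulo a maximal member \<open>L\<close> of this family, \<open>M\<close> is
    locally generated by any single \<open>g\<close> in \<open>M\<close> outside \<open>L\<close>.
    The determinant trick behind Nakayama's lemma then needs only one generator.\<close>
  define F where "F = {L. ideal L R \<and> local_sat P L = L \<and> N \<subseteq> L \<and> \<not> M \<subseteq> L}"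
  have "N \<in> F" using N Nsat nMN by (auto simp: F_def)
  then have "F \<noteq> {}" by blast
  moreover have "ideal I R" if "I \<in> F" for I using that by (simp add: F_def)
  ultimately obtain L where L: "L \<in> F" "\<And>I. I \<in> F \<Longrightarrow> L \<subseteq> I \<Longrightarrow> I = L"
    by (rule maximal_ideal_in_family) blast+
  interpret L: ideal L R using L(1) by (simp add: F_def)
  obtain g where g: "g \<in> M" "g \<notin> L" using L(1) by (auto simp: F_def)
  have gc: "g \<in> carrier R" using g M ideal.Icarr by fast
  note Lg = ideal_add_cgenideal[OF L.is_ideal gc]
  define L' where "L' = local_sat P (L <+>\<^bsub>R\<^esub> PIdl g)"
  have L': "ideal L' R" "local_sat P L' = L'" "L \<subseteq> L'" "g \<in> L'"
    using local_sat_ideal[OF P Lg(1)] local_sat_idem[OF P] local_sat_superset[OF P Lg(1)] Lg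
    by (auto simp: L'_def)
  have M_sub_L': "M \<subseteq> L'"
  proof (rule ccontr)
    assume "\<not> M \<subseteq> L'"
    then have "L' \<in> F" using L' L(1) by (auto simp: F_def)
    then show False using L(2) L' g by blast
  qed
  \<comment> \<open>Modulo \<open>L\<close> and up to a denominator outside \<open>P\<close>, every
    element of the product of \<open>P\<close> and \<open>M\<close> is a multiple of
    \<open>g\<close> by an element of \<open>P\<close>.\<close>
  have prod: "\<exists>t\<in>carrier R - P. \<exists>l\<in>L. \<exists>p\<in>P. t \<otimes> v = l \<oplus> p \<otimes> g" if "v \<in> P \<cdot>\<^bsub>R\<^esub> M" for v
    using that
  proof (induct rule: ideal_prod.induct)
    case (prod p u)
    then obtain t l r where t: "t \<in> carrier R" "t \<notin> P" "l \<in> L" "r \<in> carrier R" "t \<otimes> u = l \<oplus> r \<otimes> g"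
      using M_sub_L' by (auto simp: L'_def local_sat_def mem_ideal_add_cgenideal)
    have c: "p \<in> carrier R" "u \<in> carrier R" "l \<in> carrier R"
      using prod P.Icarr ideal.Icarr[OF M] t by auto
    have "t \<otimes> (p \<otimes> u) = p \<otimes> (t \<otimes> u)" using c t by algebra
    also have "\<dots> = p \<otimes> l \<oplus> (r \<otimes> p) \<otimes> g" unfolding t(5) using c t gc by algebra
    finally show ?case using t c prod L.I_l_closed P.I_l_closed by blast
  next
    case (sum v w)
    then obtain t l p t' l' p' where h: "t \<in> carrier R" "t \<notin> P" "l \<in> L" "p \<in> P" "t \<otimes> v = l \<oplus> p \<otimes> g"
      "t' \<in> carrier R" "t' \<notin> P" "l' \<in> L" "p' \<in> P" "t' \<otimes> w = l' \<oplus> p' \<otimes> g" by blast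
    have c: "v \<in> carrier R" "w \<in> carrier R" "l \<in> carrier R" "p \<in> carrier R" "l' \<in> carrier R" "p' \<in> carrier R"
      using sum h ideal_prod_in_carrier[OF P.is_ideal M] L.Icarr P.Icarr by auto
    have "(t \<otimes> t') \<otimes> (v \<oplus> w) = t' \<otimes> (t \<otimes> v) \<oplus> t \<otimes> (t' \<otimes> w)" using h(1,6) c by algebra
    also have "\<dots> = (t' \<otimes> l \<oplus> t \<otimes> l') \<oplus> (t' \<otimes> p \<oplus> t \<otimes> p') \<otimes> g" unfolding h(5,10) using h(1,6) c gc by algebra
    finally have e: "(t \<otimes> t') \<otimes> (v \<oplus> w) = (t' \<otimes> l \<oplus> t \<otimes> l') \<oplus> (t' \<otimes> p \<oplus> t \<otimes> p') \<otimes> g" .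
    have "t \<otimes> t' \<in> carrier R - P" using h P.I_prime by blast
    moreover have "t' \<otimes> l \<oplus> t \<otimes> l' \<in> L" "t' \<otimes> p \<oplus> t \<otimes> p' \<in> P"
      using h by (auto intro!: L.a_closed P.a_closed L.I_l_closed P.I_l_closed)
    ultimately show ?case using e by blast
  qed
  obtain s n v where s: "s \<in> carrier R" "s \<notin> P" "n \<in> N" "v \<in> P \<cdot>\<^bsub>R\<^esub> M" "s \<otimes> g = n \<oplus> v"
  proof -
    have "g \<in> local_sat P (N <+>\<^bsub>R\<^esub> P \<cdot>\<^bsub>R\<^esub> M)" using MN g(1) by blast
    then obtain s where "s \<in> carrier R" "s \<notin> P" "s \<otimes> g \<in> N <+>\<^bsub>R\<^esub> P \<cdot>\<^bsub>R\<^esub> M"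
      by (auto simp: local_sat_def)
    then show thesis using that by (auto simp: set_add_def')
  qed
  obtain t l p where t: "t \<in> carrier R" "t \<notin> P" "l \<in> L" "p \<in> P" "t \<otimes> v = l \<oplus> p \<otimes> g"
    using prod[OF s(4)] by blast
  have nL: "n \<in> L" using L(1) s by (auto simp: F_def)
  have c: "n \<in> carrier R" "v \<in> carrier R" "l \<in> carrier R" "p \<in> carrier R"
    using nL L.Icarr t P.Icarr ideal_prod_in_carrier[OF P.is_ideal M] s by auto
  \<comment> \<open>From s g = n + v and t v = l + p g follows (t s - p) g = t n + l, an element of
    \<open>L\<close>. The factor t s - p lies outside \<open>P\<close>, so saturation puts
    \<open>g\<close> into \<open>L\<close>.\<close>
  have "(t \<otimes> s \<ominus> p) \<otimes> g = t \<otimes> (s \<otimes> g) \<ominus> p \<otimes> g" using c gc t(1) s(1) by algebra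
  also have "\<dots> = t \<otimes> n \<oplus> t \<otimes> v \<ominus> p \<otimes> g" unfolding s(5) using c gc t(1) by algebra
  also have "\<dots> = t \<otimes> n \<oplus> l" unfolding t(5) using c gc t(1) by algebra
  finally have "(t \<otimes> s \<ominus> p) \<otimes> g \<in> L" using t nL by (simp add: L.I_l_closed)
  moreover have "t \<otimes> s \<ominus> p \<notin> P"
  proof
    assume "t \<otimes> s \<ominus> p \<in> P"
    then have "(t \<otimes> s \<ominus> p) \<oplus> p \<in> P" using t by auto
    moreover have "(t \<otimes> s \<ominus> p) \<oplus> p = t \<otimes> s" using t(1) s(1) c by algebra
    ultimately show False using P.I_prime[OF t(1) s(1)] t(2) s(2) by simp
  qed
  ultimately have "g \<in> local_sat P L"
    using gc c(4) t(1) s(1) by (intro local_satI[of g "t \<otimes> s \<ominus> p"]) simp_all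
  moreover have "local_sat P L = L" using L(1) unfolding F_def by blast
  ultimately show False using g(2) by simp
qed

end

section \<open>Krull's principal ideal theorem\<close>

context cring begin

lemma ideal_add_mem: "a \<in> I <+>\<^bsub>R\<^esub> J \<longleftrightarrow> (\<exists>i\<in>I. \<exists>j\<in>J. a = i \<oplus> j)"
  by (auto simp: set_add_def')

lemma ideal_add_mono: "I \<subseteq> I' \<Longrightarrow> J \<subseteq> J' \<Longrightarrow> I <+>\<^bsub>R\<^esub> J \<subseteq> I' <+>\<^bsub>R\<^esub> J'"
  unfolding ideal_add_mem subset_iff by blast

lemma ideal_add_subset:
  assumes "ideal K R" "I \<subseteq> K" "J \<subseteq> K" shows "I <+>\<^bsub>R\<^esub> J \<subseteq> K"
proof
  interpret K: ideal K R by fact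
  fix a assume "a \<in> I <+>\<^bsub>R\<^esub> J"
  then obtain i j where "i \<in> I" "j \<in> J" "a = i \<oplus> j" unfolding ideal_add_mem by blast
  then show "a \<in> K" using assms(2,3) by auto
qed

lemma ideals_set_simps [simp]: "\<one>\<^bsub>ideals_set R\<^esub> = carrier R"
  "I \<otimes>\<^bsub>ideals_set R\<^esub> J = I \<cdot>\<^bsub>R\<^esub> J"
  by (simp_all add: ideals_set_def)

lemma ideal_power_0 [simp]: "ideal_power R I 0 = carrier R"
  and ideal_power_Suc [simp]: "ideal_power R I (Suc n) = ideal_power R I n \<cdot>\<^bsub>R\<^esub> I"
  by (simp_all add: nat_pow_def)

lemma ideal_power_ideal: "ideal I R \<Longrightarrow> ideal (ideal_power R I n) R"
  by (induct n) (auto simp: oneideal ideal_prod_is_ideal)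

lemma ideal_power_Suc_subset: "ideal I R \<Longrightarrow> ideal_power R I (Suc n) \<subseteq> ideal_power R I n"
  using ideal_prod_inter[OF ideal_power_ideal] by simp

lemma ideal_power_subset_prime:
  assumes "ideal I R" "primeideal P R" "ideal_power R I n \<subseteq> P"
  shows "I \<subseteq> P"
  using assms(3)
proof (induct n)
  case 0
  interpret P: primeideal P R by fact
  show ?case using 0 P.I_notcarr P.a_subset by auto
next
  case (Suc n)
  interpret I: ideal I R by fact
  interpret P: primeideal P R by fact
  show ?case
  proof (rule ccontr)
    assume "\<not> I \<subseteq> P"
    then obtain b where b: "b \<in> I" "b \<notin> P" by blast
    have "u \<in> P" if u: "u \<in> ideal_power R I n" for u
    proof -
      have "u \<otimes> b \<in> P" using Suc(2) ideal_prod.prod[OF u b(1)] by auto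
      moreover have "u \<in> carrier R" using u ideal_power_ideal[OF assms(1)] ideal.Icarr by fast
      ultimately show ?thesis using P.I_prime[of u b] b I.Icarr by blast
    qed
    then show False using Suc(1) b by blast
  qed
qed

lemma ideal_minus_closed:
  assumes "ideal I R" "a \<in> I" "b \<in> I" shows "a \<ominus> b \<in> I"
proof -
  interpret ideal I R by fact
  show ?thesis using assms(2,3) by (simp add: minus_eq)
qed

end

context noetherian_cring begin

text \<open>A maximal member of the family of ideals (L : a) with \<open>a\<close> outside
  \<open>L\<close> is prime: if b c lies in (L : a) and c does not, then (L : c a) belongs to the
  family and contains (L : a), so both agree, and b lies in (L : c a).\<close>

lemma exists_associated_prime:
  assumes L: "ideal L R" and ne: "L \<noteq> carrier R"
  obtains a where "a \<in> carrier R" "a \<notin> L" "primeideal (ideal_colon R L {a}) R"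
proof -
  interpret L: ideal L R by fact
  define F where "F = (\<lambda>a. ideal_colon R L {a}) ` (carrier R - L)"
  have "F \<noteq> {}" using ne L.a_subset by (auto simp: F_def)
  moreover have "ideal I R" if "I \<in> F" for I
    using that ideal_colon_ideal[OF L] by (auto simp: F_def)
  ultimately obtain M where M: "M \<in> F" "\<And>I. I \<in> F \<Longrightarrow> M \<subseteq> I \<Longrightarrow> I = M"
    by (rule maximal_ideal_in_family) blast+
  obtain a where a: "a \<in> carrier R" "a \<notin> L" "M = ideal_colon R L {a}" using M(1) by (auto simp: F_def)
  have "primeideal M R"
  proof (rule primeidealI)
    show "ideal M R" using a ideal_colon_ideal[OF L] by simp
    show "carrier R \<noteq> M"
    proof
      assume "carrier R = M"
      then have "\<one> \<in> M" by auto
      then show False using a by (simp add: ideal_colon_def)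
    qed
    fix b c assume bc: "b \<in> carrier R" "c \<in> carrier R" "b \<otimes> c \<in> M"
    show "b \<in> M \<or> c \<in> M"
    proof (rule disjCI)
      assume nc: "c \<notin> M"
      then have "c \<otimes> a \<in> carrier R - L" using a bc by (auto simp: ideal_colon_def)
      then have "ideal_colon R L {c \<otimes> a} \<in> F" by (auto simp: F_def)
      moreover have "M \<subseteq> ideal_colon R L {c \<otimes> a}"
      proof
        fix s assume "s \<in> M"
        then have s: "s \<in> carrier R" "s \<otimes> a \<in> L" using a by (auto simp: ideal_colon_def)
        have "s \<otimes> (c \<otimes> a) = c \<otimes> (s \<otimes> a)" using s(1) a(1) bc(1,2) by algebra
        then show "s \<in> ideal_colon R L {c \<otimes> a}" using s bc by (simp add: ideal_colon_def L.I_l_closed)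
      qed
      ultimately have "ideal_colon R L {c \<otimes> a} = M" by (rule M(2))
      moreover have "b \<in> ideal_colon R L {c \<otimes> a}"
        using bc a by (simp add: ideal_colon_def m_assoc)
      ultimately show "b \<in> M" by simp
    qed
  qed (rule is_cring)
  then show thesis using that a by simp
qed

text \<open>If \<open>P\<close> is minimal over \<open>K\<close>, then \<open>(R/K)\<^sub>P\<close> is artinian. Noetherian induction over a lower
  bound \<open>L\<close> of the chain: a counterexample with \<open>L\<close> maximal survives adjoining to \<open>L\<close> an
  element killed by \<open>P\<close> modulo \<open>L\<close>.\<close>

lemma local_sat_chain_stabilizes:
  assumes P: "primeideal P R" and K: "ideal K R"
    and minimal: "\<And>P'. primeideal P' R \<Longrightarrow> K \<subseteq> P' \<Longrightarrow> P' \<subseteq> P \<Longrightarrow> P' = P"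
    and J: "\<And>n. ideal (J n) R" "\<And>n. local_sat P (J n) = J n" "\<And>n. K \<subseteq> J n" "\<And>n. J (Suc n) \<subseteq> J n"
  shows "\<exists>n. \<forall>m\<ge>n. J m = J n"
proof (rule ccontr)
  assume unstable: "\<nexists>n. \<forall>m\<ge>n. J m = J n"
  interpret P: primeideal P R by fact
  \<comment> \<open>\<open>ch L J\<close> describes a descending chain of \<open>P\<close>-saturated
    ideals above \<open>L\<close>. The family \<open>F\<close> collects the lower bounds that admit
    a chain which never becomes constant.\<close>
  define ch where "ch L J \<longleftrightarrow> (\<forall>n. ideal (J n) R \<and> local_sat P (J n) = J n \<and> L \<subseteq> J n \<and> J (Suc n) \<subseteq> J n)" for L J
  define F where "F = {L. ideal L R \<and> K \<subseteq> L \<and> local_sat P L = L \<and> (\<exists>J. ch L J \<and> (\<nexists>n. \<forall>m\<ge>n. J m = J n))}"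
  have "ch (local_sat P K) J"
    unfolding ch_def using J local_sat_mono[OF J(3), of P] by auto
  then have "local_sat P K \<in> F"
    unfolding F_def using unstable local_sat_ideal[OF P K] local_sat_superset[OF P K] local_sat_idem[OF P] by blast
  then have "F \<noteq> {}" by blast
  moreover have "ideal I R" if "I \<in> F" for I using that by (simp add: F_def)
  ultimately obtain L where L: "L \<in> F" "\<And>I. I \<in> F \<Longrightarrow> L \<subseteq> I \<Longrightarrow> I = L"
    by (rule maximal_ideal_in_family) blast+
  obtain J where J: "ch L J" and unstable: "\<nexists>n. \<forall>m\<ge>n. J m = J n" using L(1) by (auto simp: F_def)
  have Lp: "ideal L R" "K \<subseteq> L" "local_sat P L = L" using L(1) unfolding F_def by blast+
  interpret L: ideal L R by fact
  have Jn: "ideal (J n) R" "local_sat P (J n) = J n" "L \<subseteq> J n" "J (Suc n) \<subseteq> J n" for n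
    using J unfolding ch_def by blast+
  have Jmono: "J m \<subseteq> J n" if "n \<le> m" for m n using lift_Suc_antimono_le[of J, OF Jn(4) that] .
  have "L \<noteq> carrier R"
  proof
    assume "L = carrier R"
    then have "J n = carrier R" for n using Jn(1,3)[of n] ideal.Icarr by fast
    then show False using unstable by auto
  qed
  then obtain a where a: "a \<in> carrier R" "a \<notin> L" "primeideal (ideal_colon R L {a}) R"
    using exists_associated_prime[OF Lp(1)] by blast
  \<comment> \<open>Saturation of \<open>L\<close> keeps the associated prime inside
    \<open>P\<close>. It contains \<open>K\<close>, so minimality of \<open>P\<close> over
    \<open>K\<close> identifies it with \<open>P\<close>.\<close>
  have "ideal_colon R L {a} = P"
  proof (rule minimal[OF a(3)])
    show "K \<subseteq> ideal_colon R L {a}"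
      using Lp(2) a(1) by (auto simp: ideal_colon_def L.I_r_closed L.Icarr)
    show "ideal_colon R L {a} \<subseteq> P"
    proof
      fix s assume s: "s \<in> ideal_colon R L {a}"
      show "s \<in> P"
      proof (rule ccontr)
        assume "s \<notin> P"
        then have "a \<in> local_sat P L" using s a(1) by (intro local_satI[of a s]) (auto simp: ideal_colon_def)
        then show False using Lp(3) a(2) by simp
      qed
    qed
  qed
  then have Pa: "p \<otimes> a \<in> L" if "p \<in> P" for p using that by (auto simp: ideal_colon_def)
  define L' where "L' = local_sat P (L <+>\<^bsub>R\<^esub> PIdl a)"
  note La = ideal_add_cgenideal[OF Lp(1) a(1)]
  have L': "ideal L' R" "local_sat P L' = L'" "L \<subseteq> L'" "a \<in> L'"
    using local_sat_ideal[OF P La(1)] local_sat_idem[OF P] local_sat_superset[OF P La(1)] La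
    by (auto simp: L'_def)
  have L'F: "L' \<notin> F" using L(2)[of L'] L'(3,4) a(2) by blast
  then have stable: "\<exists>n. \<forall>m\<ge>n. J' m = J' n" if "ch L' J'" for J'
    using that L' Lp(2) unfolding F_def by blast
  show False
  \<comment> \<open>If \<open>a\<close> lies in every \<open>J n\<close>, the chain itself lies
    above the larger bound \<open>L'\<close> and becomes constant. Otherwise adjoining
    \<open>a\<close> to its members gives a chain above \<open>L'\<close>, and stability of the
    latter is carried back to \<open>J\<close>.\<close>
  proof (cases "\<forall>n. a \<in> J n")
    case True
    have "L' \<subseteq> J n" for n
    proof -
      have "PIdl a \<subseteq> J n" using True cgenideal_minimal[OF Jn(1)] by blast
      then have "L <+>\<^bsub>R\<^esub> PIdl a \<subseteq> J n"
        by (intro ideal_add_subset Jn)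
      then show ?thesis unfolding L'_def using local_sat_mono[of _ "J n" P] Jn(2)[of n] by blast
    qed
    then have "ch L' J" using Jn unfolding ch_def by blast
    then show False using stable unstable by blast
  next
    case False
    then obtain n0 where n0: "a \<notin> J n0" by blast
    define J' where "J' n = local_sat P (J n <+>\<^bsub>R\<^esub> PIdl a)" for n
    have "ch L' J'"
      unfolding ch_def
    proof (intro allI conjI)
      fix n
      note Ja = ideal_add_cgenideal[OF Jn(1)[of n] a(1)]
      show "ideal (J' n) R" unfolding J'_def by (rule local_sat_ideal[OF P Ja(1)])
      show "local_sat P (J' n) = J' n" unfolding J'_def by (rule local_sat_idem[OF P])
      show "L' \<subseteq> J' n" unfolding J'_def L'_def
        by (intro local_sat_mono ideal_add_mono Jn(3) subset_refl)
      show "J' (Suc n) \<subseteq> J' n" unfolding J'_def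
        by (intro local_sat_mono ideal_add_mono Jn(4) subset_refl)
    qed
    then obtain n1 where n1: "\<And>m. m \<ge> n1 \<Longrightarrow> J' m = J' n1" using stable by blast
    define N where "N = max n0 n1"
    have "J m = J N" if m: "m \<ge> N" for m
    proof
      show "J m \<subseteq> J N" using Jmono[OF m] .
      interpret JN: ideal "J N" R by (rule Jn)
      interpret Jm: ideal "J m" R by (rule Jn)
      show "J N \<subseteq> J m"
      proof
        fix b assume b: "b \<in> J N"
        have bc: "b \<in> carrier R" using b by (rule JN.Icarr)
        note Ja = ideal_add_cgenideal[OF Jn(1)[of N] a(1)]
        have "J' N = J' m" using n1[of m] n1[of N] m by (simp add: N_def)
        moreover have "b \<in> J' N" unfolding J'_def using local_sat_superset[OF P Ja(1)] Ja(2) b by blast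
        ultimately have "b \<in> J' m" by simp
        then obtain t c r where h: "t \<in> carrier R" "t \<notin> P" "c \<in> J m" "r \<in> carrier R" "t \<otimes> b = c \<oplus> r \<otimes> a"
          unfolding J'_def local_sat_def mem_ideal_add_cgenideal by blast
        have cc: "c \<in> carrier R" using h(3) by (rule Jm.Icarr)
        have "r \<otimes> a = t \<otimes> b \<ominus> c" unfolding h(5) using cc h(4) a(1) by algebra
        also have "\<dots> \<in> J N"
          using ideal_minus_closed[OF Jn(1)] JN.I_l_closed[OF b h(1)] Jmono[OF m] h(3) by blast
        finally have ra: "r \<otimes> a \<in> J N" .
        \<comment> \<open>A coefficient outside \<open>P\<close> would put \<open>a\<close> into the
          saturated ideal \<open>J N\<close>, hence into \<open>J n0\<close>. With \<open>r\<close>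
          in \<open>P\<close>, the product r a already lies in \<open>L\<close>.\<close>
        have "r \<in> P"
        proof (rule ccontr)
          assume "r \<notin> P"
          then have "a \<in> local_sat P (J N)" using local_satI[OF a(1) h(4) _ ra] by blast
          then have "a \<in> J N" using Jn(2)[of N] by simp
          then show False using n0 Jmono[of n0 N] by (auto simp: N_def)
        qed
        then have "r \<otimes> a \<in> J m" using Pa Jn(3)[of m] by blast
        then have "t \<otimes> b \<in> J m" unfolding h(5) using h(3) by simp
        then have "b \<in> local_sat P (J m)" using local_satI[OF bc h(1,2)] by blast
        then show "b \<in> J m" using Jn(2)[of m] by simp
      qed
    qed
    then show False using unstable by blast
  qed
qed

text \<open>Krull's principal ideal theorem for \<open>R/P0\<close>, by the symbolic powers \<open>Q\<close> of \<open>P1\<close>.\<close>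

lemma prime_between_containing:
  assumes P0: "primeideal P0 R" and P1: "primeideal P1 R" and P2: "primeideal P2 R"
    and sub: "P0 \<subset> P1" "P1 \<subset> P2" and x: "x \<in> P2" "x \<notin> P1"
  shows "\<exists>P'. primeideal P' R \<and> P0 \<subset> P' \<and> P' \<subset> P2 \<and> x \<in> P'"
proof (rule ccontr)
  assume none: "\<nexists>P'. primeideal P' R \<and> P0 \<subset> P' \<and> P' \<subset> P2 \<and> x \<in> P'"
  interpret P0: primeideal P0 R by fact
  interpret P1: primeideal P1 R by fact
  interpret P2: primeideal P2 R by fact
  have xc: "x \<in> carrier R" using x(1) by (rule P2.Icarr)
  note K = ideal_add_cgenideal[OF P0.is_ideal xc]
  \<comment> \<open>Without an intermediate prime containing \<open>x\<close>, the prime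
    \<open>P2\<close> is minimal over the ideal generated by \<open>P0\<close> and \<open>x\<close>,
    so the chain condition just proved applies at \<open>P2\<close>.\<close>
  have minimal: "P' = P2" if "primeideal P' R" "P0 <+>\<^bsub>R\<^esub> PIdl x \<subseteq> P'" "P' \<subseteq> P2" for P'
  proof (rule ccontr)
    assume "P' \<noteq> P2"
    moreover have "P0 \<subseteq> P'" "x \<in> P'" using that(2) K(2,3) by blast+
    ultimately have "P0 \<subset> P'" "P' \<subset> P2" using that(3) x(2) sub(1) by blast+
    then show False using none that(1) \<open>x \<in> P'\<close> by blast
  qed
  define Q where "Q n = local_sat P1 (ideal_power R P1 n <+>\<^bsub>R\<^esub> P0)" for n
  have id: "ideal (ideal_power R P1 n <+>\<^bsub>R\<^esub> P0) R" for n
    by (intro add_ideals ideal_power_ideal P1.is_ideal P0.is_ideal)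
  have P0Q: "P0 \<subseteq> ideal_power R P1 n <+>\<^bsub>R\<^esub> P0" and PQ: "ideal_power R P1 n \<subseteq> ideal_power R P1 n <+>\<^bsub>R\<^esub> P0" for n
  proof -
    interpret pw: ideal "ideal_power R P1 n" R by (rule ideal_power_ideal[OF P1.is_ideal])
    show "P0 \<subseteq> ideal_power R P1 n <+>\<^bsub>R\<^esub> P0"
      unfolding ideal_add_mem subset_iff by (metis P0.Icarr l_zero pw.zero_closed)
    show "ideal_power R P1 n \<subseteq> ideal_power R P1 n <+>\<^bsub>R\<^esub> P0"
      unfolding ideal_add_mem subset_iff by (metis P0.zero_closed r_zero pw.Icarr)
  qed
  have Q: "ideal (Q n) R" "local_sat P1 (Q n) = Q n" "P0 \<subseteq> Q n" "Q (Suc n) \<subseteq> Q n" for n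
  proof -
    show "ideal (Q n) R" unfolding Q_def by (rule local_sat_ideal[OF P1 id])
    show "local_sat P1 (Q n) = Q n" unfolding Q_def by (rule local_sat_idem[OF P1])
    show "P0 \<subseteq> Q n" unfolding Q_def using local_sat_superset[OF P1 id] P0Q by blast
    show "Q (Suc n) \<subseteq> Q n" unfolding Q_def
      by (intro local_sat_mono ideal_add_mono ideal_power_Suc_subset P1.is_ideal subset_refl)
  qed
  \<comment> \<open>The saturation is at \<open>P2\<close>, not at \<open>P1\<close>: stability of
    this chain is a statement about the local ring at \<open>P2\<close>, where \<open>x\<close> is a
    nonunit.\<close>
  define J where "J n = local_sat P2 (Q n <+>\<^bsub>R\<^esub> PIdl x)" for n
  have "\<exists>n. \<forall>m\<ge>n. J m = J n"
  proof (rule local_sat_chain_stabilizes[OF P2 K(1) minimal])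
    fix n
    note Qx = ideal_add_cgenideal[OF Q(1)[of n] xc]
    show "ideal (J n) R" unfolding J_def by (rule local_sat_ideal[OF P2 Qx(1)])
    show "local_sat P2 (J n) = J n" unfolding J_def by (rule local_sat_idem[OF P2])
    show "P0 <+>\<^bsub>R\<^esub> PIdl x \<subseteq> J n"
    proof -
      have "P0 <+>\<^bsub>R\<^esub> PIdl x \<subseteq> Q n <+>\<^bsub>R\<^esub> PIdl x" by (intro ideal_add_mono Q(3) subset_refl)
      then show ?thesis unfolding J_def using local_sat_superset[OF P2 Qx(1)] by blast
    qed
    show "J (Suc n) \<subseteq> J n" unfolding J_def
      by (intro local_sat_mono ideal_add_mono Q(4) subset_refl)
  qed
  then obtain n where n: "J (Suc n) = J n" by (meson le_SucI le_refl)
  interpret Qn: ideal "Q n" R by (rule Q)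
  \<comment> \<open>Stability expresses an element of \<open>Q n\<close>, up to a denominator, as b
    + r x with b in \<open>Q (Suc n)\<close>. As \<open>x\<close> is outside \<open>P1\<close> and
    \<open>Q n\<close> is saturated at \<open>P1\<close>, the cofactor r falls into
    \<open>Q n\<close>. So \<open>Q n\<close> lies locally in \<open>Q (Suc n)\<close> plus x times
    \<open>Q n\<close>, and Nakayama's lemma at \<open>P2\<close> removes the last term.\<close>
  have "Q n \<subseteq> Q (Suc n)"
  proof (rule local_nakayama[OF P2 Q(1) _ Q(1)])
    show "local_sat P2 (Q (Suc n)) = Q (Suc n)"
      using local_sat_smaller[OF P1 _ Q(2), of P2 "Suc n"] local_sat_superset[OF P2 Q(1), of "Suc n"] sub by blast
    show "Q n \<subseteq> local_sat P2 (Q (Suc n) <+>\<^bsub>R\<^esub> P2 \<cdot>\<^bsub>R\<^esub> Q n)"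
    proof
      fix a assume a: "a \<in> Q n"
      have ac: "a \<in> carrier R" using a by (rule Qn.Icarr)
      note Qx = ideal_add_cgenideal[OF Q(1)[of n] xc]
      have "a \<in> J n" unfolding J_def using local_sat_superset[OF P2 Qx(1)] Qx(2) a by blast
      then have "a \<in> J (Suc n)" using n by simp
      then obtain t b r where h: "t \<in> carrier R" "t \<notin> P2" "b \<in> Q (Suc n)" "r \<in> carrier R" "t \<otimes> a = b \<oplus> r \<otimes> x"
        unfolding J_def local_sat_def mem_ideal_add_cgenideal by blast
      have b: "b \<in> Q n" using h(3) Q(4) by blast
      have bc: "b \<in> carrier R" using b by (rule Qn.Icarr)
      have "x \<otimes> r = t \<otimes> a \<ominus> b" unfolding h(5) using bc h(4) xc by algebra
      also have "\<dots> \<in> Q n" using ideal_minus_closed[OF Q(1)] Qn.I_l_closed[OF a h(1)] b by blast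
      finally have "r \<in> local_sat P1 (Q n)" using local_satI[OF h(4) xc x(2)] by blast
      then have r: "r \<in> Q n" using Q(2) by simp
      have "t \<otimes> a = b \<oplus> x \<otimes> r" unfolding h(5) using h(4) xc by (simp add: m_comm)
      moreover have "x \<otimes> r \<in> P2 \<cdot>\<^bsub>R\<^esub> Q n" using ideal_prod.prod[OF x(1) r] .
      ultimately have "t \<otimes> a \<in> Q (Suc n) <+>\<^bsub>R\<^esub> P2 \<cdot>\<^bsub>R\<^esub> Q n" unfolding ideal_add_mem using h(3) by blast
      then show "a \<in> local_sat P2 (Q (Suc n) <+>\<^bsub>R\<^esub> P2 \<cdot>\<^bsub>R\<^esub> Q n)" by (rule local_satI[OF ac h(1,2)])
    qed
  qed
  moreover have "ideal_power R P1 n \<subseteq> Q n" unfolding Q_def using local_sat_superset[OF P1 id] PQ by blast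
  moreover have "ideal_power R P1 (Suc n) <+>\<^bsub>R\<^esub> P0 = P0 <+>\<^bsub>R\<^esub> P1 \<cdot>\<^bsub>R\<^esub> ideal_power R P1 n"
  proof -
    have e: "ideal_power R P1 (Suc n) = P1 \<cdot>\<^bsub>R\<^esub> ideal_power R P1 n"
      using ideal_prod_commute[OF ideal_power_ideal[OF P1.is_ideal] P1.is_ideal] by simp
    show ?thesis unfolding e[symmetric]
      using set_add_comm P0.a_subset ideal_power_ideal[OF P1.is_ideal, of "Suc n"] ideal.Icarr subsetI by metis
  qed
  \<comment> \<open>Second use of Nakayama's lemma, now at \<open>P1\<close>: the
    \<open>n\<close>-th power of \<open>P1\<close> lies in \<open>P0\<close> plus \<open>P1\<close>
    times itself up to denominators, hence in \<open>P0\<close>, which forces \<open>P1\<close> into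
    \<open>P0\<close>.\<close>
  ultimately have "ideal_power R P1 n \<subseteq> local_sat P1 (P0 <+>\<^bsub>R\<^esub> P1 \<cdot>\<^bsub>R\<^esub> ideal_power R P1 n)"
    unfolding Q_def by simp
  moreover have "local_sat P1 P0 = P0"
    using local_sat_superset[OF P1 P0.is_ideal] sub P0.I_prime P0.Icarr by (auto simp: local_sat_def)
  ultimately have "ideal_power R P1 n \<subseteq> P0"
    using local_nakayama[OF P1 P0.is_ideal _ ideal_power_ideal[OF P1.is_ideal]] by blast
  then have "P1 \<subseteq> P0" by (rule ideal_power_subset_prime[OF P1.is_ideal P0])
  then show False using sub by blast
qed

end

section \<open>Regular systems of parameters\<close>

definition prime_chain :: "('a, 'b) ring_scheme \<Rightarrow> (nat \<Rightarrow> 'a set) \<Rightarrow> nat \<Rightarrow> bool" where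
  "prime_chain R P n \<longleftrightarrow> (\<forall>i\<le>n. primeideal (P i) R) \<and> (\<forall>i<n. P i \<subset> P (Suc i))"

context cring begin

lemma finsum_lessThan_Suc:
  assumes "f \<in> {..<Suc n} \<rightarrow> carrier R"
  shows "(\<Oplus>i\<in>{..<Suc n}. f i) = (\<Oplus>i\<in>{..<n}. f i) \<oplus> f n"
  using assms by (simp add: lessThan_Suc Pi_def a_comm)

lemma genideal_image_lessThan:
  fixes n :: nat
  assumes x: "x \<in> {..<n} \<rightarrow> carrier R"
  shows "Idl (x ` {..<n}) = {\<Oplus>i\<in>{..<n}. c i \<otimes> x i | c. c \<in> {..<n} \<rightarrow> carrier R}" (is "_ = ?I")
proof
  have sub: "x ` {..<n} \<subseteq> carrier R" using x by auto
  have xi: "x i \<in> carrier R" if "i < n" for i using x that by auto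
  have "ideal ?I R"
  proof (rule ideal_criterion)
    show "?I \<subseteq> carrier R" using xi by (auto intro!: finsum_closed)
    have "(\<Oplus>i\<in>{..<n}. \<zero> \<otimes> x i) = (\<Oplus>i\<in>{..<n}. \<zero>)" using xi by (intro finsum_cong') auto
    then show "\<zero> \<in> ?I" by (auto intro!: exI[of _ "\<lambda>_. \<zero>"])
  next
    fix a b assume "a \<in> ?I" "b \<in> ?I"
    then obtain c d where c: "c \<in> {..<n} \<rightarrow> carrier R" "a = (\<Oplus>i\<in>{..<n}. c i \<otimes> x i)"
      and d: "d \<in> {..<n} \<rightarrow> carrier R" "b = (\<Oplus>i\<in>{..<n}. d i \<otimes> x i)" by auto
    have "a \<oplus> b = (\<Oplus>i\<in>{..<n}. c i \<otimes> x i \<oplus> d i \<otimes> x i)"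
      unfolding c(2) d(2) using c(1) d(1) xi by (intro finsum_addf[symmetric]) auto
    also have "\<dots> = (\<Oplus>i\<in>{..<n}. (c i \<oplus> d i) \<otimes> x i)"
      using c(1) d(1) xi by (intro finsum_cong') (auto simp: l_distr Pi_def)
    finally show "a \<oplus> b \<in> ?I" using c(1) d(1) by (auto intro!: exI[of _ "\<lambda>i. c i \<oplus> d i"])
  next
    fix a r assume "a \<in> ?I" and r: "r \<in> carrier R"
    then obtain c where c: "c \<in> {..<n} \<rightarrow> carrier R" "a = (\<Oplus>i\<in>{..<n}. c i \<otimes> x i)" by auto
    have "r \<otimes> a = (\<Oplus>i\<in>{..<n}. r \<otimes> (c i \<otimes> x i))"
      unfolding c(2) using c(1) xi r by (intro finsum_rdistr) auto
    also have "\<dots> = (\<Oplus>i\<in>{..<n}. (r \<otimes> c i) \<otimes> x i)"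
      using c(1) xi r by (intro finsum_cong') (auto simp: m_assoc Pi_def)
    finally show "r \<otimes> a \<in> ?I" using c(1) r by (auto intro!: exI[of _ "\<lambda>i. r \<otimes> c i"])
  qed
  moreover have "x ` {..<n} \<subseteq> ?I"
  proof (clarify)
    fix j assume j: "j < n"
    have "(\<Oplus>i\<in>{..<n}. (if i = j then \<one> else \<zero>) \<otimes> x i) = (\<Oplus>i\<in>{..<n}. if j = i then x i else \<zero>)"
      using xi by (intro finsum_cong') auto
    also have "\<dots> = x j" using j xi by (intro finsum_singleton) auto
    finally show "\<exists>c. x j = (\<Oplus>i\<in>{..<n}. c i \<otimes> x i) \<and> c \<in> {..<n} \<rightarrow> carrier R"
      by (intro exI[of _ "\<lambda>i. if i = j then \<one> else \<zero>"]) auto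
  qed
  ultimately show "Idl (x ` {..<n}) \<subseteq> ?I" by (rule genideal_minimal)
  interpret I: ideal "Idl (x ` {..<n})" R by (rule genideal_ideal[OF sub])
  show "?I \<subseteq> Idl (x ` {..<n})"
  proof clarify
    fix c assume c: "c \<in> {..<n} \<rightarrow> carrier R"
    show "(\<Oplus>i\<in>{..<n}. c i \<otimes> x i) \<in> Idl (x ` {..<n})"
      using c genideal_self[OF sub] by (intro ideal_finsum_closed[OF I.is_ideal] I.I_l_closed) auto
  qed
qed

lemma genideal_image_lessThan_Suc:
  assumes x: "x \<in> {..<Suc n} \<rightarrow> carrier R"
  shows "Idl (x ` {..<Suc n}) = Idl (x ` {..<n}) <+>\<^bsub>R\<^esub> PIdl (x n)"
proof
  have sub: "x ` {..<Suc n} \<subseteq> carrier R" and sub': "x ` {..<n} \<subseteq> carrier R" and xn: "x n \<in> carrier R"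
    using x by auto
  note K = ideal_add_cgenideal[OF genideal_ideal[OF sub'] xn]
  show "Idl (x ` {..<Suc n}) \<subseteq> Idl (x ` {..<n}) <+>\<^bsub>R\<^esub> PIdl (x n)"
    using K(2,3) genideal_self[OF sub'] by (intro genideal_minimal K(1)) (auto simp: lessThan_Suc)
  show "Idl (x ` {..<n}) <+>\<^bsub>R\<^esub> PIdl (x n) \<subseteq> Idl (x ` {..<Suc n})"
    using genideal_self[OF sub]
    by (intro ideal_add_subset genideal_ideal[OF sub] subset_Idl_subset[OF sub] cgenideal_minimal) auto
qed

text \<open>Vanishing of the first Koszul homology of a regular sequence. The last coefficient
  multiplies the last element into the ideal of the earlier ones, so it lies in that ideal, and its
  expansion reduces the relation to a shorter one. The zero diagonal is a separate claim, since
  antisymmetry gives only 2 g_ii = 0.\<close>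

lemma regular_imp_koszul:
  fixes n :: nat
  assumes "x \<in> {..<n} \<rightarrow> carrier R"
    and "\<And>j a. j < n \<Longrightarrow> a \<in> carrier R \<Longrightarrow> a \<otimes> x j \<in> Idl (x ` {..<j}) \<Longrightarrow> a \<in> Idl (x ` {..<j})"
    and "c \<in> {..<n} \<rightarrow> carrier R" and "(\<Oplus>i\<in>{..<n}. c i \<otimes> x i) = \<zero>"
  shows "\<exists>g. (\<forall>i<n. \<forall>l<n. g i l \<in> carrier R \<and> g l i = \<ominus> g i l) \<and> (\<forall>i<n. g i i = \<zero>) \<and>
           (\<forall>i<n. c i = (\<Oplus>l\<in>{..<n}. g i l \<otimes> x l))"
  using assms
proof (induct n arbitrary: c)
  case (Suc n)
  have x: "x i \<in> carrier R" if "i < Suc n" for i using Suc(2) that by auto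
  have c: "c i \<in> carrier R" if "i < Suc n" for i using Suc(4) that by auto
  have xn: "x \<in> {..<n} \<rightarrow> carrier R" using x by auto
  define s where "s = (\<Oplus>i\<in>{..<n}. c i \<otimes> x i)"
  have sc: "s \<in> carrier R" unfolding s_def using x c by (intro finsum_closed) auto
  have "(\<Oplus>i\<in>{..<Suc n}. c i \<otimes> x i) = s \<oplus> c n \<otimes> x n"
    unfolding s_def using x c by (intro finsum_lessThan_Suc) auto
  then have s0: "s \<oplus> c n \<otimes> x n = \<zero>" using Suc(5) by simp
  have sub: "x ` {..<n} \<subseteq> carrier R" using x by auto
  have "s \<in> Idl (x ` {..<n})" unfolding s_def genideal_image_lessThan[OF xn] using c by auto
  moreover have "c n \<otimes> x n = \<ominus> s" using s0 sc x c by (metis a_comm lessI m_closed minus_equality)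
  ultimately have "c n \<otimes> x n \<in> Idl (x ` {..<n})"
    using additive_subgroup.a_inv_closed[OF ideal.axioms(1)[OF genideal_ideal[OF sub]]] by simp
  then have "c n \<in> Idl (x ` {..<n})" using Suc(3)[of n "c n"] c by simp
  then obtain d where d: "d \<in> {..<n} \<rightarrow> carrier R" "c n = (\<Oplus>i\<in>{..<n}. d i \<otimes> x i)"
    unfolding genideal_image_lessThan[OF xn] by auto
  \<comment> \<open>Subtracting the Koszul relations between \<open>x i\<close> and
    \<open>x n\<close>, with coefficients \<open>d i\<close>, clears the last entry of the relation
    and leaves these entries.\<close>
  define c' where "c' i = c i \<oplus> d i \<otimes> x n" for i
  have dc: "d i \<in> carrier R" if "i < n" for i using d(1) that by auto
  have c': "c' \<in> {..<n} \<rightarrow> carrier R" unfolding c'_def using c x dc by auto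
  have "(\<Oplus>i\<in>{..<n}. c' i \<otimes> x i) = (\<Oplus>i\<in>{..<n}. c i \<otimes> x i \<oplus> (d i \<otimes> x i) \<otimes> x n)"
  proof (rule finsum_cong')
    fix i assume "i \<in> {..<n}"
    then have "c i \<in> carrier R" "d i \<in> carrier R" "x i \<in> carrier R" "x n \<in> carrier R" using c dc x by auto
    then show "c' i \<otimes> x i = c i \<otimes> x i \<oplus> d i \<otimes> x i \<otimes> x n" unfolding c'_def by algebra
  qed (use c dc x in auto)
  also have "\<dots> = s \<oplus> (\<Oplus>i\<in>{..<n}. (d i \<otimes> x i) \<otimes> x n)"
    unfolding s_def using c dc x by (intro finsum_addf) auto
  also have "(\<Oplus>i\<in>{..<n}. (d i \<otimes> x i) \<otimes> x n) = c n \<otimes> x n"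
    unfolding d(2) using dc x by (intro finsum_ldistr[symmetric]) auto
  finally have "(\<Oplus>i\<in>{..<n}. c' i \<otimes> x i) = \<zero>" using s0 by simp
  moreover have "a \<in> Idl (x ` {..<j})" if "j < n" "a \<in> carrier R" "a \<otimes> x j \<in> Idl (x ` {..<j})" for j a
    using Suc(3)[of j a] that by simp
  ultimately obtain g where g: "\<forall>i<n. \<forall>l<n. g i l \<in> carrier R \<and> g l i = \<ominus> g i l" "\<forall>i<n. g i i = \<zero>"
    "\<forall>i<n. c' i = (\<Oplus>l\<in>{..<n}. g i l \<otimes> x l)" using Suc(1)[OF xn _ c'] by blast
  have gc: "g i l \<in> carrier R" if "i < n" "l < n" for i l using g(1) that by blast
  \<comment> \<open>The alternating matrix of size \<open>n\<close>, bordered by the row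
    \<open>d\<close> and the column of its negatives, puts the subtracted relations back.\<close>
  define h where "h i l = (if i < n then if l < n then g i l else \<ominus> d i else if l < n then d l else \<zero>)" for i l
  have hc: "h i l \<in> carrier R" if "i < Suc n" "l < Suc n" for i l using gc dc unfolding h_def by auto
  have "h l i = \<ominus> h i l" if "i < Suc n" "l < Suc n" for i l
  proof (cases "i < n \<and> l < n")
    case True
    then have "g l i = \<ominus> g i l" using g(1) by blast
    with True show ?thesis unfolding h_def by (simp only: if_True)
  qed (use dc that in \<open>auto simp: h_def\<close>)
  moreover have "h i i = \<zero>" if "i < Suc n" for i using g(2) unfolding h_def by auto
  moreover have "c i = (\<Oplus>l\<in>{..<Suc n}. h i l \<otimes> x l)" if i: "i < Suc n" for i
  proof -
    have e: "(\<Oplus>l\<in>{..<Suc n}. h i l \<otimes> x l) = (\<Oplus>l\<in>{..<n}. h i l \<otimes> x l) \<oplus> h i n \<otimes> x n"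
      using hc[OF i] x by (intro finsum_lessThan_Suc) auto
    show ?thesis
    proof (cases "i < n")
      case True
      have "(\<Oplus>l\<in>{..<n}. h i l \<otimes> x l) = (\<Oplus>l\<in>{..<n}. g i l \<otimes> x l)"
        using True gc x by (intro finsum_cong') (auto simp: h_def)
      then have "(\<Oplus>l\<in>{..<Suc n}. h i l \<otimes> x l) = c' i \<oplus> (\<ominus> d i) \<otimes> x n"
        using e g(3) True by (simp add: h_def)
      also have "\<dots> = c i"
        unfolding c'_def using c[OF i] dc[OF True] x[of n] by (simp add: l_minus a_assoc r_neg)
      finally show ?thesis by simp
    next
      case False
      have "(\<Oplus>l\<in>{..<n}. h i l \<otimes> x l) = (\<Oplus>l\<in>{..<n}. d l \<otimes> x l)"
        using False dc x by (intro finsum_cong') (auto simp: h_def)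
      moreover have "i = n" using False i by simp
      ultimately show ?thesis using e d(2) c[of n] x[of n] by (simp add: h_def)
    qed
  qed
  ultimately show ?case using hc by blast
qed auto

end

section \<open>Chains of primes adapted to a sequence of elements\<close>

context noetherian_cring begin

text \<open>The element is pushed down from the top of the chain: a prime is replaced by one that
  contains \<open>x\<close> and lies strictly between its neighbours, which exists by the principal
  ideal theorem. Primes of index at most \<open>j\<close> are never touched.\<close>

lemma prime_chain_insert:
  assumes P: "prime_chain R P n" and x: "x \<in> P n" and j: "j < n"
  shows "\<exists>P'. prime_chain R P' n \<and> (\<forall>i\<le>j. P' i = P i) \<and> P' n = P n \<and> x \<in> P' (Suc j)"
proof -
  have "Suc j \<le> n" using j by simp
  then show ?thesis
  proof (induct rule: inc_induct)
    case base
    then show ?case using P x by blast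
  next
    case (step k)
    then obtain P' where P': "prime_chain R P' n" "\<forall>i\<le>j. P' i = P i" "P' n = P n" "x \<in> P' (Suc k)" by blast
    show ?case
    proof (cases "x \<in> P' k")
      case True
      then show ?thesis using P' by blast
    next
      case False
      \<comment> \<open>\<open>k\<close> is at least \<open>Suc j\<close>, so the prime to be
        replaced has a lower neighbour.\<close>
      obtain k' where k': "k = Suc k'" using step(1) by (cases k) auto
      have pr: "primeideal (P' k') R" "primeideal (P' k) R" "primeideal (P' (Suc k)) R"
        and st: "P' k' \<subset> P' k" "P' k \<subset> P' (Suc k)"
        using P'(1) step(2) unfolding prime_chain_def k' by auto
      obtain L where L: "primeideal L R" "P' k' \<subset> L" "L \<subset> P' (Suc k)" "x \<in> L"
        using prime_between_containing[OF pr st P'(4) False] by blast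
      have "prime_chain R (P'(k := L)) n"
        using P'(1) L step(2) unfolding prime_chain_def k' by (auto simp: less_Suc_eq_le)
      moreover have "\<forall>i\<le>j. (P'(k := L)) i = P i" using P'(2) step(1) by auto
      moreover have "(P'(k := L)) n = P n" using P'(3) step(2) by auto
      moreover have "x \<in> (P'(k := L)) k" using L(4) by simp
      ultimately show ?thesis by blast
    qed
  qed
qed

text \<open>Successive insertion of x 0, x 1 and so on: placing \<open>x j\<close> into the prime of
  index \<open>Suc j\<close> leaves alone the primes that were already adapted to the earlier
  elements.\<close>

lemma prime_chain_adapted:
  assumes P: "prime_chain R P n" and x: "x ` {..<n} \<subseteq> P n" and j: "j \<le> n"
  shows "\<exists>P'. prime_chain R P' n \<and> P' n = P n \<and> (\<forall>i\<le>j. x ` {..<i} \<subseteq> P' i)"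
  using j
proof (induct j)
  case 0
  then show ?case using P by auto
next
  case (Suc j)
  then obtain P' where P': "prime_chain R P' n" "P' n = P n" "\<forall>i\<le>j. x ` {..<i} \<subseteq> P' i" by auto
  have "x j \<in> P' n" using x Suc(2) P'(2) by auto
  from prime_chain_insert[OF P'(1) this, of j] Suc(2)
  obtain P'' where P'': "prime_chain R P'' n" "\<forall>i\<le>j. P'' i = P' i" "P'' n = P' n" "x j \<in> P'' (Suc j)" by auto
  have "P'' j \<subset> P'' (Suc j)" using P''(1) Suc(2) unfolding prime_chain_def by auto
  moreover have "x ` {..<j} \<subseteq> P'' j" using P'(3) P''(2) by auto
  ultimately have top: "x ` {..<Suc j} \<subseteq> P'' (Suc j)" using P''(4) unfolding lessThan_Suc by blast
  have "x ` {..<i} \<subseteq> P'' i" if "i \<le> Suc j" for i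
    using that P'(3) P''(2) top by (cases "i = Suc j") auto
  then show ?case using P'' P'(2) by auto
qed

end

sublocale noetherian_local_ring \<subseteq> noetherian_cring ..

section \<open>Local rings: units, Nakayama's lemma, regular systems of parameters\<close>

context noetherian_local_ring begin

lemma maximal_prime: "primeideal \<mm> R"
  using maximalideal_prime[OF maximal] .

lemma maximal_ideal: "ideal \<mm> R"
  using maximal_prime primeideal.axioms(1) by blast

lemma one_notin_maximal: "\<one> \<notin> \<mm>"
  using maximalideal.I_notcarr[OF maximal] ideal.one_imp_carrier[OF maximal_ideal] by auto

lemma proper_ideal_subset_maximal:
  assumes I: "ideal I R" and ne: "I \<noteq> carrier R"
  shows "I \<subseteq> \<mm>"
proof -
  define F where "F = {J. ideal J R \<and> I \<subseteq> J \<and> J \<noteq> carrier R}"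
  have "F \<noteq> {}" using assms by (auto simp: F_def)
  moreover have "ideal J R" if "J \<in> F" for J using that by (simp add: F_def)
  ultimately obtain M where M: "M \<in> F" "\<And>J. J \<in> F \<Longrightarrow> M \<subseteq> J \<Longrightarrow> J = M"
    by (rule maximal_ideal_in_family) blast+
  have "maximalideal M R"
    using M unfolding F_def by (intro maximalidealI) blast+
  then show ?thesis using unique_maximal[of M] M(1) by (auto simp: F_def)
qed

lemma unit_if_notin_maximal:
  assumes "a \<in> carrier R" "a \<notin> \<mm>"
  obtains b where "b \<in> carrier R" "b \<otimes> a = \<one>"
proof -
  have "PIdl a = carrier R"
    using proper_ideal_subset_maximal[OF cgenideal_ideal[OF assms(1)]] cgenideal_self[OF assms(1)] assms(2) by blast
  then have "\<one> \<in> PIdl a" by simp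
  then show thesis using that by (auto simp: cgenideal_def)
qed

text \<open>The case of the maximal ideal: elements outside \<mm> are units, so every ideal is
  saturated at \<mm>.\<close>

lemma nakayama:
  assumes N: "ideal N R" and M: "ideal M R" and MN: "M \<subseteq> N <+>\<^bsub>R\<^esub> \<mm> \<cdot>\<^bsub>R\<^esub> M"
  shows "M \<subseteq> N"
proof (rule local_nakayama[OF maximal_prime N _ M])
  interpret N: ideal N R by fact
  show "local_sat \<mm> N = N"
  proof
    show "local_sat \<mm> N \<subseteq> N"
    proof
      fix a assume "a \<in> local_sat \<mm> N"
      then obtain t where t: "a \<in> carrier R" "t \<in> carrier R" "t \<notin> \<mm>" "t \<otimes> a \<in> N" by (auto simp: local_sat_def)
      obtain u where u: "u \<in> carrier R" "u \<otimes> t = \<one>" using unit_if_notin_maximal[OF t(2,3)] .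
      have "a = u \<otimes> (t \<otimes> a)" using t u by (simp flip: m_assoc)
      then show "a \<in> N" using N.I_l_closed[OF t(4) u(1)] by simp
    qed
  qed (rule local_sat_superset[OF maximal_prime N])
  show "M \<subseteq> local_sat \<mm> (N <+>\<^bsub>R\<^esub> \<mm> \<cdot>\<^bsub>R\<^esub> M)"
    using MN local_sat_superset[OF maximal_prime add_ideals[OF N ideal_prod_is_ideal[OF maximal_ideal M]]] by blast
qed

text \<open>A finite supremum of natural numbers is attained, and replacing the top prime of a chain
  by \<mm> keeps the chain strict.\<close>

lemma krull_dim_prime_chain:
  assumes "krull_dim R = enat n"
  obtains P where "prime_chain R P n" "P n = \<mm>"
proof -
  define X where "X = {enat n | n. \<exists>P. prime_chain R P n}"
  have "prime_chain R (\<lambda>_. \<mm>) 0" using maximal_prime by (simp add: prime_chain_def)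
  then have ne: "X \<noteq> {}" unfolding X_def by blast
  have "Sup X = enat n" using assms unfolding krull_dim_def X_def prime_chain_def by simp
  then have "enat n \<in> X"
    using ne Max_in[of X] by (metis Sup_enat_def enat.distinct(1))
  then obtain P where P: "prime_chain R P n" by (auto simp: X_def)
  interpret Pn: primeideal "P n" R using P by (simp add: prime_chain_def)
  have sub: "P n \<subseteq> \<mm>" using proper_ideal_subset_maximal[OF Pn.is_ideal] Pn.I_notcarr by simp
  have "P i \<subset> (P(n := \<mm>)) (Suc i)" if "i < n" for i
    using P that sub unfolding prime_chain_def by (cases "Suc i = n") auto
  then have "prime_chain R (P(n := \<mm>)) n"
    using P maximal_prime unfolding prime_chain_def by auto
  then show thesis using that[of "P(n := \<mm>)"] by simp
qed

text \<open>A chain of primes adapted to the generators \<open>x\<close> consists, by Nakayama, of the ideals they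
  generate.\<close>

lemma regular_generators_regular:
  assumes dim: "krull_dim R = enat n" and x: "x \<in> {..<n} \<rightarrow> carrier R" and gen: "Idl (x ` {..<n}) = \<mm>"
    and j: "j < n" and a: "a \<in> carrier R" "a \<otimes> x j \<in> Idl (x ` {..<j})"
  shows "a \<in> Idl (x ` {..<j})"
proof -
  obtain P0 where P0: "prime_chain R P0 n" "P0 n = \<mm>" using krull_dim_prime_chain[OF dim] .
  have "x ` {..<n} \<subseteq> \<mm>" using genideal_self[of "x ` {..<n}"] x gen by blast
  then obtain P where P: "prime_chain R P n" "P n = \<mm>" "\<forall>i\<le>n. x ` {..<i} \<subseteq> P i"
    using prime_chain_adapted[OF P0(1), of x n] P0(2) by auto
  have prime: "primeideal (P i) R" if "i \<le> n" for i using P(1) that by (simp add: prime_chain_def)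
  have id: "ideal (P i) R" if "i \<le> n" for i using prime[OF that] primeideal.axioms(1) by blast
  have strict: "P i \<subset> P (Suc i)" if "i < n" for i using P(1) that by (simp add: prime_chain_def)
  have sub: "x ` {..<i} \<subseteq> carrier R" if "i \<le> n" for i using x that by auto
  have QP: "Idl (x ` {..<i}) \<subseteq> P i" if "i \<le> n" for i
    using genideal_minimal[OF id[OF that]] P(3) that by blast
  have PQ: "P i = Idl (x ` {..<i})" and xP: "i < n \<longrightarrow> x i \<notin> P i" if "i \<le> n" for i
  proof -
    \<comment> \<open>Descent from \<open>P n\<close>, which is \<mm>. If x 0, ..., x i generate
      \<open>P (Suc i)\<close>, strictness of the chain keeps \<open>x i\<close> out of
      \<open>P i\<close>. Then an element q + r x_i of \<open>P i\<close> has r in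
      \<open>P i\<close>, and Nakayama's lemma shows that x 0, ..., x (i - 1) generate
      \<open>P i\<close>.\<close>
    have "P i = Idl (x ` {..<i}) \<and> (i < n \<longrightarrow> x i \<notin> P i)"
      using that
    proof (induct rule: inc_induct)
      case base
      then show ?case using P(2) gen by simp
    next
      case (step i)
      interpret Pi: primeideal "P i" R using prime step by simp
      have xi: "x i \<in> carrier R" using x step(2) by auto
      have PS: "P (Suc i) = Idl (x ` {..<i}) <+>\<^bsub>R\<^esub> PIdl (x i)"
      proof -
        have "x \<in> {..<Suc i} \<rightarrow> carrier R" using x step(2) by auto
        then show ?thesis using step(3) genideal_image_lessThan_Suc[of x i] by simp
      qed
      have xPi: "x i \<notin> P i"
      proof
        assume "x i \<in> P i"
        then have "P (Suc i) \<subseteq> P i" unfolding PS using QP[of i] step(2)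
          by (intro ideal_add_subset Pi.is_ideal cgenideal_minimal) auto
        then show False using strict[OF step(2)] by blast
      qed
      have "P i \<subseteq> Idl (x ` {..<i}) <+>\<^bsub>R\<^esub> \<mm> \<cdot>\<^bsub>R\<^esub> P i"
      proof
        fix p assume p: "p \<in> P i"
        then have "p \<in> P (Suc i)" using strict[OF step(2)] by blast
        then obtain q r where h: "q \<in> Idl (x ` {..<i})" "r \<in> carrier R" "p = q \<oplus> r \<otimes> x i"
          unfolding PS mem_ideal_add_cgenideal by blast
        have q: "q \<in> P i" using h(1) QP[of i] step(2) by auto
        have c: "p \<in> carrier R" "q \<in> carrier R" using p q Pi.Icarr by auto
        have "r \<otimes> x i = p \<ominus> q" unfolding h(3) using c h(2) xi by algebra
        then have "r \<otimes> x i \<in> P i" using ideal_minus_closed[OF Pi.is_ideal p q] by simp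
        then have r: "r \<in> P i" using Pi.I_prime[OF h(2) xi] xPi by blast
        have "x i \<in> \<mm>" using \<open>x ` {..<n} \<subseteq> \<mm>\<close> step(2) by auto
        then have "x i \<otimes> r \<in> \<mm> \<cdot>\<^bsub>R\<^esub> P i" using r by (rule ideal_prod.prod)
        then show "p \<in> Idl (x ` {..<i}) <+>\<^bsub>R\<^esub> \<mm> \<cdot>\<^bsub>R\<^esub> P i"
          unfolding ideal_add_mem using h xi by (auto simp: m_comm)
      qed
      then have "P i \<subseteq> Idl (x ` {..<i})"
        using nakayama[OF genideal_ideal[OF sub[of i]] Pi.is_ideal] step(2) by simp
      moreover have "Idl (x ` {..<i}) \<subseteq> P i" using QP[of i] step(2) by simp
      ultimately show ?case using xPi by blast
    qed
    then show "P i = Idl (x ` {..<i})" "i < n \<longrightarrow> x i \<notin> P i" by blast+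
  qed
  \<comment> \<open>The ideal of the first \<open>j\<close> elements is the prime
    \<open>P j\<close>, which does not contain \<open>x j\<close>.\<close>
  have "x j \<in> carrier R" using x j by auto
  then show ?thesis
    using a primeideal.I_prime[OF prime[of j], of a "x j"] PQ[of j, symmetric] xP[of j] j by simp
qed

end

section \<open>Linear combinations and bases\<close>

text \<open>Families on an initial segment replace sets of vectors: repetitions are allowed, and
  matrices of coefficients need no reindexing.\<close>

definition lin_comb :: "('a, 'c, 'd) module_scheme \<Rightarrow> nat \<Rightarrow> (nat \<Rightarrow> 'c) \<Rightarrow> (nat \<Rightarrow> 'a) \<Rightarrow> 'c" where
  "lin_comb M n v c = (\<Oplus>\<^bsub>M\<^esub>i\<in>{..<n}. c i \<odot>\<^bsub>M\<^esub> v i)"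

lemma finsum_additive:
  assumes M: "abelian_group M" and N: "abelian_group N" and h: "h \<in> carrier M \<rightarrow> carrier N"
    and add: "\<And>x y. x \<in> carrier M \<Longrightarrow> y \<in> carrier M \<Longrightarrow> h (x \<oplus>\<^bsub>M\<^esub> y) = h x \<oplus>\<^bsub>N\<^esub> h y"
    and f: "f \<in> A \<rightarrow> carrier M"
  shows "h (finsum M f A) = (\<Oplus>\<^bsub>N\<^esub>i\<in>A. h (f i))"
proof -
  interpret M: abelian_group M by fact
  interpret N: abelian_group N by fact
  have "h \<zero>\<^bsub>M\<^esub> \<oplus>\<^bsub>N\<^esub> h \<zero>\<^bsub>M\<^esub> = h \<zero>\<^bsub>M\<^esub>" using add[of "\<zero>\<^bsub>M\<^esub>" "\<zero>\<^bsub>M\<^esub>"] by simp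
  then have 0: "h \<zero>\<^bsub>M\<^esub> = \<zero>\<^bsub>N\<^esub>" using h by (simp add: N.add.l_cancel_one' Pi_def)
  from f show ?thesis
  proof (induct A rule: infinite_finite_induct)
    case (insert x F)
    then have "h (finsum M f F) = (\<Oplus>\<^bsub>N\<^esub>i\<in>F. h (f i))" by auto
    moreover have "finsum M f (insert x F) = f x \<oplus>\<^bsub>M\<^esub> finsum M f F" using insert by (intro M.finsum_insert) auto
    moreover have "(\<Oplus>\<^bsub>N\<^esub>i\<in>insert x F. h (f i)) = h (f x) \<oplus>\<^bsub>N\<^esub> (\<Oplus>\<^bsub>N\<^esub>i\<in>F. h (f i))"
      using insert h by (intro N.finsum_insert) auto
    ultimately show ?case using insert by (auto simp: add)
  qed (auto simp: 0)
qed

lemma mod_homD: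
  assumes "f \<in> mod_hom R M N"
  shows "f \<in> carrier M \<rightarrow> carrier N"
    "x \<in> carrier M \<Longrightarrow> y \<in> carrier M \<Longrightarrow> f (x \<oplus>\<^bsub>M\<^esub> y) = f x \<oplus>\<^bsub>N\<^esub> f y"
    "a \<in> carrier R \<Longrightarrow> x \<in> carrier M \<Longrightarrow> f (a \<odot>\<^bsub>M\<^esub> x) = a \<odot>\<^bsub>N\<^esub> f x"
  using assms by (auto simp: mod_hom_def)

lemma mod_hom_lin_comb:
  assumes M: "module R M" and N: "module R N" and f: "f \<in> mod_hom R M N"
    and v: "v \<in> {..<n} \<rightarrow> carrier M" and c: "c \<in> {..<n} \<rightarrow> carrier R"
  shows "f (lin_comb M n v c) = lin_comb N n (\<lambda>i. f (v i)) c"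
proof -
  interpret M: module R M by fact
  interpret N: module R N by fact
  note f' = mod_homD[OF f]
  have "f (lin_comb M n v c) = (\<Oplus>\<^bsub>N\<^esub>i\<in>{..<n}. f (c i \<odot>\<^bsub>M\<^esub> v i))"
    unfolding lin_comb_def using v c
    by (intro finsum_additive[OF M.abelian_group_axioms N.abelian_group_axioms f'(1,2)]) auto
  also have "\<dots> = lin_comb N n (\<lambda>i. f (v i)) c"
    unfolding lin_comb_def
  proof (rule N.M.finsum_cong')
    fix i assume "i \<in> {..<n}"
    then have "c i \<in> carrier R" "v i \<in> carrier M" using v c by auto
    then show "f (c i \<odot>\<^bsub>M\<^esub> v i) = c i \<odot>\<^bsub>N\<^esub> f (v i)" by (rule f'(3))
  qed (use v c f'(1) in auto)
  finally show ?thesis .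
qed

context module begin

lemma lin_comb_closed:
  "v \<in> {..<n} \<rightarrow> carrier M \<Longrightarrow> c \<in> {..<n} \<rightarrow> carrier R \<Longrightarrow> lin_comb M n v c \<in> carrier M"
  unfolding lin_comb_def by (intro M.finsum_closed) auto

lemma lin_comb_cong:
  assumes "v \<in> {..<n} \<rightarrow> carrier M" "c \<in> {..<n} \<rightarrow> carrier R"
    and "\<And>i. i < n \<Longrightarrow> c i = d i" "\<And>i. i < n \<Longrightarrow> v i = w i"
  shows "lin_comb M n v c = lin_comb M n w d"
  unfolding lin_comb_def
proof (rule M.finsum_cong')
  show "(\<lambda>i. d i \<odot>\<^bsub>M\<^esub> w i) \<in> {..<n} \<rightarrow> carrier M"
    using assms(1,2) by (auto simp: assms(3,4)[symmetric] Pi_def)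
qed (simp_all add: assms(3,4))

lemma lin_comb_add:
  assumes "v \<in> {..<n} \<rightarrow> carrier M" "c \<in> {..<n} \<rightarrow> carrier R" "d \<in> {..<n} \<rightarrow> carrier R"
  shows "lin_comb M n v (\<lambda>i. c i \<oplus> d i) = lin_comb M n v c \<oplus>\<^bsub>M\<^esub> lin_comb M n v d"
proof -
  have "lin_comb M n v (\<lambda>i. c i \<oplus> d i) = (\<Oplus>\<^bsub>M\<^esub>i\<in>{..<n}. c i \<odot>\<^bsub>M\<^esub> v i \<oplus>\<^bsub>M\<^esub> d i \<odot>\<^bsub>M\<^esub> v i)"
    unfolding lin_comb_def using assms by (intro M.finsum_cong') (auto simp: smult_l_distr Pi_def)
  also have "\<dots> = lin_comb M n v c \<oplus>\<^bsub>M\<^esub> lin_comb M n v d"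
    unfolding lin_comb_def using assms by (intro M.finsum_addf) auto
  finally show ?thesis .
qed

lemma lin_comb_smult:
  assumes "v \<in> {..<n} \<rightarrow> carrier M" "c \<in> {..<n} \<rightarrow> carrier R" "a \<in> carrier R"
  shows "lin_comb M n v (\<lambda>i. a \<otimes> c i) = a \<odot>\<^bsub>M\<^esub> lin_comb M n v c"
proof -
  have "lin_comb M n v (\<lambda>i. a \<otimes> c i) = (\<Oplus>\<^bsub>M\<^esub>i\<in>{..<n}. a \<odot>\<^bsub>M\<^esub> (c i \<odot>\<^bsub>M\<^esub> v i))"
    unfolding lin_comb_def using assms by (intro M.finsum_cong') (auto simp: smult_assoc1 Pi_def)
  also have "\<dots> = a \<odot>\<^bsub>M\<^esub> lin_comb M n v c"
    unfolding lin_comb_def using assms by (intro finsum_smult_ldistr[symmetric]) auto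
  finally show ?thesis .
qed

lemma lin_comb_zero:
  assumes "v \<in> {..<n} \<rightarrow> carrier M"
  shows "lin_comb M n v (\<lambda>i. \<zero>) = \<zero>\<^bsub>M\<^esub>"
proof -
  have "lin_comb M n v (\<lambda>i. \<zero>) = (\<Oplus>\<^bsub>M\<^esub>i\<in>{..<n}. \<zero>\<^bsub>M\<^esub>)"
    unfolding lin_comb_def using assms by (intro M.finsum_cong') (auto simp: Pi_def)
  then show ?thesis by simp
qed

lemma lin_comb_minus:
  assumes v: "v \<in> {..<n} \<rightarrow> carrier M" and c: "c \<in> {..<n} \<rightarrow> carrier R" and d: "d \<in> {..<n} \<rightarrow> carrier R"
  shows "lin_comb M n v (\<lambda>i. c i \<ominus> d i) = lin_comb M n v c \<ominus>\<^bsub>M\<^esub> lin_comb M n v d"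
proof -
  have "lin_comb M n v c = lin_comb M n v (\<lambda>i. (c i \<ominus> d i) \<oplus> d i)"
    using assms by (intro lin_comb_cong) (auto simp: Pi_def R.minus_eq R.a_assoc R.l_neg)
  also have "\<dots> = lin_comb M n v (\<lambda>i. c i \<ominus> d i) \<oplus>\<^bsub>M\<^esub> lin_comb M n v d"
    using assms by (intro lin_comb_add) auto
  finally show ?thesis using lin_comb_closed[OF v, of "\<lambda>i. c i \<ominus> d i"] lin_comb_closed[OF v d] c d
    by (auto simp: M.minus_eq M.a_assoc M.r_neg Pi_def)
qed

lemma lin_comb_delta:
  assumes "v \<in> {..<n} \<rightarrow> carrier M" "j < n" "a \<in> carrier R"
  shows "lin_comb M n v (\<lambda>i. if i = j then a else \<zero>) = a \<odot>\<^bsub>M\<^esub> v j"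
proof -
  have "lin_comb M n v (\<lambda>i. if i = j then a else \<zero>) = (\<Oplus>\<^bsub>M\<^esub>i\<in>{..<n}. if j = i then a \<odot>\<^bsub>M\<^esub> v i else \<zero>\<^bsub>M\<^esub>)"
    unfolding lin_comb_def using assms by (intro M.finsum_cong') (auto simp: Pi_def)
  also have "\<dots> = a \<odot>\<^bsub>M\<^esub> v j" using assms by (intro M.finsum_singleton) auto
  finally show ?thesis .
qed

lemma lin_comb_Suc:
  assumes "v \<in> {..<Suc n} \<rightarrow> carrier M" "c \<in> {..<Suc n} \<rightarrow> carrier R"
  shows "lin_comb M (Suc n) v c = lin_comb M n v c \<oplus>\<^bsub>M\<^esub> c n \<odot>\<^bsub>M\<^esub> v n"
proof -
  have "(\<lambda>i. c i \<odot>\<^bsub>M\<^esub> v i) \<in> {..<n} \<rightarrow> carrier M" "c n \<odot>\<^bsub>M\<^esub> v n \<in> carrier M"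
    using assms by (auto simp: Pi_def)
  then show ?thesis unfolding lin_comb_def lessThan_Suc
    by (subst M.finsum_insert) (auto intro: M.a_comm M.finsum_closed)
qed

lemma lin_comb_submodule:
  assumes N: "submodule N R M" and "\<And>i. i < n \<Longrightarrow> c i \<odot>\<^bsub>M\<^esub> v i \<in> N"
  shows "lin_comb M n v c \<in> N"
proof -
  note N' = submoduleE[OF N]
  have 0: "\<zero>\<^bsub>M\<^esub> \<in> N" using subgroup.one_closed[OF submodule.axioms(1)[OF N]] by simp
  have "finite F \<Longrightarrow> F \<subseteq> {..<n} \<Longrightarrow> (\<Oplus>\<^bsub>M\<^esub>i\<in>F. c i \<odot>\<^bsub>M\<^esub> v i) \<in> N" for F
  proof (induct rule: finite_induct)
    case (insert x F)
    then show ?case using assms(2) N'(1) by (subst M.finsum_insert) (auto intro!: N'(5))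
  qed (simp add: 0)
  then show ?thesis unfolding lin_comb_def by simp
qed

lemma lin_comb_lin_comb:
  assumes "v \<in> {..<p} \<rightarrow> carrier M" "c \<in> {..<n} \<rightarrow> carrier R"
    "\<And>i. i < n \<Longrightarrow> A i \<in> {..<p} \<rightarrow> carrier R"
  shows "lin_comb M n (\<lambda>i. lin_comb M p v (A i)) c = lin_comb M p v (\<lambda>l. \<Oplus>i\<in>{..<n}. c i \<otimes> A i l)"
  using assms(2,3)
proof (induct n)
  case 0
  have "lin_comb M p v (\<lambda>l. \<zero>) = \<zero>\<^bsub>M\<^esub>" using lin_comb_zero[OF assms(1)] .
  then show ?case by (simp add: lin_comb_def)
next
  case (Suc n)
  have c: "c i \<in> carrier R" if "i < Suc n" for i using Suc(2) that by auto
  have A: "A i l \<in> carrier R" if "i < Suc n" "l < p" for i l using Suc(3)[OF that(1)] that(2) by auto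
  have "lin_comb M (Suc n) (\<lambda>i. lin_comb M p v (A i)) c =
    lin_comb M n (\<lambda>i. lin_comb M p v (A i)) c \<oplus>\<^bsub>M\<^esub> c n \<odot>\<^bsub>M\<^esub> lin_comb M p v (A n)"
    using Suc(2,3) assms(1) by (intro lin_comb_Suc) (auto intro!: lin_comb_closed)
  also have "lin_comb M n (\<lambda>i. lin_comb M p v (A i)) c = lin_comb M p v (\<lambda>l. \<Oplus>i\<in>{..<n}. c i \<otimes> A i l)"
    using Suc c by (simp add: Pi_def)
  also have "c n \<odot>\<^bsub>M\<^esub> lin_comb M p v (A n) = lin_comb M p v (\<lambda>l. c n \<otimes> A n l)"
    using Suc(3)[of n] c assms(1) by (intro lin_comb_smult[symmetric]) auto
  also have "lin_comb M p v (\<lambda>l. \<Oplus>i\<in>{..<n}. c i \<otimes> A i l) \<oplus>\<^bsub>M\<^esub> lin_comb M p v (\<lambda>l. c n \<otimes> A n l) =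
      lin_comb M p v (\<lambda>l. (\<Oplus>i\<in>{..<n}. c i \<otimes> A i l) \<oplus> c n \<otimes> A n l)"
    using c A assms(1) by (intro lin_comb_add[symmetric]) (auto intro!: R.finsum_closed)
  also have "\<dots> = lin_comb M p v (\<lambda>l. \<Oplus>i\<in>{..<Suc n}. c i \<otimes> A i l)"
    using c A assms(1)
    by (intro lin_comb_cong) (auto intro!: R.finsum_closed R.finsum_lessThan_Suc[symmetric])
  finally show ?case .
qed

end

text \<open>The counterpart of \<open>finite_basis\<close> for families, with uniqueness of
  coordinates replaced by the absence of nontrivial relations. The two notions are translated into
  each other below.\<close>

definition indexed_basis ::
    "('a, 'b) ring_scheme \<Rightarrow> ('a, 'c, 'd) module_scheme \<Rightarrow> nat \<Rightarrow> (nat \<Rightarrow> 'c) \<Rightarrow> bool" where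
  "indexed_basis R M n v \<longleftrightarrow> v \<in> {..<n} \<rightarrow> carrier M \<and>
     (\<forall>x\<in>carrier M. \<exists>c\<in>{..<n} \<rightarrow> carrier R. x = lin_comb M n v c) \<and>
     (\<forall>c\<in>{..<n} \<rightarrow> carrier R. lin_comb M n v c = \<zero>\<^bsub>M\<^esub> \<longrightarrow> (\<forall>i<n. c i = \<zero>\<^bsub>R\<^esub>))"

context module begin

lemma finsum_reindex_lin_comb:
  assumes v: "v \<in> {..<n} \<rightarrow> carrier M" and inj: "inj_on v {..<n}" and c: "c \<in> v ` {..<n} \<rightarrow> carrier R"
  shows "(\<Oplus>\<^bsub>M\<^esub>b\<in>v ` {..<n}. c b \<odot>\<^bsub>M\<^esub> b) = lin_comb M n v (\<lambda>i. c (v i))"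
  unfolding lin_comb_def using assms by (intro M.finsum_reindex) auto

lemma finite_basis_imp_indexed:
  assumes B: "finite_basis R M B"
  obtains v where "indexed_basis R M (card B) v"
proof -
  have fin: "finite B" and Bc: "B \<subseteq> carrier M"
    and ex1: "\<And>x. x \<in> carrier M \<Longrightarrow> \<exists>!c. c \<in> B \<rightarrow>\<^sub>E carrier R \<and> x = (\<Oplus>\<^bsub>M\<^esub>b\<in>B. c b \<odot>\<^bsub>M\<^esub> b)"
    using B by (auto simp: finite_basis_def)
  obtain v where v: "bij_betw v {..<card B} B"
    using ex_bij_betw_nat_finite[OF fin] by (auto simp: atLeast0LessThan)
  have inj: "inj_on v {..<card B}" and im: "v ` {..<card B} = B" using v by (auto simp: bij_betw_def)
  have vc: "v \<in> {..<card B} \<rightarrow> carrier M" using im Bc by auto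
  note reindex = finsum_reindex_lin_comb[OF vc inj, unfolded im]
  have "indexed_basis R M (card B) v"
    unfolding indexed_basis_def
  proof (intro conjI ballI impI allI)
    fix x assume "x \<in> carrier M"
    then obtain c where c: "c \<in> B \<rightarrow>\<^sub>E carrier R" "x = (\<Oplus>\<^bsub>M\<^esub>b\<in>B. c b \<odot>\<^bsub>M\<^esub> b)" using ex1 by blast
    then have "x = lin_comb M (card B) v (\<lambda>i. c (v i))" using reindex[of c] by auto
    moreover have "(\<lambda>i. c (v i)) \<in> {..<card B} \<rightarrow> carrier R" using c(1) im by auto
    ultimately show "\<exists>c\<in>{..<card B} \<rightarrow> carrier R. x = lin_comb M (card B) v c" by blast
  next
    fix c i assume c: "c \<in> {..<card B} \<rightarrow> carrier R" "lin_comb M (card B) v c = \<zero>\<^bsub>M\<^esub>" and i: "i < card B"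
    define d where "d = (\<lambda>b\<in>B. c (the_inv_into {..<card B} v b))"
    have dv: "d (v j) = c j" if "j < card B" for j
      using that im inj by (auto simp: d_def the_inv_into_f_f)
    have d: "d \<in> B \<rightarrow>\<^sub>E carrier R"
    proof (rule PiE_I)
      fix b assume "b \<in> B"
      then obtain j where "j < card B" "b = v j" using im by auto
      then show "d b \<in> carrier R" using dv c(1) by (simp add: Pi_def)
    qed (simp add: d_def)
    have "(\<Oplus>\<^bsub>M\<^esub>b\<in>B. d b \<odot>\<^bsub>M\<^esub> b) = lin_comb M (card B) v (\<lambda>i. d (v i))" using reindex[of d] d by auto
    also have "\<dots> = lin_comb M (card B) v c" using vc c(1) dv by (intro lin_comb_cong) auto
    finally have d0: "\<zero>\<^bsub>M\<^esub> = (\<Oplus>\<^bsub>M\<^esub>b\<in>B. d b \<odot>\<^bsub>M\<^esub> b)" using c(2) by simp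
    have "(\<Oplus>\<^bsub>M\<^esub>b\<in>B. (\<lambda>b\<in>B. \<zero>) b \<odot>\<^bsub>M\<^esub> b) = (\<Oplus>\<^bsub>M\<^esub>b\<in>B. \<zero>\<^bsub>M\<^esub>)"
      using Bc by (intro M.finsum_cong') auto
    then have "\<zero>\<^bsub>M\<^esub> = (\<Oplus>\<^bsub>M\<^esub>b\<in>B. (\<lambda>b\<in>B. \<zero>) b \<odot>\<^bsub>M\<^esub> b)" by simp
    moreover have "(\<lambda>b\<in>B. \<zero>) \<in> B \<rightarrow>\<^sub>E carrier R" by auto
    ultimately have "d = (\<lambda>b\<in>B. \<zero>)" using ex1[OF M.zero_closed] d d0 by blast
    moreover have "v i \<in> B" using im i by blast
    ultimately show "c i = \<zero>" using dv[OF i] by simp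
  qed (use vc in auto)
  then show thesis by (rule that)
qed

lemma indexed_basis_unique:
  assumes v: "indexed_basis R M n v" and c: "c \<in> {..<n} \<rightarrow> carrier R" and d: "d \<in> {..<n} \<rightarrow> carrier R"
    and eq: "lin_comb M n v c = lin_comb M n v d" and i: "i < n"
  shows "c i = d i"
proof -
  have vc: "v \<in> {..<n} \<rightarrow> carrier M" using v by (simp add: indexed_basis_def)
  have "lin_comb M n v (\<lambda>i. c i \<ominus> d i) = \<zero>\<^bsub>M\<^esub>"
    using lin_comb_minus[OF vc c d] eq lin_comb_closed[OF vc d] by (simp add: M.minus_eq M.r_neg)
  moreover have "(\<lambda>i. c i \<ominus> d i) \<in> {..<n} \<rightarrow> carrier R" using c d by auto
  ultimately have "c i \<ominus> d i = \<zero>" using v i unfolding indexed_basis_def by blast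
  then show ?thesis using c d i by (simp add: Pi_def)
qed

lemma indexed_basis_imp_finite:
  assumes v: "indexed_basis R M n v" and ne: "\<one> \<noteq> \<zero>"
  shows "finite_basis R M (v ` {..<n})" "card (v ` {..<n}) = n"
proof -
  have vc: "v \<in> {..<n} \<rightarrow> carrier M" using v by (simp add: indexed_basis_def)
  have inj: "inj_on v {..<n}"
  proof (rule inj_onI)
    fix i j assume ij: "i \<in> {..<n}" "j \<in> {..<n}" "v i = v j"
    have "lin_comb M n v (\<lambda>l. if l = i then \<one> else \<zero>) = lin_comb M n v (\<lambda>l. if l = j then \<one> else \<zero>)"
      using ij vc by (auto simp: lin_comb_delta Pi_def)
    from indexed_basis_unique[OF v _ _ this, of i] show "i = j" using ij ne by (auto split: if_splits)
  qed
  then show "card (v ` {..<n}) = n" by (simp add: card_image)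
  note reindex = finsum_reindex_lin_comb[OF vc inj]
  show "finite_basis R M (v ` {..<n})"
    unfolding finite_basis_def
  proof (intro conjI ballI ex_ex1I)
    fix x assume "x \<in> carrier M"
    then obtain c where c: "c \<in> {..<n} \<rightarrow> carrier R" "x = lin_comb M n v c" using v by (auto simp: indexed_basis_def)
    define d where "d = (\<lambda>b\<in>v ` {..<n}. c (the_inv_into {..<n} v b))"
    have dv: "d (v j) = c j" if "j < n" for j
      using that inj by (auto simp: d_def the_inv_into_f_f)
    have d: "d \<in> v ` {..<n} \<rightarrow>\<^sub>E carrier R"
    proof (rule PiE_I)
      fix b assume "b \<in> v ` {..<n}"
      then obtain j where "j < n" "b = v j" by auto
      then show "d b \<in> carrier R" using dv c(1) by (simp add: Pi_def)
    qed (simp add: d_def)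
    have "(\<Oplus>\<^bsub>M\<^esub>b\<in>v ` {..<n}. d b \<odot>\<^bsub>M\<^esub> b) = lin_comb M n v (\<lambda>i. d (v i))" using reindex[of d] d by auto
    also have "\<dots> = x" unfolding c(2) using vc d dv c by (intro lin_comb_cong) auto
    finally show "\<exists>c. c \<in> v ` {..<n} \<rightarrow>\<^sub>E carrier R \<and> x = (\<Oplus>\<^bsub>M\<^esub>b\<in>v ` {..<n}. c b \<odot>\<^bsub>M\<^esub> b)" using d by blast
  next
    fix x c d
    assume c: "c \<in> v ` {..<n} \<rightarrow>\<^sub>E carrier R \<and> x = (\<Oplus>\<^bsub>M\<^esub>b\<in>v ` {..<n}. c b \<odot>\<^bsub>M\<^esub> b)"
      and d: "d \<in> v ` {..<n} \<rightarrow>\<^sub>E carrier R \<and> x = (\<Oplus>\<^bsub>M\<^esub>b\<in>v ` {..<n}. d b \<odot>\<^bsub>M\<^esub> b)"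
    have cP: "c \<in> v ` {..<n} \<rightarrow> carrier R" and dP: "d \<in> v ` {..<n} \<rightarrow> carrier R" using c d by auto
    have "lin_comb M n v (\<lambda>i. c (v i)) = lin_comb M n v (\<lambda>i. d (v i))"
      using c d reindex[OF cP] reindex[OF dP] by simp
    moreover have "(\<lambda>i. c (v i)) \<in> {..<n} \<rightarrow> carrier R" "(\<lambda>i. d (v i)) \<in> {..<n} \<rightarrow> carrier R"
      using cP dP by auto
    ultimately have "c (v i) = d (v i)" if "i < n" for i
      using indexed_basis_unique[OF v, of "\<lambda>i. c (v i)" "\<lambda>i. d (v i)" i] that by blast
    then have "c b = d b" if "b \<in> v ` {..<n}" for b using that by blast
    then show "c = d" using PiE_ext[of c "v ` {..<n}" "\<lambda>_. carrier R" d] c d by blast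
  qed (use vc in auto)
qed

end

text \<open>Gaussian elimination: \<open>J\<close> indexes the unknowns and \<open>I\<close> the
  equations. A pivot in row \<open>j0\<close> clears the column \<open>i0\<close> in all other rows,
  which removes one unknown and one equation.\<close>

lemma (in field) exists_nontrivial_relation:
  assumes "finite I" "finite J" "card I < card J" "\<And>j i. j \<in> J \<Longrightarrow> i \<in> I \<Longrightarrow> A j i \<in> carrier R"
  shows "\<exists>c\<in>J \<rightarrow> carrier R. (\<exists>j\<in>J. c j \<noteq> \<zero>) \<and> (\<forall>i\<in>I. (\<Oplus>j\<in>J. c j \<otimes> A j i) = \<zero>)"
  using assms
proof (induct I arbitrary: J A rule: finite_induct)
  case empty
  then have "J \<noteq> {}" by auto
  then show ?case by (intro bexI[of _ "\<lambda>_. \<one>"]) auto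
next
  case (insert i0 I)
  have A: "A j i \<in> carrier R" if "j \<in> J" "i \<in> insert i0 I" for j i using insert(6) that by blast
  show ?case
  proof (cases "\<forall>j\<in>J. A j i0 = \<zero>")
    case True
    have "card I < card J" using insert by auto
    from insert(3)[OF insert(4) this, of A] A
    obtain c where c: "c \<in> J \<rightarrow> carrier R" "\<exists>j\<in>J. c j \<noteq> \<zero>" "\<forall>i\<in>I. (\<Oplus>j\<in>J. c j \<otimes> A j i) = \<zero>" by auto
    have "(\<Oplus>j\<in>J. c j \<otimes> A j i0) = (\<Oplus>j\<in>J. \<zero>)" using c(1) True by (intro finsum_cong') (auto simp: Pi_def)
    then have "(\<Oplus>j\<in>J. c j \<otimes> A j i0) = \<zero>" by simp
    then show ?thesis using c by (intro bexI[of _ c]) auto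
  next
    case False
    then obtain j0 where j0: "j0 \<in> J" "A j0 i0 \<noteq> \<zero>" by blast
    have u: "A j0 i0 \<in> Units R" using j0 A field_Units by auto
    define p where "p = inv (A j0 i0)"
    have p: "p \<in> carrier R" "p \<otimes> A j0 i0 = \<one>" unfolding p_def using u by auto
    define J' where "J' = J - {j0}"
    define A' where "A' j i = A j i \<ominus> (A j i0 \<otimes> p) \<otimes> A j0 i" for j i
    have A': "A' j i \<in> carrier R" if "j \<in> J'" "i \<in> insert i0 I" for j i
      unfolding A'_def using A[of j i] A[of j i0] A[of j0 i] that j0 p by (auto simp: J'_def)
    have "card I < card J'" using insert(1,2,4,5) j0 by (auto simp: J'_def)
    from insert(3)[OF _ this, of A'] A' insert(4)
    obtain c where c: "c \<in> J' \<rightarrow> carrier R" "\<exists>j\<in>J'. c j \<noteq> \<zero>" "\<forall>i\<in>I. (\<Oplus>j\<in>J'. c j \<otimes> A' j i) = \<zero>"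
      by (auto simp: J'_def)
    \<comment> \<open>The negative of \<open>s\<close> is the coefficient of the pivot row that
      turns a relation between the modified rows into one between the original rows.\<close>
    define s where "s = (\<Oplus>j\<in>J'. c j \<otimes> (A j i0 \<otimes> p))"
    have J'J: "J' \<subseteq> J" by (auto simp: J'_def)
    have cc: "c j \<in> carrier R" if "j \<in> J'" for j using c(1) that by auto
    have s: "s \<in> carrier R" unfolding s_def using cc A J'J p by (intro finsum_closed) auto
    define d where "d j = (if j = j0 then \<ominus> s else c j)" for j
    have d: "d \<in> J \<rightarrow> carrier R" using cc s by (auto simp: d_def J'_def)
    have "(\<Oplus>j\<in>J. d j \<otimes> A j i) = (\<Oplus>j\<in>J'. c j \<otimes> A' j i)" if i: "i \<in> insert i0 I" for i
    proof -
      have ij0: "A j0 i \<in> carrier R" using A j0 i by auto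
      have "J = insert j0 J'" using j0 by (auto simp: J'_def)
      then have "(\<Oplus>j\<in>J. d j \<otimes> A j i) = (\<Oplus>j\<in>insert j0 J'. d j \<otimes> A j i)" by simp
      also have "\<dots> = d j0 \<otimes> A j0 i \<oplus> (\<Oplus>j\<in>J'. d j \<otimes> A j i)"
        using insert(4) d A i J'J j0 by (intro finsum_insert) (auto simp: J'_def)
      also have "d j0 \<otimes> A j0 i = (\<Oplus>j\<in>J'. \<ominus> (c j \<otimes> (A j i0 \<otimes> p)) \<otimes> A j0 i)"
      proof -
        have "\<ominus> s = (\<Oplus>j\<in>J'. \<ominus> (c j \<otimes> (A j i0 \<otimes> p)))"
          unfolding s_def using cc A J'J p
          by (intro finsum_additive[of R R "a_inv R"]) (auto simp: minus_add abelian_group_axioms)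
        then have "d j0 \<otimes> A j0 i = (\<Oplus>j\<in>J'. \<ominus> (c j \<otimes> (A j i0 \<otimes> p))) \<otimes> A j0 i" by (simp add: d_def)
        also have "\<dots> = (\<Oplus>j\<in>J'. \<ominus> (c j \<otimes> (A j i0 \<otimes> p)) \<otimes> A j0 i)"
          using insert(4) cc A J'J p ij0 by (intro finsum_ldistr) (auto simp: J'_def)
        finally show ?thesis .
      qed
      also have "(\<Oplus>j\<in>J'. d j \<otimes> A j i) = (\<Oplus>j\<in>J'. c j \<otimes> A j i)"
        using cc A J'J i by (intro finsum_cong') (auto simp: d_def J'_def)
      also have "(\<Oplus>j\<in>J'. \<ominus> (c j \<otimes> (A j i0 \<otimes> p)) \<otimes> A j0 i) \<oplus> (\<Oplus>j\<in>J'. c j \<otimes> A j i) =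
          (\<Oplus>j\<in>J'. \<ominus> (c j \<otimes> (A j i0 \<otimes> p)) \<otimes> A j0 i \<oplus> c j \<otimes> A j i)"
        using cc A J'J p ij0 i by (intro finsum_addf[symmetric]) auto
      also have "\<dots> = (\<Oplus>j\<in>J'. c j \<otimes> A' j i)"
      proof (rule finsum_cong')
        fix j assume j: "j \<in> J'"
        have "c j \<in> carrier R" "A j i \<in> carrier R" "A j i0 \<in> carrier R"
          using cc[OF j] A[of j i] A[of j i0] j J'J i by auto
        then show "\<ominus> (c j \<otimes> (A j i0 \<otimes> p)) \<otimes> A j0 i \<oplus> c j \<otimes> A j i = c j \<otimes> A' j i"
          unfolding A'_def using p(1) ij0 by algebra
      qed (use cc A' i in auto)
      finally show ?thesis .
    qed
    moreover have "(\<Oplus>j\<in>J'. c j \<otimes> A' j i0) = \<zero>"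
    proof -
      have "c j \<otimes> A' j i0 = \<zero>" if j: "j \<in> J'" for j
      proof -
        have "A j i0 \<in> carrier R" using A[of j i0] j J'J by auto
        then have "A' j i0 = \<zero>" unfolding A'_def using p A[of j0 i0] j0 by (simp add: m_assoc minus_eq r_neg)
        then show ?thesis using cc[OF j] by simp
      qed
      then have "(\<Oplus>j\<in>J'. c j \<otimes> A' j i0) = (\<Oplus>j\<in>J'. \<zero>)" by (intro finsum_cong') auto
      then show ?thesis by simp
    qed
    ultimately have "\<forall>i\<in>insert i0 I. (\<Oplus>j\<in>J. d j \<otimes> A j i) = \<zero>" using c(3) by auto
    moreover have "\<exists>j\<in>J. d j \<noteq> \<zero>" using c(2) by (auto simp: d_def J'_def)
    ultimately show ?thesis using d by blast
  qed
qed

text \<open>If \<open>n\<close> exceeded \<open>p\<close>, the \<open>n\<close> coordinate vectors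
  with respect to \<open>w\<close> would be linearly dependent, and so would be the family
  \<open>v\<close>.\<close>

lemma indexed_basis_card_le:
  assumes K: "field K" and V: "module K V" and v: "indexed_basis K V n v" and w: "indexed_basis K V p w"
  shows "n \<le> p"
proof (rule ccontr)
  interpret K: field K by fact
  interpret V: module K V by fact
  assume "\<not> n \<le> p"
  then have lt: "card {..<p} < card {..<n}" by simp
  have vc: "v \<in> {..<n} \<rightarrow> carrier V" and wc: "w \<in> {..<p} \<rightarrow> carrier V" using v w by (auto simp: indexed_basis_def)
  have "\<forall>i<n. \<exists>c\<in>{..<p} \<rightarrow> carrier K. v i = lin_comb V p w c"
    using vc w unfolding indexed_basis_def by blast
  then obtain A where A: "\<And>i. i < n \<Longrightarrow> A i \<in> {..<p} \<rightarrow> carrier K" "\<And>i. i < n \<Longrightarrow> v i = lin_comb V p w (A i)"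
    by metis
  obtain c where c: "c \<in> {..<n} \<rightarrow> carrier K" "\<exists>j\<in>{..<n}. c j \<noteq> \<zero>\<^bsub>K\<^esub>"
    "\<forall>i\<in>{..<p}. (\<Oplus>\<^bsub>K\<^esub>j\<in>{..<n}. c j \<otimes>\<^bsub>K\<^esub> A j i) = \<zero>\<^bsub>K\<^esub>"
    using K.exists_nontrivial_relation[OF _ _ lt, of A] A(1) by (auto simp: Pi_def)
  have "lin_comb V n v c = lin_comb V n (\<lambda>i. lin_comb V p w (A i)) c"
    using vc c(1) A by (intro V.lin_comb_cong) auto
  also have "\<dots> = lin_comb V p w (\<lambda>l. \<Oplus>\<^bsub>K\<^esub>i\<in>{..<n}. c i \<otimes>\<^bsub>K\<^esub> A i l)"
    using wc c(1) A(1) by (rule V.lin_comb_lin_comb)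
  also have "\<dots> = lin_comb V p w (\<lambda>l. \<zero>\<^bsub>K\<^esub>)"
    using wc c(3) by (intro V.lin_comb_cong) auto
  also have "\<dots> = \<zero>\<^bsub>V\<^esub>" using wc by (rule V.lin_comb_zero)
  finally show False using v c(1,2) unfolding indexed_basis_def by blast
qed

text \<open>The definite description in \<open>vector_dim\<close> is meaningful because any two
  finite bases over a field have the same size.\<close>

lemma vector_dim_eqI:
  assumes K: "field K" and V: "module K V" and v: "indexed_basis K V n v"
  shows "vector_dim K V = n"
proof -
  interpret K: field K by fact
  interpret V: module K V by fact
  note B = V.indexed_basis_imp_finite[OF v K.one_not_zero]
  show ?thesis
    unfolding vector_dim_def
  proof (rule the_equality)
    show "\<exists>B. finite_basis K V B \<and> card B = n" using B by blast
    fix d assume "\<exists>B. finite_basis K V B \<and> card B = d"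
    then obtain B where B: "finite_basis K V B" "card B = d" by blast
    then obtain w where "indexed_basis K V d w" using V.finite_basis_imp_indexed by metis
    then show "d = n" using indexed_basis_card_le[OF K V] v by (meson le_antisym)
  qed
qed

section \<open>Quotient modules and minimal generators\<close>

lemma finsum_self_module [simp]: "finsum (self_module R) = finsum R"
  by (rule ext)+ (simp add: finsum_def finprod_def self_module_def)

lemma self_module_simps [simp]:
  "carrier (self_module R) = carrier R" "\<zero>\<^bsub>self_module R\<^esub> = \<zero>\<^bsub>R\<^esub>"
  "a \<oplus>\<^bsub>self_module R\<^esub> b = a \<oplus>\<^bsub>R\<^esub> b" "a \<odot>\<^bsub>self_module R\<^esub> b = a \<otimes>\<^bsub>R\<^esub> b"
  by (simp_all add: self_module_def)

lemma lin_comb_self_module: "lin_comb (self_module R) n x c = (\<Oplus>\<^bsub>R\<^esub>i\<in>{..<n}. c i \<otimes>\<^bsub>R\<^esub> x i)"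
  by (simp add: lin_comb_def)

context module begin

context
  fixes N assumes N: "submodule N R M"
begin

lemma submodule_abelian_subgroup: "abelian_subgroup N M"
  by (intro abelian_subgroupI3 additive_subgroupI submodule.axioms(1)[OF N] M.abelian_group_axioms)

lemma quot_module_carrier: "carrier (quot_module R M N) = (\<lambda>x. N +>\<^bsub>M\<^esub> x) ` carrier M"
  by (auto simp: quot_module_def A_RCOSETS_def')

lemma quot_module_zero: "\<zero>\<^bsub>quot_module R M N\<^esub> = N"
  by (simp add: quot_module_def)

lemma quot_module_add:
  "x \<in> carrier M \<Longrightarrow> y \<in> carrier M \<Longrightarrow>
    (N +>\<^bsub>M\<^esub> x) \<oplus>\<^bsub>quot_module R M N\<^esub> (N +>\<^bsub>M\<^esub> y) = N +>\<^bsub>M\<^esub> (x \<oplus>\<^bsub>M\<^esub> y)"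
  by (simp add: quot_module_def abelian_subgroup.a_rcos_sum[OF submodule_abelian_subgroup])

lemma coset_eq_zero_iff:
  assumes "x \<in> carrier M" shows "N +>\<^bsub>M\<^esub> x = N \<longleftrightarrow> x \<in> N"
  using abelian_subgroup.a_rcos_const[OF submodule_abelian_subgroup]
    abelian_subgroup.a_rcos_self[OF submodule_abelian_subgroup assms] by auto

lemma coset_zero: "N +>\<^bsub>M\<^esub> \<zero>\<^bsub>M\<^esub> = N"
  using coset_eq_zero_iff[OF M.zero_closed] subgroup.one_closed[OF submodule.axioms(1)[OF N]] by simp

lemma quot_module_is_module: "module R (quot_module R M N)"
proof -
  let ?Q = "quot_module R M N"
  note sm = quot_module_smult[OF N]
  show ?thesis
  proof (rule moduleI)
    show "abelian_group ?Q"
    proof (rule abelian_groupI)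
      show "\<zero>\<^bsub>?Q\<^esub> \<in> carrier ?Q"
        using coset_zero by (auto simp: quot_module_carrier quot_module_zero intro!: image_eqI[of _ _ "\<zero>\<^bsub>M\<^esub>"])
      fix X assume "X \<in> carrier ?Q"
      then obtain x where x: "x \<in> carrier M" "X = N +>\<^bsub>M\<^esub> x" by (auto simp: quot_module_carrier)
      show "\<zero>\<^bsub>?Q\<^esub> \<oplus>\<^bsub>?Q\<^esub> X = X"
        using quot_module_add[OF M.zero_closed x(1)] x coset_zero by (simp add: quot_module_zero)
      show "\<exists>Y\<in>carrier ?Q. Y \<oplus>\<^bsub>?Q\<^esub> X = \<zero>\<^bsub>?Q\<^esub>"
        using quot_module_add[of "\<ominus>\<^bsub>M\<^esub> x" x] x coset_zero
        by (intro bexI[of _ "N +>\<^bsub>M\<^esub> (\<ominus>\<^bsub>M\<^esub> x)"]) (auto simp: quot_module_zero quot_module_carrier M.l_neg)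
      fix Y assume "Y \<in> carrier ?Q"
      then obtain y where y: "y \<in> carrier M" "Y = N +>\<^bsub>M\<^esub> y" by (auto simp: quot_module_carrier)
      show "X \<oplus>\<^bsub>?Q\<^esub> Y \<in> carrier ?Q" "X \<oplus>\<^bsub>?Q\<^esub> Y = Y \<oplus>\<^bsub>?Q\<^esub> X"
        using x y by (auto simp: quot_module_add quot_module_carrier M.a_comm)
      fix Z assume "Z \<in> carrier ?Q"
      then obtain z where z: "z \<in> carrier M" "Z = N +>\<^bsub>M\<^esub> z" by (auto simp: quot_module_carrier)
      show "X \<oplus>\<^bsub>?Q\<^esub> Y \<oplus>\<^bsub>?Q\<^esub> Z = X \<oplus>\<^bsub>?Q\<^esub> (Y \<oplus>\<^bsub>?Q\<^esub> Z)"
        using x y z by (simp add: quot_module_add M.a_assoc)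
    qed
    fix a X assume a: "a \<in> carrier R" and "X \<in> carrier ?Q"
    then obtain x where x: "x \<in> carrier M" "X = N +>\<^bsub>M\<^esub> x" by (auto simp: quot_module_carrier)
    show "a \<odot>\<^bsub>?Q\<^esub> X \<in> carrier ?Q" using a x by (auto simp: sm quot_module_carrier)
    { fix b assume b: "b \<in> carrier R"
      show "(a \<oplus> b) \<odot>\<^bsub>?Q\<^esub> X = a \<odot>\<^bsub>?Q\<^esub> X \<oplus>\<^bsub>?Q\<^esub> b \<odot>\<^bsub>?Q\<^esub> X" "(a \<otimes> b) \<odot>\<^bsub>?Q\<^esub> X = a \<odot>\<^bsub>?Q\<^esub> (b \<odot>\<^bsub>?Q\<^esub> X)"
        using a b x by (simp_all add: sm quot_module_add smult_l_distr smult_assoc1) }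
    fix Y assume "Y \<in> carrier ?Q"
    then obtain y where y: "y \<in> carrier M" "Y = N +>\<^bsub>M\<^esub> y" by (auto simp: quot_module_carrier)
    show "a \<odot>\<^bsub>?Q\<^esub> (X \<oplus>\<^bsub>?Q\<^esub> Y) = a \<odot>\<^bsub>?Q\<^esub> X \<oplus>\<^bsub>?Q\<^esub> a \<odot>\<^bsub>?Q\<^esub> Y"
      using a x y by (simp add: sm quot_module_add smult_r_distr)
  next
    fix X assume "X \<in> carrier ?Q"
    then obtain x where x: "x \<in> carrier M" "X = N +>\<^bsub>M\<^esub> x" by (auto simp: quot_module_carrier)
    then show "\<one> \<odot>\<^bsub>?Q\<^esub> X = X" by (simp add: sm)
  qed (rule R.is_cring)
qed

lemma coset_mod_hom: "(\<lambda>x. N +>\<^bsub>M\<^esub> x) \<in> mod_hom R M (quot_module R M N)"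
  unfolding mod_hom_def using quot_module_smult[OF N] by (auto simp: quot_module_add quot_module_carrier)

end

lemma lin_comb_permute:
  assumes v: "v \<in> {..<n} \<rightarrow> carrier M" and c: "c \<in> {..<n} \<rightarrow> carrier R" and t: "bij_betw t {..<n} {..<n}"
  shows "lin_comb M n (\<lambda>i. v (t i)) (\<lambda>i. c (t i)) = lin_comb M n v c"
proof -
  have "(\<Oplus>\<^bsub>M\<^esub>i\<in>t ` {..<n}. c i \<odot>\<^bsub>M\<^esub> v i) = (\<Oplus>\<^bsub>M\<^esub>i\<in>{..<n}. c (t i) \<odot>\<^bsub>M\<^esub> v (t i))"
    using t v c by (intro M.finsum_reindex) (auto simp: bij_betw_def)
  then show ?thesis using t by (simp add: lin_comb_def bij_betw_def)
qed

end

definition index_generates :: "('a, 'b) ring_scheme \<Rightarrow> ('a, 'c, 'd) module_scheme \<Rightarrow> nat \<Rightarrow> (nat \<Rightarrow> 'c) \<Rightarrow> 'c set \<Rightarrow> bool" where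
  "index_generates R M n v K \<longleftrightarrow> v \<in> {..<n} \<rightarrow> K \<and> (\<forall>x\<in>K. \<exists>c\<in>{..<n} \<rightarrow> carrier R. x = lin_comb M n v c)"

text \<open>Minimality is expressed through relations. For a submodule \<open>K\<close> it says that
  the \<open>v i\<close> form a basis of K modulo \<mm>K; in this form it makes a cover by a free
  module one step of a minimal resolution.\<close>

definition minimally_generates ::
    "('a, 'b) ring_scheme \<Rightarrow> 'a set \<Rightarrow> ('a, 'c, 'd) module_scheme \<Rightarrow> nat \<Rightarrow> (nat \<Rightarrow> 'c) \<Rightarrow> 'c set \<Rightarrow> bool" where
  "minimally_generates R \<mm> M n v K \<longleftrightarrow> index_generates R M n v K \<and>
     (\<forall>c\<in>{..<n} \<rightarrow> carrier R. lin_comb M n v c = \<zero>\<^bsub>M\<^esub> \<longrightarrow> (\<forall>i<n. c i \<in> \<mm>))"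

context noetherian_local_ring begin

lemma exists_minimal_generators:
  assumes M: "module R M" and K: "K \<subseteq> carrier M" and fg: "\<exists>n v. index_generates R M n v K"
  shows "\<exists>n v. minimally_generates R \<mm> M n v K"
proof -
  interpret M: module R M by fact
  define n where "n = (LEAST n. \<exists>v. index_generates R M n v K)"
  have "\<exists>v. index_generates R M n v K" unfolding n_def using fg by (rule LeastI_ex)
  then obtain v where v: "index_generates R M n v K" by blast
  have least: "n \<le> m" if "index_generates R M m w K" for m w
    unfolding n_def using that by (blast intro: Least_le)
  have vc: "v \<in> {..<n} \<rightarrow> carrier M" using v K by (auto simp: index_generates_def)
  have "c l \<in> \<mm>" if c: "c \<in> {..<n} \<rightarrow> carrier R" "lin_comb M n v c = \<zero>\<^bsub>M\<^esub>" and l: "l < n" for c l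
  proof (rule ccontr)
    assume "c l \<notin> \<mm>"
    then obtain u where u: "u \<in> carrier R" "u \<otimes> c l = \<one>" using unit_if_notin_maximal c(1) l by (metis PiE lessThan_iff)
    obtain m where m: "n = Suc m" using l by (cases n) auto
    \<comment> \<open>The redundant generator is swapped into the last position, so that dropping it
      leaves an initial segment.\<close>
    define t where "t = Transposition.transpose l m"
    have t: "bij_betw t {..<n} {..<n}" unfolding t_def using l m by (intro bij_betw_transpose_iff) auto
    have tn: "t i < n" if "i < n" for i using t that by (auto simp: bij_betw_def)
    have tm: "t m = l" by (simp add: t_def)
    define w where "w i = v (t i)" for i
    have wc: "w \<in> {..<Suc m} \<rightarrow> carrier M" "w \<in> {..<m} \<rightarrow> carrier M"
      unfolding w_def using vc tn m by (auto simp: Pi_def)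
    have wm: "w m \<in> carrier M" using wc(1) by auto
    have permuted: "lin_comb M n w (\<lambda>i. d (t i)) = lin_comb M n v d" if "d \<in> {..<n} \<rightarrow> carrier R" for d
      unfolding w_def using M.lin_comb_permute[OF vc that t] .
    have ct: "(\<lambda>i. c (t i)) \<in> {..<Suc m} \<rightarrow> carrier R" using c(1) tn m by (auto simp: Pi_def)
    define s where "s = lin_comb M m w (\<lambda>i. c (t i))"
    have s: "s \<in> carrier M" unfolding s_def using ct by (intro M.lin_comb_closed wc) auto
    have cl: "c l \<in> carrier R" using c(1) l by auto
    have cti: "c (t i) \<in> carrier R" if "i < m" for i using ct that by (auto simp: Pi_def)
    have "s \<oplus>\<^bsub>M\<^esub> c l \<odot>\<^bsub>M\<^esub> w m = \<zero>\<^bsub>M\<^esub>"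
      using permuted[OF c(1)] c(2) M.lin_comb_Suc[OF wc(1) ct] tm m by (simp add: s_def)
    then have "c l \<odot>\<^bsub>M\<^esub> w m \<oplus>\<^bsub>M\<^esub> s = \<zero>\<^bsub>M\<^esub>"
      using M.M.a_comm[OF s, of "c l \<odot>\<^bsub>M\<^esub> w m"] wm cl by simp
    then have "c l \<odot>\<^bsub>M\<^esub> w m = \<ominus>\<^bsub>M\<^esub> s"
      using M.M.minus_equality[of "c l \<odot>\<^bsub>M\<^esub> w m" s] s wm cl by simp
    then have "u \<odot>\<^bsub>M\<^esub> (c l \<odot>\<^bsub>M\<^esub> w m) = u \<odot>\<^bsub>M\<^esub> (\<ominus>\<^bsub>M\<^esub> s)" by simp
    then have "w m = u \<odot>\<^bsub>M\<^esub> (\<ominus>\<^bsub>M\<^esub> s)" using u cl wm by (simp flip: M.smult_assoc1)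
    also have "\<dots> = (\<ominus> u) \<odot>\<^bsub>M\<^esub> s" using u s by (simp add: M.smult_r_minus M.smult_l_minus)
    also have "\<dots> = lin_comb M m w (\<lambda>i. \<ominus> u \<otimes> c (t i))"
      unfolding s_def using ct u by (intro M.lin_comb_smult[symmetric] wc) auto
    finally have wm_eq: "w m = lin_comb M m w (\<lambda>i. \<ominus> u \<otimes> c (t i))" .
    have "index_generates R M m w K"
      unfolding index_generates_def
    proof (intro conjI ballI)
      show "w \<in> {..<m} \<rightarrow> K" using v tn m unfolding w_def index_generates_def by (auto simp: Pi_def)
      fix x assume "x \<in> K"
      then obtain d where d: "d \<in> {..<n} \<rightarrow> carrier R" "x = lin_comb M n v d" using v by (auto simp: index_generates_def)
      have dt: "(\<lambda>i. d (t i)) \<in> {..<Suc m} \<rightarrow> carrier R" using d(1) tn m by (auto simp: Pi_def)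
      have dl: "d l \<in> carrier R" using d(1) l by auto
      have "x = lin_comb M m w (\<lambda>i. d (t i)) \<oplus>\<^bsub>M\<^esub> d l \<odot>\<^bsub>M\<^esub> w m"
        using permuted[OF d(1)] d(2) M.lin_comb_Suc[OF wc(1) dt] tm m by simp
      also have "d l \<odot>\<^bsub>M\<^esub> w m = lin_comb M m w (\<lambda>i. d l \<otimes> (\<ominus> u \<otimes> c (t i)))"
        unfolding wm_eq using cti u dl by (intro M.lin_comb_smult[symmetric] wc) auto
      also have "lin_comb M m w (\<lambda>i. d (t i)) \<oplus>\<^bsub>M\<^esub> \<dots> = lin_comb M m w (\<lambda>i. d (t i) \<oplus> d l \<otimes> (\<ominus> u \<otimes> c (t i)))"
        using dt cti u dl by (intro M.lin_comb_add[symmetric] wc) (auto simp: Pi_def)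
      finally show "\<exists>c\<in>{..<m} \<rightarrow> carrier R. x = lin_comb M m w c"
        using dt ct u dl by (intro bexI[of _ "\<lambda>i. d (t i) \<oplus> d l \<otimes> (\<ominus> u \<otimes> c (t i))"]) (auto simp: Pi_def)
    qed
    then show False using least[of m w] m by simp
  qed
  then show ?thesis using v unfolding minimally_generates_def by blast
qed

lemma residue_space_module:
  assumes V: "module R V" and ann: "\<And>a x. a \<in> \<mm> \<Longrightarrow> x \<in> carrier V \<Longrightarrow> a \<odot>\<^bsub>V\<^esub> x = \<zero>\<^bsub>V\<^esub>"
  shows "module (R Quot \<mm>) (residue_space R V)"
proof -
  interpret V: module R V by fact
  interpret I: ideal \<mm> R by (rule maximal_ideal)
  let ?W = "residue_space R V" and ?K = "R Quot \<mm>"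
  note sm = residue_space_smult[OF V ann]
  have W [simp]: "carrier ?W = carrier V" "\<zero>\<^bsub>?W\<^esub> = \<zero>\<^bsub>V\<^esub>" "x \<oplus>\<^bsub>?W\<^esub> y = x \<oplus>\<^bsub>V\<^esub> y" for x y
    by (simp_all add: residue_space_def)
  have K: "\<exists>a\<in>carrier R. X = \<mm> +> a" if "X \<in> carrier ?K" for X
    using that by (auto simp: FactRing_def A_RCOSETS_def')
  have Kadd: "(\<mm> +> a) \<oplus>\<^bsub>?K\<^esub> (\<mm> +> b) = \<mm> +> (a \<oplus> b)" if "a \<in> carrier R" "b \<in> carrier R" for a b
    using that by (simp add: FactRing_def I.a_rcos_sum)
  have Kmult: "(\<mm> +> a) \<otimes>\<^bsub>?K\<^esub> (\<mm> +> b) = \<mm> +> (a \<otimes> b)" if "a \<in> carrier R" "b \<in> carrier R" for a b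
    using that by (simp add: FactRing_def I.rcoset_mult_add)
  show ?thesis
  proof (rule moduleI)
    show "cring ?K" by (rule I.quotient_is_cring[OF is_cring])
    show "abelian_group ?W"
    proof (rule abelian_groupI)
      fix x assume "x \<in> carrier ?W"
      then show "\<exists>y\<in>carrier ?W. y \<oplus>\<^bsub>?W\<^esub> x = \<zero>\<^bsub>?W\<^esub>"
        by (intro bexI[of _ "\<ominus>\<^bsub>V\<^esub> x"]) (auto simp: V.M.l_neg)
    qed (auto simp: V.M.a_assoc intro: V.M.a_comm)
    fix X x assume X: "X \<in> carrier ?K" and x: "x \<in> carrier ?W"
    obtain a where a: "a \<in> carrier R" "X = \<mm> +> a" using K[OF X] by blast
    show "X \<odot>\<^bsub>?W\<^esub> x \<in> carrier ?W" using a x by (simp add: sm)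
    { fix Y assume "Y \<in> carrier ?K"
      then obtain b where b: "b \<in> carrier R" "Y = \<mm> +> b" using K by blast
      show "(X \<oplus>\<^bsub>?K\<^esub> Y) \<odot>\<^bsub>?W\<^esub> x = X \<odot>\<^bsub>?W\<^esub> x \<oplus>\<^bsub>?W\<^esub> Y \<odot>\<^bsub>?W\<^esub> x"
        using a b x by (simp add: sm Kadd V.smult_l_distr)
      show "(X \<otimes>\<^bsub>?K\<^esub> Y) \<odot>\<^bsub>?W\<^esub> x = X \<odot>\<^bsub>?W\<^esub> (Y \<odot>\<^bsub>?W\<^esub> x)"
        using a b x by (simp add: sm Kmult V.smult_assoc1) }
    fix y assume "y \<in> carrier ?W"
    then show "X \<odot>\<^bsub>?W\<^esub> (x \<oplus>\<^bsub>?W\<^esub> y) = X \<odot>\<^bsub>?W\<^esub> x \<oplus>\<^bsub>?W\<^esub> X \<odot>\<^bsub>?W\<^esub> y"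
      using a x by (simp add: sm V.smult_r_distr)
  next
    fix x assume "x \<in> carrier ?W"
    then show "\<one>\<^bsub>?K\<^esub> \<odot>\<^bsub>?W\<^esub> x = x" using sm[of \<one> x] by (simp add: FactRing_def)
  qed
qed

text \<open>A coefficient in \<mm> is zero in the residue field, so minimal generators of a module
  killed by \<mm> are a basis over that field.\<close>

lemma residue_space_dim:
  assumes V: "module R V" and ann: "\<And>a x. a \<in> \<mm> \<Longrightarrow> x \<in> carrier V \<Longrightarrow> a \<odot>\<^bsub>V\<^esub> x = \<zero>\<^bsub>V\<^esub>"
    and v: "minimally_generates R \<mm> V n v (carrier V)"
  shows "vector_dim (R Quot \<mm>) (residue_space R V) = n"
proof (rule vector_dim_eqI)
  interpret V: module R V by fact
  interpret I: maximalideal \<mm> R by (rule maximal)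
  let ?W = "residue_space R V" and ?K = "R Quot \<mm>"
  show "field ?K" by (rule I.quotient_is_field[OF is_cring])
  show "module ?K ?W" by (rule residue_space_module[OF V ann])
  interpret W: module ?K ?W by (rule residue_space_module[OF V ann])
  have vc: "v \<in> {..<n} \<rightarrow> carrier V" using v by (auto simp: minimally_generates_def index_generates_def)
  have lc: "lin_comb ?W n v (\<lambda>i. \<mm> +> c i) = lin_comb V n v c" if c: "c \<in> {..<n} \<rightarrow> carrier R" for c
  proof -
    have "lin_comb ?W n v (\<lambda>i. \<mm> +> c i) = (\<Oplus>\<^bsub>V\<^esub>i\<in>{..<n}. (\<mm> +> c i) \<odot>\<^bsub>?W\<^esub> v i)"
      by (simp add: lin_comb_def finsum_def finprod_def residue_space_def)
    also have "\<dots> = lin_comb V n v c"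
      unfolding lin_comb_def using c vc
      by (intro V.M.finsum_cong') (auto intro!: residue_space_smult[OF V ann] simp: Pi_def)
    finally show ?thesis .
  qed
  have rep: "\<exists>c\<in>{..<n} \<rightarrow> carrier R. \<forall>i<n. C i = \<mm> +> c i" if "C \<in> {..<n} \<rightarrow> carrier ?K" for C
  proof -
    have "\<forall>i<n. \<exists>a\<in>carrier R. C i = \<mm> +> a" using that by (auto simp: FactRing_def A_RCOSETS_def' Pi_def)
    then obtain c where "\<forall>i<n. c i \<in> carrier R \<and> C i = \<mm> +> c i" by metis
    then show ?thesis by (intro bexI[of _ c]) auto
  qed
  have Kc: "(\<lambda>i. \<mm> +> c i) \<in> {..<n} \<rightarrow> carrier ?K" if "c \<in> {..<n} \<rightarrow> carrier R" for c
    using that by (auto simp: FactRing_def A_RCOSETS_def' Pi_def)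
  have W [simp]: "carrier ?W = carrier V" "\<zero>\<^bsub>?W\<^esub> = \<zero>\<^bsub>V\<^esub>" by (simp_all add: residue_space_def)
  show "indexed_basis ?K ?W n v"
    unfolding indexed_basis_def
  proof (intro conjI ballI impI allI)
    show "v \<in> {..<n} \<rightarrow> carrier ?W" using vc by simp
    fix x assume "x \<in> carrier ?W"
    then obtain c where c: "c \<in> {..<n} \<rightarrow> carrier R" "x = lin_comb V n v c"
      using v by (auto simp: minimally_generates_def index_generates_def)
    then show "\<exists>C\<in>{..<n} \<rightarrow> carrier ?K. x = lin_comb ?W n v C"
      using lc[OF c(1)] Kc[OF c(1)] by (intro bexI[of _ "\<lambda>i. \<mm> +> c i"]) auto
  next
    fix C i assume C: "C \<in> {..<n} \<rightarrow> carrier ?K" "lin_comb ?W n v C = \<zero>\<^bsub>?W\<^esub>" and i: "i < n"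
    obtain c where c: "c \<in> {..<n} \<rightarrow> carrier R" "\<forall>i<n. C i = \<mm> +> c i" using rep[OF C(1)] by blast
    have "lin_comb ?W n v C = lin_comb ?W n v (\<lambda>i. \<mm> +> c i)"
      using C(1) c(2) vc by (intro W.lin_comb_cong) auto
    then have "lin_comb V n v c = \<zero>\<^bsub>V\<^esub>" using lc[OF c(1)] C(2) by simp
    then have "c i \<in> \<mm>" using v c(1) i by (auto simp: minimally_generates_def)
    then show "C i = \<zero>\<^bsub>?K\<^esub>" using c(2) i I.a_rcos_const by (simp add: FactRing_def)
  qed
qed

lemma ideal_submodule:
  assumes "ideal J R" shows "submodule J R (self_module R)"
proof -
  interpret J: ideal J R by fact
  interpret module R "self_module R" by (rule module_self)
  show ?thesis
  proof (rule submoduleI)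
    fix a assume "a \<in> J"
    moreover have "\<ominus>\<^bsub>self_module R\<^esub> a = \<ominus> a" by (simp add: a_inv_def m_inv_def self_module_def)
    ultimately show "\<ominus>\<^bsub>self_module R\<^esub> a \<in> J" by simp
  qed (auto simp: J.I_l_closed J.Icarr)
qed

lemma submodule_of_submodule:
  assumes M: "module R M" and A: "submodule A R M" and B: "submodule B R M" "B \<subseteq> A"
  shows "submodule B R (M\<lparr>carrier := A\<rparr>)"
proof -
  interpret M: module R M by fact
  interpret A: module R "M\<lparr>carrier := A\<rparr>" by (rule submodule.submodule_is_module[OF A M])
  show ?thesis
    by (rule A.module_incl_imp_submodule) (use B submodule.submodule_is_module[OF B(1) M] in simp_all)
qed

section \<open>The vector space \<mm>/J\<close>

abbreviation max_quot :: "'a set \<Rightarrow> ('a, 'a set) module" where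
  "max_quot J \<equiv> quot_module R ((self_module R)\<lparr>carrier := \<mm>\<rparr>) J"

context
  fixes J assumes J: "ideal J R" "J \<subseteq> \<mm>" and mJ: "\<And>a b. a \<in> \<mm> \<Longrightarrow> b \<in> \<mm> \<Longrightarrow> a \<otimes> b \<in> J"
begin

lemma max_module: "module R ((self_module R)\<lparr>carrier := \<mm>\<rparr>)"
  by (rule submodule.submodule_is_module[OF ideal_submodule[OF maximal_ideal] module_self])

lemma max_submodule: "submodule J R ((self_module R)\<lparr>carrier := \<mm>\<rparr>)"
  by (rule submodule_of_submodule[OF module_self ideal_submodule[OF maximal_ideal] ideal_submodule[OF J(1)] J(2)])

lemma max_quot_module: "module R (max_quot J)"
  by (rule module.quot_module_is_module[OF max_module max_submodule])

lemma max_quot_carrier: "carrier (max_quot J) = (\<lambda>x. J +> x) ` \<mm>"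
  using module.quot_module_carrier[OF max_module max_submodule]
  by (simp add: a_r_coset_def r_coset_def self_module_def)

lemma max_quot_ann:
  assumes "a \<in> \<mm>" "X \<in> carrier (max_quot J)"
  shows "a \<odot>\<^bsub>max_quot J\<^esub> X = \<zero>\<^bsub>max_quot J\<^esub>"
proof -
  let ?M = "(self_module R)\<lparr>carrier := \<mm>\<rparr>"
  obtain x where x: "x \<in> \<mm>" "X = J +>\<^bsub>?M\<^esub> x"
    using assms(2) module.quot_module_carrier[OF max_module max_submodule] by auto
  have a: "a \<in> carrier R" using assms(1) ideal.Icarr[OF maximal_ideal] by simp
  have "a \<odot>\<^bsub>max_quot J\<^esub> X = J +>\<^bsub>?M\<^esub> (a \<otimes> x)"
    unfolding x(2) using module.quot_module_smult[OF max_module max_submodule a, of x] x(1) by simp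
  also have "\<dots> = J"
    using module.coset_eq_zero_iff[OF max_module max_submodule, of "a \<otimes> x"] mJ[OF assms(1) x(1)] J(2) by auto
  finally show ?thesis by (simp add: quot_module_def)
qed

lemma max_quot_lin_comb:
  assumes x: "x \<in> {..<n} \<rightarrow> \<mm>" and c: "c \<in> {..<n} \<rightarrow> carrier R"
  shows "lin_comb (max_quot J) n (\<lambda>i. J +> x i) c = J +> (\<Oplus>i\<in>{..<n}. c i \<otimes> x i)"
proof -
  let ?M = "(self_module R)\<lparr>carrier := \<mm>\<rparr>"
  have co: "J +>\<^bsub>?M\<^esub> u = J +> u" for u by (simp add: a_r_coset_def r_coset_def self_module_def)
  have "id \<in> mod_hom R ?M (self_module R)"
    using ideal.Icarr[OF maximal_ideal] by (auto simp: mod_hom_def)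
  from mod_hom_lin_comb[OF max_module module_self this, of x n c] x c
  have "lin_comb ?M n x c = (\<Oplus>i\<in>{..<n}. c i \<otimes> x i)" by (simp add: lin_comb_self_module)
  with mod_hom_lin_comb[OF max_module max_quot_module module.coset_mod_hom[OF max_module max_submodule], of x n c] x c
  show ?thesis by (simp add: co)
qed

lemma dim_max_quot_eqI:
  assumes x: "x \<in> {..<n} \<rightarrow> \<mm>"
    and gen: "\<And>u. u \<in> \<mm> \<Longrightarrow> \<exists>c\<in>{..<n} \<rightarrow> carrier R. \<exists>j\<in>J. u = j \<oplus> (\<Oplus>i\<in>{..<n}. c i \<otimes> x i)"
    and indep: "\<And>c i. c \<in> {..<n} \<rightarrow> carrier R \<Longrightarrow> (\<Oplus>i\<in>{..<n}. c i \<otimes> x i) \<in> J \<Longrightarrow> i < n \<Longrightarrow> c i \<in> \<mm>"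
  shows "dim_max_quot R \<mm> J = n"
  unfolding dim_max_quot_def
proof (rule residue_space_dim[OF max_quot_module max_quot_ann])
  interpret J: ideal J R by (rule J)
  have xc: "x i \<in> carrier R" if "i < n" for i using x that ideal.Icarr[OF maximal_ideal] by auto
  have sc: "(\<Oplus>i\<in>{..<n}. c i \<otimes> x i) \<in> carrier R" if "c \<in> {..<n} \<rightarrow> carrier R" for c
    using that xc by (intro finsum_closed) auto
  show "minimally_generates R \<mm> (max_quot J) n (\<lambda>i. J +> x i) (carrier (max_quot J))"
    unfolding minimally_generates_def index_generates_def
  proof (intro conjI ballI impI allI)
    show "(\<lambda>i. J +> x i) \<in> {..<n} \<rightarrow> carrier (max_quot J)" using x by (auto simp: max_quot_carrier)
    fix X assume "X \<in> carrier (max_quot J)"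
    then obtain u where u: "u \<in> \<mm>" "X = J +> u" by (auto simp: max_quot_carrier)
    obtain c j where c: "c \<in> {..<n} \<rightarrow> carrier R" "j \<in> J" "u = j \<oplus> (\<Oplus>i\<in>{..<n}. c i \<otimes> x i)" using gen[OF u(1)] by blast
    have "u \<in> J +> (\<Oplus>i\<in>{..<n}. c i \<otimes> x i)" using c(2,3) by (auto simp: a_r_coset_def r_coset_def)
    then have "J +> (\<Oplus>i\<in>{..<n}. c i \<otimes> x i) = X"
      using u(2) a_repr_independence[OF _ sc[OF c(1)] J.a_subgroup] by simp
    then show "\<exists>c\<in>{..<n} \<rightarrow> carrier R. X = lin_comb (max_quot J) n (\<lambda>i. J +> x i) c"
      using max_quot_lin_comb[OF x c(1)] c(1) by auto
  next
    fix c i assume c: "c \<in> {..<n} \<rightarrow> carrier R" "lin_comb (max_quot J) n (\<lambda>i. J +> x i) c = \<zero>\<^bsub>max_quot J\<^esub>" and i: "i < n"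
    have "J +> (\<Oplus>i\<in>{..<n}. c i \<otimes> x i) = J"
      using c(2) max_quot_lin_comb[OF x c(1)] by (simp add: quot_module_def)
    then have "(\<Oplus>i\<in>{..<n}. c i \<otimes> x i) \<in> J" using J.a_rcos_self[OF sc[OF c(1)]] by simp
    then show "c i \<in> \<mm>" using indep c(1) i by blast
  qed
qed

text \<open>As \<open>vector_dim\<close> is a definite description, a positive value needs an actual
  basis. It comes from a minimal generating system of \<mm>/J, which is nonempty because
  \<open>J\<close> differs from \<mm>.\<close>

lemma dim_max_quot_pos:
  assumes ne: "J \<noteq> \<mm>" and fg: "\<exists>n v. index_generates R (self_module R) n v \<mm>"
  shows "dim_max_quot R \<mm> J \<ge> 1"
proof -
  obtain n x where x: "index_generates R (self_module R) n x \<mm>" using fg by blast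
  then have xm: "x \<in> {..<n} \<rightarrow> \<mm>" by (simp add: index_generates_def)
  have "index_generates R (max_quot J) n (\<lambda>i. J +> x i) (carrier (max_quot J))"
    unfolding index_generates_def
  proof (intro conjI ballI)
    show "(\<lambda>i. J +> x i) \<in> {..<n} \<rightarrow> carrier (max_quot J)" using xm by (auto simp: max_quot_carrier)
    fix X assume "X \<in> carrier (max_quot J)"
    then obtain u where u: "u \<in> \<mm>" "X = J +> u" by (auto simp: max_quot_carrier)
    then obtain c where "c \<in> {..<n} \<rightarrow> carrier R" "u = (\<Oplus>i\<in>{..<n}. c i \<otimes> x i)"
      using x by (auto simp: index_generates_def lin_comb_self_module)
    then show "\<exists>c\<in>{..<n} \<rightarrow> carrier R. X = lin_comb (max_quot J) n (\<lambda>i. J +> x i) c"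
      using max_quot_lin_comb[OF xm] u by auto
  qed
  then obtain p v where v: "minimally_generates R \<mm> (max_quot J) p v (carrier (max_quot J))"
    using exists_minimal_generators[OF max_quot_module subset_refl] by blast
  have "dim_max_quot R \<mm> J = p"
    unfolding dim_max_quot_def by (rule residue_space_dim[OF max_quot_module max_quot_ann v])
  moreover have "p \<noteq> 0"
  proof
    assume "p = 0"
    obtain u where u: "u \<in> \<mm>" "u \<notin> J" using ne J(2) by blast
    then have "J +> u \<in> carrier (max_quot J)" by (auto simp: max_quot_carrier)
    then obtain c where "J +> u = lin_comb (max_quot J) p v c"
      using v by (auto simp: minimally_generates_def index_generates_def)
    interpret Q: module R "max_quot J" by (rule max_quot_module)
    have "lin_comb (max_quot J) p v c = \<zero>\<^bsub>max_quot J\<^esub>" using \<open>p = 0\<close> by (simp add: lin_comb_def)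
    then have "J +> u = J" using \<open>J +> u = _\<close> by (simp add: quot_module_def)
    moreover have "u \<in> J +> u"
      using abelian_subgroup.a_rcos_self[OF ideal.axioms(1)[OF J(1), THEN abelian_subgroupI3[OF _ abelian_group_axioms]]]
        u ideal.Icarr[OF maximal_ideal] by blast
    ultimately show False using u by simp
  qed
  ultimately show ?thesis by simp
qed

end
end

section \<open>Free modules over a noetherian local ring\<close>

lemma free_module_simps [simp]:
  "carrier (free_module R n) = {..<n} \<rightarrow>\<^sub>E carrier R"
  "i < n \<Longrightarrow> \<zero>\<^bsub>free_module R n\<^esub> i = \<zero>\<^bsub>R\<^esub>"
  "i < n \<Longrightarrow> (x \<oplus>\<^bsub>free_module R n\<^esub> y) i = x i \<oplus>\<^bsub>R\<^esub> y i"
  "i < n \<Longrightarrow> (a \<odot>\<^bsub>free_module R n\<^esub> x) i = a \<otimes>\<^bsub>R\<^esub> x i"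
  by (simp_all add: free_module_def)

lemma PiE_lessThan_ext:
  fixes n :: nat
  assumes "x \<in> {..<n} \<rightarrow>\<^sub>E A" "y \<in> {..<n} \<rightarrow>\<^sub>E B" "\<And>i. i < n \<Longrightarrow> x i = y i"
  shows "x = y"
proof (rule extensionalityI)
  show "x \<in> extensional {..<n}" "y \<in> extensional {..<n}" using assms(1,2) by (auto simp: PiE_def)
qed (simp add: assms(3))

definition std_basis :: "('a, 'b) ring_scheme \<Rightarrow> nat \<Rightarrow> nat \<Rightarrow> nat \<Rightarrow> 'a" where
  "std_basis R n j = (\<lambda>i\<in>{..<n}. if i = j then \<one>\<^bsub>R\<^esub> else \<zero>\<^bsub>R\<^esub>)"

lemma (in module) lin_comb_append:
  assumes v: "v \<in> {..<n} \<rightarrow> carrier M" and w: "w \<in> {..<p} \<rightarrow> carrier M"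
    and c: "c \<in> {..<n} \<rightarrow> carrier R" and d: "d \<in> {..<p} \<rightarrow> carrier R"
  shows "lin_comb M (n + p) (\<lambda>i. if i < n then v i else w (i - n)) (\<lambda>i. if i < n then c i else d (i - n)) =
    lin_comb M n v c \<oplus>\<^bsub>M\<^esub> lin_comb M p w d"
  using w d
proof (induct p)
  case 0
  have "lin_comb M n (\<lambda>i. if i < n then v i else w (i - n)) (\<lambda>i. if i < n then c i else d (i - n)) = lin_comb M n v c"
    using v c by (intro lin_comb_cong) auto
  moreover have "lin_comb M 0 w d = \<zero>\<^bsub>M\<^esub>" by (simp add: lin_comb_def)
  ultimately show ?case using lin_comb_closed[OF v c] by simp
next
  case (Suc p)
  have w: "w \<in> {..<p} \<rightarrow> carrier M" "w p \<in> carrier M" and d: "d \<in> {..<p} \<rightarrow> carrier R" "d p \<in> carrier R"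
    using Suc(2,3) by (auto simp: Pi_def)
  let ?v = "\<lambda>i. if i < n then v i else w (i - n)" and ?c = "\<lambda>i. if i < n then c i else d (i - n)"
  have "lin_comb M (Suc (n + p)) ?v ?c = lin_comb M (n + p) ?v ?c \<oplus>\<^bsub>M\<^esub> ?c (n + p) \<odot>\<^bsub>M\<^esub> ?v (n + p)"
    using Suc(2,3) v c by (intro lin_comb_Suc) (auto simp: Pi_def)
  also have "\<dots> = (lin_comb M n v c \<oplus>\<^bsub>M\<^esub> lin_comb M p w d) \<oplus>\<^bsub>M\<^esub> d p \<odot>\<^bsub>M\<^esub> w p" using Suc(1)[OF w(1) d(1)] by simp
  also have "\<dots> = lin_comb M n v c \<oplus>\<^bsub>M\<^esub> (lin_comb M p w d \<oplus>\<^bsub>M\<^esub> d p \<odot>\<^bsub>M\<^esub> w p)"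
    using lin_comb_closed[OF v c] lin_comb_closed[OF w(1) d(1)] w(2) d(2) by (intro M.a_assoc) auto
  also have "lin_comb M p w d \<oplus>\<^bsub>M\<^esub> d p \<odot>\<^bsub>M\<^esub> w p = lin_comb M (Suc p) w d"
    using Suc(2,3) by (intro lin_comb_Suc[symmetric])
  finally show ?case by simp
qed

lemma (in module) lin_comb_mod_hom:
  assumes v: "v \<in> {..<n} \<rightarrow> carrier M"
  shows "(\<lambda>c. lin_comb M n v c) \<in> mod_hom R (free_module R n) M"
  unfolding mod_hom_def
proof (intro CollectI conjI ballI)
  show "lin_comb M n v \<in> carrier (free_module R n) \<rightarrow> carrier M"
    using v by (auto intro!: lin_comb_closed)
  fix x assume "x \<in> carrier (free_module R n)"
  then have x: "x \<in> {..<n} \<rightarrow> carrier R" by auto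
  { fix y assume "y \<in> carrier (free_module R n)"
    then have y: "y \<in> {..<n} \<rightarrow> carrier R" by auto
    have "lin_comb M n v (x \<oplus>\<^bsub>free_module R n\<^esub> y) = lin_comb M n v (\<lambda>i. x i \<oplus> y i)"
      using v x y by (intro lin_comb_cong) (auto simp: Pi_def)
    then show "lin_comb M n v (x \<oplus>\<^bsub>free_module R n\<^esub> y) = lin_comb M n v x \<oplus>\<^bsub>M\<^esub> lin_comb M n v y"
      using lin_comb_add[OF v x y] by simp }
  fix a assume a: "a \<in> carrier R"
  have "lin_comb M n v (a \<odot>\<^bsub>free_module R n\<^esub> x) = lin_comb M n v (\<lambda>i. a \<otimes> x i)"
    using v x a by (intro lin_comb_cong) (auto simp: Pi_def)
  then show "lin_comb M n v (a \<odot>\<^bsub>free_module R n\<^esub> x) = a \<odot>\<^bsub>M\<^esub> lin_comb M n v x"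
    using lin_comb_smult[OF v x a] by simp
qed

lemma mod_hom_zero:
  assumes "module R M" "module R N" "f \<in> mod_hom R M N"
  shows "f \<zero>\<^bsub>M\<^esub> = \<zero>\<^bsub>N\<^esub>"
proof -
  interpret M: module R M by fact
  interpret N: module R N by fact
  have f0: "f \<zero>\<^bsub>M\<^esub> \<in> carrier N" using mod_homD(1)[OF assms(3)] by auto
  have "f \<zero>\<^bsub>M\<^esub> = f (\<zero>\<^bsub>R\<^esub> \<odot>\<^bsub>M\<^esub> \<zero>\<^bsub>M\<^esub>)" by simp
  also have "\<dots> = \<zero>\<^bsub>R\<^esub> \<odot>\<^bsub>N\<^esub> f \<zero>\<^bsub>M\<^esub>" by (intro mod_homD(3)[OF assms(3)]) auto
  also have "\<dots> = \<zero>\<^bsub>N\<^esub>" using f0 by simp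
  finally show ?thesis .
qed

lemma (in module) submodule_criterion:
  assumes "H \<subseteq> carrier M" "\<zero>\<^bsub>M\<^esub> \<in> H" "\<And>a b. a \<in> H \<Longrightarrow> b \<in> H \<Longrightarrow> a \<oplus>\<^bsub>M\<^esub> b \<in> H"
    "\<And>r a. r \<in> carrier R \<Longrightarrow> a \<in> H \<Longrightarrow> r \<odot>\<^bsub>M\<^esub> a \<in> H"
  shows "submodule H R M"
proof (rule submoduleI)
  fix a assume a: "a \<in> H"
  then have "\<ominus>\<^bsub>M\<^esub> a = (\<ominus> \<one>) \<odot>\<^bsub>M\<^esub> a" using assms(1) by (auto simp: smult_l_minus)
  then show "\<ominus>\<^bsub>M\<^esub> a \<in> H" using assms(4)[OF _ a] by simp
qed (use assms in auto)

lemma (in module) submodule_zero_closed: "submodule H R M \<Longrightarrow> \<zero>\<^bsub>M\<^esub> \<in> H"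
  using subgroup.one_closed[OF submodule.axioms(1)] by fastforce

lemma mod_hom_kernel_submodule:
  assumes M: "module R M" and N: "module R N" and f: "f \<in> mod_hom R M N"
  shows "submodule {x \<in> carrier M. f x = \<zero>\<^bsub>N\<^esub>} R M"
proof -
  interpret M: module R M by fact
  interpret N: module R N by fact
  show ?thesis
    by (rule M.submodule_criterion) (auto simp: mod_homD[OF f] mod_hom_zero[OF M N f])
qed

context module begin

lemma chain_Union_submodule:
  assumes C: "subset.chain {K. submodule K R M} C" "C \<noteq> {}"
  shows "submodule (\<Union>C) R M"
proof (rule submodule_criterion)
  have sub: "submodule K R M" if "K \<in> C" for K using C that unfolding pred_on.chain_def by auto
  show "\<Union>C \<subseteq> carrier M" using submoduleE(1)[OF sub] by blast
  show "\<zero>\<^bsub>M\<^esub> \<in> \<Union>C" using C(2) submodule_zero_closed[OF sub] by blast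
  { fix a b assume "a \<in> \<Union>C" "b \<in> \<Union>C"
    then obtain K L where KL: "K \<in> C" "L \<in> C" "a \<in> K" "b \<in> L" by blast
    then have "K \<subseteq> L \<or> L \<subseteq> K" using C(1) unfolding pred_on.chain_def by blast
    then show "a \<oplus>\<^bsub>M\<^esub> b \<in> \<Union>C"
      using KL submoduleE(5)[OF sub[OF KL(1)], of a b] submoduleE(5)[OF sub[OF KL(2)], of a b] by blast }
  fix r a assume "r \<in> carrier R" "a \<in> \<Union>C"
  then show "r \<odot>\<^bsub>M\<^esub> a \<in> \<Union>C" using submoduleE(4)[OF sub] by blast
qed

lemma maximal_submodule_avoiding:
  assumes B: "submodule B R M" and a: "a \<notin> B"
  obtains B' where "submodule B' R M" "B \<subseteq> B'" "a \<notin> B'"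
    "\<And>K. submodule K R M \<Longrightarrow> B' \<subseteq> K \<Longrightarrow> a \<notin> K \<Longrightarrow> K = B'"
proof -
  define F where "F = {K. submodule K R M \<and> B \<subseteq> K \<and> a \<notin> K}"
  have "\<exists>U\<in>F. \<forall>X\<in>F. U \<subseteq> X \<longrightarrow> X = U"
  proof (rule subset_Zorn)
    fix C assume C: "subset.chain F C"
    show "\<exists>U\<in>F. \<forall>X\<in>C. X \<subseteq> U"
    proof (cases "C = {}")
      case True
      then show ?thesis using B a by (auto simp: F_def)
    next
      case False
      have CF: "C \<subseteq> F" using C unfolding pred_on.chain_def by blast
      have "subset.chain {K. submodule K R M} C"
        using C unfolding pred_on.chain_def F_def by blast
      then have "submodule (\<Union>C) R M" using False by (rule chain_Union_submodule)
      moreover have "B \<subseteq> \<Union>C" using False CF by (auto simp: F_def)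
      moreover have "a \<notin> \<Union>C" using CF by (auto simp: F_def)
      ultimately have "\<Union>C \<in> F" by (simp add: F_def)
      then show ?thesis by (intro bexI[of _ "\<Union>C"]) auto
    qed
  qed
  then obtain U where U: "U \<in> F" "\<And>X. X \<in> F \<Longrightarrow> U \<subseteq> X \<Longrightarrow> X = U" by blast
  show thesis
  proof (rule that[of U])
    fix K assume "submodule K R M" "U \<subseteq> K" "a \<notin> K"
    then show "K = U" using U unfolding F_def by blast
  qed (use U(1) in \<open>auto simp: F_def\<close>)
qed

text \<open>The union of the chain is finitely generated, and finitely many generators already lie
  in one member.\<close>

lemma submodule_chain_stabilizes:
  assumes fg: "\<And>K. submodule K R M \<Longrightarrow> \<exists>n v. index_generates R M n v K"
    and K: "\<And>j::nat. submodule (K j) R M" "\<And>j. K j \<subseteq> K (Suc j)"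
  shows "\<exists>N. \<forall>j\<ge>N. K j = K N"
proof -
  have mono: "K i \<subseteq> K j" if "i \<le> j" for i j using lift_Suc_mono_le[of K, OF K(2) that] .
  have "subset.chain {K. submodule K R M} (range K)"
    unfolding subset_chain_def
  proof (intro conjI ballI)
    fix A B assume "A \<in> range K" "B \<in> range K"
    then obtain i j where "A = K i" "B = K j" by blast
    then show "A \<subseteq> B \<or> B \<subseteq> A" using mono[of i j] mono[of j i] by (cases "i \<le> j") auto
  qed (use K(1) in auto)
  then have "submodule (\<Union>(range K)) R M" by (rule chain_Union_submodule) auto
  then obtain n v where v: "index_generates R M n v (\<Union>(range K))" using fg by blast
  then have "\<forall>i<n. \<exists>j. v i \<in> K j" by (auto simp: index_generates_def Pi_def)
  then obtain g where g: "\<And>i. i < n \<Longrightarrow> v i \<in> K (g i)" by metis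
  define N where "N = Max (insert 0 (g ` {..<n}))"
  have vN: "v i \<in> K N" if "i < n" for i
    using g[OF that] mono[of "g i" N] that unfolding N_def by auto
  have "K j \<subseteq> K N" for j
  proof
    fix x assume "x \<in> K j"
    then have "x \<in> \<Union>(range K)" by blast
    then obtain c where c: "c \<in> {..<n} \<rightarrow> carrier R" "x = lin_comb M n v c"
      using v unfolding index_generates_def by blast
    show "x \<in> K N" unfolding c(2)
    proof (rule lin_comb_submodule[OF K(1)])
      fix i assume "i < n"
      then show "c i \<odot>\<^bsub>M\<^esub> v i \<in> K N" using submoduleE(4)[OF K(1)] c(1) vN by (simp add: Pi_def)
    qed
  qed
  then show ?thesis using mono by blast
qed

end

context cring begin

lemma free_module_lin_comb_coord:
  assumes v: "v \<in> {..<b} \<rightarrow> carrier (free_module R n)" and c: "c \<in> {..<b} \<rightarrow> carrier R" and i: "i < n"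
  shows "lin_comb (free_module R n) b v c i = (\<Oplus>j\<in>{..<b}. c j \<otimes> v j i)"
proof -
  have "(\<lambda>x. x i) \<in> mod_hom R (free_module R n) (self_module R)" using i by (auto simp: mod_hom_def)
  from mod_hom_lin_comb[OF module_free module_self this v c] show ?thesis by (simp add: lin_comb_self_module)
qed

lemma std_basis_carrier: "std_basis R n j \<in> carrier (free_module R n)"
  by (auto simp: std_basis_def)

lemma std_basis_expansion:
  assumes x: "x \<in> carrier (free_module R n)"
  shows "lin_comb (free_module R n) n (std_basis R n) x = x"
proof (rule PiE_lessThan_ext)
  interpret F: module R "free_module R n" by (rule module_free)
  have xc: "x \<in> {..<n} \<rightarrow> carrier R" using x by auto
  show "lin_comb (free_module R n) n (std_basis R n) x \<in> {..<n} \<rightarrow>\<^sub>E carrier R"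
    using F.lin_comb_closed[of "std_basis R n" n x] std_basis_carrier xc by auto
  show "x \<in> {..<n} \<rightarrow>\<^sub>E carrier R" using x by simp
  fix i assume i: "i < n"
  have "lin_comb (free_module R n) n (std_basis R n) x i = (\<Oplus>j\<in>{..<n}. x j \<otimes> std_basis R n j i)"
    using std_basis_carrier xc i by (intro free_module_lin_comb_coord) auto
  also have "\<dots> = (\<Oplus>j\<in>{..<n}. if i = j then x j else \<zero>)"
    using xc i by (intro finsum_cong') (auto simp: std_basis_def Pi_def)
  also have "\<dots> = x i" using xc i by (intro finsum_singleton) auto
  finally show "lin_comb (free_module R n) n (std_basis R n) x i = x i" .
qed

end

context noetherian_local_ring begin

lemma ideal_index_generates:
  assumes "ideal J R"
  shows "\<exists>n x. index_generates R (self_module R) n x J"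
proof -
  obtain A where A: "A \<subseteq> carrier R" "finite A" "J = Idl A" using finetely_gen[OF assms] by blast
  obtain x where x: "bij_betw x {..<card A} A" using ex_bij_betw_nat_finite[OF A(2)] by (auto simp: atLeast0LessThan)
  then have im: "x ` {..<card A} = A" by (simp add: bij_betw_def)
  then have xc: "x \<in> {..<card A} \<rightarrow> carrier R" using A(1) by auto
  have "J = {\<Oplus>i\<in>{..<card A}. c i \<otimes> x i | c. c \<in> {..<card A} \<rightarrow> carrier R}"
    using genideal_image_lessThan[OF xc] im A(3) by simp
  moreover have "x \<in> {..<card A} \<rightarrow> J" using im A(1,3) genideal_self by auto
  ultimately show ?thesis unfolding index_generates_def lin_comb_self_module by auto
qed

text \<open>Induction over the number \<open>m\<close> of coordinates that may be nonzero on \<open>K\<close>.\<close>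

lemma free_module_noetherian_aux:
  assumes "m \<le> n" "submodule K R (free_module R n)" "\<And>x i. x \<in> K \<Longrightarrow> m \<le> i \<Longrightarrow> i < n \<Longrightarrow> x i = \<zero>"
  shows "\<exists>b v. index_generates R (free_module R n) b v K"
  using assms
proof (induct m arbitrary: K)
  case 0
  interpret F: module R "free_module R n" by (rule module_free)
  have "x = \<zero>\<^bsub>free_module R n\<^esub>" if x: "x \<in> K" for x
  proof (rule PiE_lessThan_ext)
    show "x \<in> {..<n} \<rightarrow>\<^sub>E carrier R" using F.submoduleE(1)[OF 0(2)] x by auto
    show "\<zero>\<^bsub>free_module R n\<^esub> \<in> {..<n} \<rightarrow>\<^sub>E carrier R" using F.M.zero_closed by simp
  qed (use 0(3) x in auto)
  then have "index_generates R (free_module R n) 0 undefined K"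
    by (auto simp: index_generates_def lin_comb_def)
  then show ?case by blast
next
  case (Suc m)
  let ?F = "free_module R n"
  interpret F: module R ?F by (rule module_free)
  have m: "m < n" using Suc(2) by simp
  note K = F.submoduleE[OF Suc(3)]
  \<comment> \<open>The \<open>m\<close>-th coordinates of \<open>K\<close> form an ideal. Its
    generators, lifted to \<open>K\<close>, together with generators of the part \<open>K'\<close>
    on which this coordinate vanishes, generate \<open>K\<close>.\<close>
  define P where "P = (\<lambda>x. x m) ` K"
  have "ideal P R"
  proof (rule ideal_criterion)
    show "P \<subseteq> carrier R" using K(1) m by (auto simp: P_def)
    show "\<zero> \<in> P" using F.submodule_zero_closed[OF Suc(3)] m by (auto simp: P_def intro: rev_image_eqI)
    { fix a b assume "a \<in> P" "b \<in> P"
      then obtain x y where "x \<in> K" "y \<in> K" "a = x m" "b = y m" by (auto simp: P_def)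
      then show "a \<oplus> b \<in> P" using K(5)[of x y] m by (auto simp: P_def intro!: rev_image_eqI[of "x \<oplus>\<^bsub>?F\<^esub> y"]) }
    fix a r assume "a \<in> P" "r \<in> carrier R"
    then obtain x where "x \<in> K" "a = x m" by (auto simp: P_def)
    then show "r \<otimes> a \<in> P" using K(4)[OF \<open>r \<in> carrier R\<close>, of x] m by (auto simp: P_def intro!: rev_image_eqI[of "r \<odot>\<^bsub>?F\<^esub> x"])
  qed
  then obtain p y where y: "index_generates R (self_module R) p y P" using ideal_index_generates by blast
  then have "\<forall>l<p. \<exists>k\<in>K. y l = k m" by (auto simp: index_generates_def P_def Pi_def)
  then obtain k where k: "\<And>l. l < p \<Longrightarrow> k l \<in> K" "\<And>l. l < p \<Longrightarrow> y l = k l m" by metis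
  define K' where "K' = {x \<in> K. x m = \<zero>}"
  have K': "submodule K' R ?F"
    by (rule F.submodule_criterion)
      (use K m F.submodule_zero_closed[OF Suc(3)] in \<open>auto simp: K'_def\<close>)
  have "x i = \<zero>" if "x \<in> K'" "m \<le> i" "i < n" for x i
    using that Suc(4)[of x i] by (cases "i = m") (auto simp: K'_def)
  then obtain b v where v: "index_generates R ?F b v K'" using Suc(1)[OF _ K'] m by auto
  have vK: "v i \<in> K" if "i < b" for i using v that by (auto simp: index_generates_def K'_def Pi_def)
  have vF: "v \<in> {..<b} \<rightarrow> carrier ?F" and kF: "k \<in> {..<p} \<rightarrow> carrier ?F" using vK k(1) K(1) by blast+
  have "index_generates R ?F (b + p) (\<lambda>i. if i < b then v i else k (i - b)) K"
    unfolding index_generates_def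
  proof (intro conjI ballI)
    show "(\<lambda>i. if i < b then v i else k (i - b)) \<in> {..<b + p} \<rightarrow> K" using vK k(1) by auto
    fix x assume x: "x \<in> K"
    then have "x m \<in> P" by (auto simp: P_def)
    then obtain d where d: "d \<in> {..<p} \<rightarrow> carrier R" "x m = (\<Oplus>l\<in>{..<p}. d l \<otimes> y l)"
      using y by (auto simp: index_generates_def lin_comb_self_module)
    define z where "z = lin_comb ?F p k d"
    have zK: "z \<in> K" unfolding z_def
      by (rule F.lin_comb_submodule[OF Suc(3)]) (use d(1) k(1) K(4) in auto)
    have "z m = (\<Oplus>l\<in>{..<p}. d l \<otimes> k l m)"
      unfolding z_def using d(1) kF m by (intro free_module_lin_comb_coord) auto
    also have "\<dots> = (\<Oplus>l\<in>{..<p}. d l \<otimes> y l)"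
    proof (rule finsum_cong')
      have "y l \<in> carrier R" if "l < p" for l using kF m that k(2)[OF that] by (auto simp: Pi_def PiE_def)
      then show "(\<lambda>l. d l \<otimes> y l) \<in> {..<p} \<rightarrow> carrier R" using d(1) by auto
    qed (simp_all add: k(2))
    also have "\<dots> = x m" using d(2) by simp
    finally have zm: "z m = x m" .
    have xc: "x \<in> carrier ?F" and zc: "z \<in> carrier ?F" using x zK K(1) by blast+
    have xm: "x m \<in> carrier R" using xc m by auto
    have "\<ominus>\<^bsub>?F\<^esub> z = (\<ominus> \<one>) \<odot>\<^bsub>?F\<^esub> z" using zc by (simp add: F.smult_l_minus)
    then have mz: "(\<ominus>\<^bsub>?F\<^esub> z) m = \<ominus> x m" using zm m xm by (simp add: l_minus)
    have "x \<oplus>\<^bsub>?F\<^esub> (\<ominus>\<^bsub>?F\<^esub> z) \<in> K'"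
      using K(5)[OF x K(3)[OF zK]] m mz xm by (simp add: K'_def r_neg)
    then obtain c where c: "c \<in> {..<b} \<rightarrow> carrier R" "x \<oplus>\<^bsub>?F\<^esub> (\<ominus>\<^bsub>?F\<^esub> z) = lin_comb ?F b v c"
      using v by (auto simp: index_generates_def)
    have "x = (x \<oplus>\<^bsub>?F\<^esub> (\<ominus>\<^bsub>?F\<^esub> z)) \<oplus>\<^bsub>?F\<^esub> z"
      using xc zc F.M.a_assoc[OF xc F.M.a_inv_closed[OF zc] zc] by (simp only: F.M.l_neg F.M.r_zero)
    also have "\<dots> = lin_comb ?F (b + p) (\<lambda>i. if i < b then v i else k (i - b)) (\<lambda>i. if i < b then c i else d (i - b))"
      unfolding F.lin_comb_append[OF vF kF c(1) d(1)] z_def[symmetric] c(2)[symmetric] ..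
    finally show "\<exists>c\<in>{..<b + p} \<rightarrow> carrier R. x = lin_comb ?F (b + p) (\<lambda>i. if i < b then v i else k (i - b)) c"
      using c(1) d(1) by (intro bexI[of _ "\<lambda>i. if i < b then c i else d (i - b)"]) (auto simp: Pi_def)
  qed
  then show ?case by blast
qed

lemma free_module_noetherian:
  "submodule K R (free_module R n) \<Longrightarrow> \<exists>b v. index_generates R (free_module R n) b v K"
  by (rule free_module_noetherian_aux[of n n]) auto

text \<open>If no power of \<mm> lay in \<open>A\<close>, take \<open>L\<close> above
  \<open>A\<close> maximal with this property. An associated prime (L : a) contains a power of each
  element of \<mm>, hence \<mm> itself. By maximality some \<mm>^t lies in L + (a), so \<mm>^(t+1)
  lies in \<open>L\<close>.\<close>

lemma radical_contains_power:
  assumes A: "ideal A R" and rad: "\<And>y. y \<in> \<mm> \<Longrightarrow> \<exists>k::nat. y [^] k \<in> A"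
  shows "\<exists>t. ideal_power R \<mm> t \<subseteq> A"
proof (rule ccontr)
  assume bad: "\<nexists>t. ideal_power R \<mm> t \<subseteq> A"
  define F where "F = {L. ideal L R \<and> A \<subseteq> L \<and> (\<nexists>t. ideal_power R \<mm> t \<subseteq> L)}"
  have "F \<noteq> {}" using A bad by (auto simp: F_def)
  moreover have "ideal I R" if "I \<in> F" for I using that by (simp add: F_def)
  ultimately obtain L where L: "L \<in> F" "\<And>I. I \<in> F \<Longrightarrow> L \<subseteq> I \<Longrightarrow> I = L"
    by (rule maximal_ideal_in_family) blast+
  interpret L: ideal L R using L(1) by (simp add: F_def)
  have AL: "A \<subseteq> L" using L(1) by (simp add: F_def)
  have noL: "\<not> ideal_power R \<mm> t \<subseteq> L" for t using L(1) by (auto simp: F_def)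
  have "L \<noteq> carrier R" using noL[of 0] by auto
  then obtain a where a: "a \<in> carrier R" "a \<notin> L" "primeideal (ideal_colon R L {a}) R"
    using exists_associated_prime[OF L.is_ideal] by blast
  define Q where "Q = ideal_colon R L {a}"
  have Q: "s \<in> Q \<longleftrightarrow> s \<in> carrier R \<and> s \<otimes> a \<in> L" for s by (simp add: Q_def ideal_colon_def)
  interpret P: primeideal Q R unfolding Q_def by (rule a(3))
  have ma: "y \<otimes> a \<in> L" if y: "y \<in> \<mm>" for y
  proof -
    have yc: "y \<in> carrier R" using y ideal.Icarr[OF maximal_ideal] by blast
    obtain k where "y [^] (k::nat) \<in> A" using rad[OF y] by (elim exE)
    then have "y [^] k \<otimes> a \<in> L" by (intro L.I_r_closed[OF _ a(1)] subsetD[OF AL])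
    then have "y [^] k \<in> Q" unfolding Q using yc by blast
    then have "y \<in> Q"
    proof (induct k)
      case 0
      then show ?case using P.one_imp_carrier P.I_notcarr by simp
    next
      case (Suc k)
      then have "y [^] k \<in> Q \<or> y \<in> Q"
        using P.I_prime[of "y [^] k" y] yc by simp
      then show ?case using Suc(1) by blast
    qed
    then show ?thesis by (simp add: Q)
  qed
  note La = ideal_add_cgenideal[OF L.is_ideal a(1)]
  have "L <+>\<^bsub>R\<^esub> PIdl a \<notin> F" using L(2)[OF _ La(2)] La(3) a(2) by blast
  then obtain t where t: "ideal_power R \<mm> t \<subseteq> L <+>\<^bsub>R\<^esub> PIdl a" using La AL by (auto simp: F_def)
  have "v \<in> L" if "v \<in> ideal_power R \<mm> t \<cdot>\<^bsub>R\<^esub> \<mm>" for v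
    using that
  proof (induct rule: ideal_prod.induct)
    case (prod u y)
    then obtain l r where u: "l \<in> L" "r \<in> carrier R" "u = l \<oplus> r \<otimes> a"
      using t unfolding subset_iff mem_ideal_add_cgenideal by blast
    have c: "l \<in> carrier R" "y \<in> carrier R" using u L.Icarr prod ideal.Icarr[OF maximal_ideal] by auto
    have "u \<otimes> y = y \<otimes> l \<oplus> r \<otimes> (y \<otimes> a)" unfolding u(3) using c u(2) a(1) by algebra
    then show ?case using L.I_l_closed[OF u(1) c(2)] L.I_l_closed[OF ma[OF prod(2)] u(2)] by simp
  qed auto
  then show False using noL[of "Suc t"] by auto
qed

text \<open>The instance of Krull's intersection theorem needed here: a maximal submodule avoiding the
  socle element \<open>a\<close> has finite colength.\<close>

lemma socle_element_avoided:
  assumes B: "submodule B R (free_module R n)" and a: "a \<in> carrier (free_module R n)" "a \<notin> B"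
    and soc: "\<And>p. p \<in> \<mm> \<Longrightarrow> p \<odot>\<^bsub>free_module R n\<^esub> a = \<zero>\<^bsub>free_module R n\<^esub>"
  shows "\<exists>B' t. submodule B' R (free_module R n) \<and> B \<subseteq> B' \<and> a \<notin> B' \<and>
     (\<forall>x\<in>carrier (free_module R n). (\<forall>i<n. x i \<in> ideal_power R \<mm> t) \<longrightarrow> x \<in> B')"
proof -
  let ?F = "free_module R n"
  interpret F: module R ?F by (rule module_free)
  obtain B' where B': "submodule B' R ?F" "B \<subseteq> B'" "a \<notin> B'"
    and max: "\<And>K. submodule K R ?F \<Longrightarrow> B' \<subseteq> K \<Longrightarrow> a \<notin> K \<Longrightarrow> K = B'"
    using F.maximal_submodule_avoiding[OF B a(2)] by metis
  note B'E = F.submoduleE[OF B'(1)]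
  \<comment> \<open>The annihilator of the quotient by \<open>B'\<close>; a power of \<mm> inside it
    yields the required \<open>t\<close>. It suffices to find a power of each single element of
    \<mm> in it.\<close>
  define A where "A = {r \<in> carrier R. \<forall>x\<in>carrier ?F. r \<odot>\<^bsub>?F\<^esub> x \<in> B'}"
  have A: "ideal A R"
  proof (rule ideal_criterion)
    show "\<zero> \<in> A" using F.submodule_zero_closed[OF B'(1)] by (auto simp: A_def simp del: free_module_simps)
  qed (auto simp: A_def F.smult_l_distr F.smult_assoc1 B'E(4,5) simp del: free_module_simps)
  have "\<exists>k::nat. y [^] k \<in> A" if y: "y \<in> \<mm>" for y
  proof -
    have yc: "y \<in> carrier R" using y ideal.Icarr[OF maximal_ideal] by blast
    have yk: "y [^] k \<in> carrier R" for k :: nat using yc by simp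
    define K where "K k = {x \<in> carrier ?F. (y [^] (k::nat)) \<odot>\<^bsub>?F\<^esub> x \<in> B'}" for k
    have sub: "submodule (K k) R ?F" for k
    proof (rule F.submodule_criterion)
      show "\<zero>\<^bsub>?F\<^esub> \<in> K k" using F.submodule_zero_closed[OF B'(1)] yk by (simp add: K_def del: free_module_simps)
      fix r x assume r: "r \<in> carrier R" and x: "x \<in> K k"
      then have "(y [^] k) \<odot>\<^bsub>?F\<^esub> (r \<odot>\<^bsub>?F\<^esub> x) = r \<odot>\<^bsub>?F\<^esub> ((y [^] k) \<odot>\<^bsub>?F\<^esub> x)"
        using yk by (simp add: K_def F.smult_assoc1[symmetric] m_comm del: free_module_simps)
      then show "r \<odot>\<^bsub>?F\<^esub> x \<in> K k" using r x B'E(4) by (simp add: K_def del: free_module_simps)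
    qed (use yk in \<open>auto simp: K_def F.smult_r_distr B'E(5) simp del: free_module_simps\<close>)
    have smS: "(y [^] Suc k) \<odot>\<^bsub>?F\<^esub> x = y \<odot>\<^bsub>?F\<^esub> ((y [^] k) \<odot>\<^bsub>?F\<^esub> x)" if "x \<in> carrier ?F" for k x
      using that yk yc by (simp add: F.smult_assoc1[symmetric] m_comm del: free_module_simps)
    have "K k \<subseteq> K (Suc k)" for k
      using smS B'E(4)[OF yc] unfolding K_def by (auto simp del: free_module_simps nat_pow_Suc)
    then obtain N where N: "\<forall>j\<ge>N. K j = K N"
      using F.submodule_chain_stabilizes[OF free_module_noetherian, of K] sub by blast
    \<comment> \<open>An argument in the style of Fitting's lemma. If a = b + y^N x with b in
      \<open>B'\<close>, then y a = 0 puts y^(N+1) x into \<open>B'\<close>; as the submodules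
      \<open>K k\<close> are constant from \<open>N\<close> on, y^N x lies in \<open>B'\<close>, and
      so would \<open>a\<close>. Thus \<open>B2\<close> still avoids \<open>a\<close>, and
      maximality gives \<open>B2 = B'\<close>.\<close>
    define B2 where "B2 = {b \<oplus>\<^bsub>?F\<^esub> (y [^] N) \<odot>\<^bsub>?F\<^esub> x | b x. b \<in> B' \<and> x \<in> carrier ?F}"
    have B2I: "b \<oplus>\<^bsub>?F\<^esub> (y [^] N) \<odot>\<^bsub>?F\<^esub> x \<in> B2" if "b \<in> B'" "x \<in> carrier ?F" for b x
      using that unfolding B2_def by blast
    have B'c: "b \<in> carrier ?F" if "b \<in> B'" for b using that B'E(1) by blast
    have B2: "submodule B2 R ?F"
    proof (rule F.submodule_criterion)
      show "B2 \<subseteq> carrier ?F" using B'c yk unfolding B2_def by (auto simp del: free_module_simps)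
      show "\<zero>\<^bsub>?F\<^esub> \<in> B2"
        using B2I[OF F.submodule_zero_closed[OF B'(1)] F.M.zero_closed] yk by (simp del: free_module_simps)
      { fix u w assume "u \<in> B2" "w \<in> B2"
        then obtain b x b' x' where h: "b \<in> B'" "x \<in> carrier ?F" "u = b \<oplus>\<^bsub>?F\<^esub> (y [^] N) \<odot>\<^bsub>?F\<^esub> x"
          "b' \<in> B'" "x' \<in> carrier ?F" "w = b' \<oplus>\<^bsub>?F\<^esub> (y [^] N) \<odot>\<^bsub>?F\<^esub> x'" unfolding B2_def by blast
        have "u \<oplus>\<^bsub>?F\<^esub> w = (b \<oplus>\<^bsub>?F\<^esub> b') \<oplus>\<^bsub>?F\<^esub> (y [^] N) \<odot>\<^bsub>?F\<^esub> (x \<oplus>\<^bsub>?F\<^esub> x')"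
          unfolding h(3,6) using h(2,5) B'c[OF h(1)] B'c[OF h(4)] yk
          by (simp add: F.smult_r_distr F.M.a_ac del: free_module_simps)
        then show "u \<oplus>\<^bsub>?F\<^esub> w \<in> B2" using B2I[OF B'E(5)[OF h(1,4)] F.M.a_closed[OF h(2,5)]] by simp }
      fix r u assume r: "r \<in> carrier R" and "u \<in> B2"
      then obtain b x where h: "b \<in> B'" "x \<in> carrier ?F" "u = b \<oplus>\<^bsub>?F\<^esub> (y [^] N) \<odot>\<^bsub>?F\<^esub> x" unfolding B2_def by blast
      have "r \<odot>\<^bsub>?F\<^esub> u = r \<odot>\<^bsub>?F\<^esub> b \<oplus>\<^bsub>?F\<^esub> (y [^] N) \<odot>\<^bsub>?F\<^esub> (r \<odot>\<^bsub>?F\<^esub> x)"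
        unfolding h(3) using r h(2) B'c[OF h(1)] yk
        by (simp add: F.smult_r_distr F.smult_assoc1[symmetric] m_comm del: free_module_simps)
      then show "r \<odot>\<^bsub>?F\<^esub> u \<in> B2" using B2I[OF B'E(4)[OF r h(1)] F.smult_closed[OF r h(2)]] by simp
    qed
    have sub2: "B' \<subseteq> B2"
    proof
      fix b assume b: "b \<in> B'"
      have "b \<oplus>\<^bsub>?F\<^esub> (y [^] N) \<odot>\<^bsub>?F\<^esub> \<zero>\<^bsub>?F\<^esub> = b" using B'c[OF b] yk by (simp del: free_module_simps)
      then show "b \<in> B2" using B2I[OF b F.M.zero_closed] by simp
    qed
    have "a \<notin> B2"
    proof
      assume "a \<in> B2"
      then obtain b x where h: "b \<in> B'" "x \<in> carrier ?F" "a = b \<oplus>\<^bsub>?F\<^esub> (y [^] N) \<odot>\<^bsub>?F\<^esub> x" unfolding B2_def by blast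
      have bc: "b \<in> carrier ?F" using B'c[OF h(1)] .
      have yb: "y \<odot>\<^bsub>?F\<^esub> b \<in> B'" using B'E(4)[OF yc h(1)] .
      have ybc: "y \<odot>\<^bsub>?F\<^esub> b \<in> carrier ?F" using B'c[OF yb] .
      have yxc: "(y [^] Suc N) \<odot>\<^bsub>?F\<^esub> x \<in> carrier ?F" using F.smult_closed[OF yk h(2)] .
      have "y \<odot>\<^bsub>?F\<^esub> a = y \<odot>\<^bsub>?F\<^esub> b \<oplus>\<^bsub>?F\<^esub> (y [^] Suc N) \<odot>\<^bsub>?F\<^esub> x"
        unfolding h(3) smS[OF h(2)] using F.smult_r_distr[OF yc bc F.smult_closed[OF yk h(2)]] .
      then have "y \<odot>\<^bsub>?F\<^esub> b \<oplus>\<^bsub>?F\<^esub> (y [^] Suc N) \<odot>\<^bsub>?F\<^esub> x = \<zero>\<^bsub>?F\<^esub>" using soc[OF y] by simp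
      then have "\<ominus>\<^bsub>?F\<^esub> ((y [^] Suc N) \<odot>\<^bsub>?F\<^esub> x) = y \<odot>\<^bsub>?F\<^esub> b"
        by (rule F.M.minus_equality[OF _ yxc ybc])
      then have "(y [^] Suc N) \<odot>\<^bsub>?F\<^esub> x = \<ominus>\<^bsub>?F\<^esub> (y \<odot>\<^bsub>?F\<^esub> b)" using F.M.minus_minus[OF yxc] by simp
      then have "x \<in> K (Suc N)" using B'E(3)[OF yb] h(2) unfolding K_def by simp
      moreover have "K (Suc N) = K N" using N le_SucI[OF order_refl] by blast
      ultimately have "x \<in> K N" by simp
      then have "a \<in> B'" unfolding h(3) K_def using B'E(5)[OF h(1)] by blast
      then show False using B'(3) by simp
    qed
    then have eq: "B2 = B'" using max[OF B2 sub2] by simp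
    have "(y [^] N) \<odot>\<^bsub>?F\<^esub> x \<in> B'" if x: "x \<in> carrier ?F" for x
    proof -
      have "\<zero>\<^bsub>?F\<^esub> \<oplus>\<^bsub>?F\<^esub> (y [^] N) \<odot>\<^bsub>?F\<^esub> x = (y [^] N) \<odot>\<^bsub>?F\<^esub> x"
        using F.M.l_zero[OF F.smult_closed[OF yk x]] .
      then show ?thesis using B2I[OF F.submodule_zero_closed[OF B'(1)] x] eq by simp
    qed
    then have "y [^] N \<in> A" unfolding A_def using yk by blast
    then show ?thesis by blast
  qed
  then obtain t where t: "ideal_power R \<mm> t \<subseteq> A" using radical_contains_power[OF A] by blast
  have "x \<in> B'" if x: "x \<in> carrier ?F" "\<forall>i<n. x i \<in> ideal_power R \<mm> t" for x
  proof -
    have "lin_comb ?F n (std_basis R n) x \<in> B'"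
    proof (rule F.lin_comb_submodule[OF B'(1)])
      fix i assume "i < n"
      then have "x i \<in> A" using x(2) t by blast
      then show "x i \<odot>\<^bsub>?F\<^esub> std_basis R n i \<in> B'" using std_basis_carrier unfolding A_def by blast
    qed
    then show ?thesis using std_basis_expansion[OF x(1)] by simp
  qed
  then show ?thesis using B' by blast
qed

text \<open>One step of a minimal resolution. Minimality is stated for the kernel, because that
  kernel is the image of the next differential.\<close>

lemma minimal_cover:
  assumes K: "submodule K R (free_module R n)"
  shows "\<exists>b d. d \<in> mod_hom R (free_module R b) (free_module R n) \<and> d ` carrier (free_module R b) = K \<and>
    (\<forall>c\<in>carrier (free_module R b). d c = \<zero>\<^bsub>free_module R n\<^esub> \<longrightarrow> (\<forall>i<b. c i \<in> \<mm>))"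
proof -
  let ?F = "free_module R n"
  interpret F: module R ?F by (rule module_free)
  obtain b v where v: "minimally_generates R \<mm> ?F b v K"
    using exists_minimal_generators[OF module_free F.submoduleE(1)[OF K] free_module_noetherian[OF K]] by blast
  then have vK: "v \<in> {..<b} \<rightarrow> K" and gen: "\<forall>x\<in>K. \<exists>c\<in>{..<b} \<rightarrow> carrier R. x = lin_comb ?F b v c"
    and ker: "\<forall>c\<in>{..<b} \<rightarrow> carrier R. lin_comb ?F b v c = \<zero>\<^bsub>?F\<^esub> \<longrightarrow> (\<forall>i<b. c i \<in> \<mm>)"
    by (auto simp: minimally_generates_def index_generates_def)
  have vF: "v \<in> {..<b} \<rightarrow> carrier ?F" using vK F.submoduleE(1)[OF K] by blast
  have "lin_comb ?F b v ` carrier (free_module R b) = K"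
  proof
    show "lin_comb ?F b v ` carrier (free_module R b) \<subseteq> K"
    proof clarify
      fix c assume "c \<in> carrier (free_module R b)"
      then have "c i \<odot>\<^bsub>?F\<^esub> v i \<in> K" if "i < b" for i
        using vK that F.submoduleE(4)[OF K] by auto
      then show "lin_comb ?F b v c \<in> K" by (rule F.lin_comb_submodule[OF K])
    qed
    show "K \<subseteq> lin_comb ?F b v ` carrier (free_module R b)"
    proof
      fix x assume "x \<in> K"
      then obtain c where c: "c \<in> {..<b} \<rightarrow> carrier R" "x = lin_comb ?F b v c" using gen by blast
      have "lin_comb ?F b v c = lin_comb ?F b v (restrict c {..<b})"
        using vF c(1) by (intro F.lin_comb_cong) auto
      then show "x \<in> lin_comb ?F b v ` carrier (free_module R b)"
        using c by (intro image_eqI[of _ _ "restrict c {..<b}"]) auto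
    qed
  qed
  moreover have "lin_comb ?F b v \<in> mod_hom R (free_module R b) ?F" using F.lin_comb_mod_hom[OF vF] .
  moreover have "\<forall>c\<in>carrier (free_module R b). lin_comb ?F b v c = \<zero>\<^bsub>?F\<^esub> \<longrightarrow> (\<forall>i<b. c i \<in> \<mm>)"
    using ker by auto
  ultimately show ?thesis by blast
qed

end

section \<open>The cokernel of a minimal system of generators\<close>

context module begin

lemma lin_comb_add_vectors:
  assumes "v \<in> {..<n} \<rightarrow> carrier M" "w \<in> {..<n} \<rightarrow> carrier M" "c \<in> {..<n} \<rightarrow> carrier R"
  shows "lin_comb M n (\<lambda>i. v i \<oplus>\<^bsub>M\<^esub> w i) c = lin_comb M n v c \<oplus>\<^bsub>M\<^esub> lin_comb M n w c"
proof -
  have "lin_comb M n (\<lambda>i. v i \<oplus>\<^bsub>M\<^esub> w i) c = (\<Oplus>\<^bsub>M\<^esub>i\<in>{..<n}. c i \<odot>\<^bsub>M\<^esub> v i \<oplus>\<^bsub>M\<^esub> c i \<odot>\<^bsub>M\<^esub> w i)"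
    unfolding lin_comb_def using assms by (intro M.finsum_cong') (auto simp: smult_r_distr Pi_def)
  also have "\<dots> = lin_comb M n v c \<oplus>\<^bsub>M\<^esub> lin_comb M n w c"
    unfolding lin_comb_def using assms by (intro M.finsum_addf) auto
  finally show ?thesis .
qed

lemma lin_comb_multiples:
  assumes x: "x \<in> carrier M" and u: "u \<in> {..<n} \<rightarrow> carrier R" and c: "c \<in> {..<n} \<rightarrow> carrier R"
  shows "lin_comb M n (\<lambda>i. u i \<odot>\<^bsub>M\<^esub> x) c = (\<Oplus>i\<in>{..<n}. c i \<otimes> u i) \<odot>\<^bsub>M\<^esub> x"
proof -
  have "(\<Oplus>i\<in>{..<n}. c i \<otimes> u i) \<odot>\<^bsub>M\<^esub> x = (\<Oplus>\<^bsub>M\<^esub>i\<in>{..<n}. (c i \<otimes> u i) \<odot>\<^bsub>M\<^esub> x)"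
    using x u c by (intro finsum_additive[OF R.abelian_group_axioms M.abelian_group_axioms])
      (auto simp: smult_l_distr Pi_def)
  also have "\<dots> = lin_comb M n (\<lambda>i. u i \<odot>\<^bsub>M\<^esub> x) c"
    unfolding lin_comb_def using x u c by (intro M.finsum_cong') (auto simp: smult_assoc1 Pi_def)
  finally show ?thesis ..
qed

end

context noetherian_local_ring begin

text \<open>\<open>mod_fin_gen\<close> asks for a set of generators, so the family should be
  injective. A repetition would be a relation with coefficient 1, which is not in \<mm>.\<close>

lemma minimally_generates_imp_fin_gen:
  assumes M: "module R M" and v: "minimally_generates R \<mm> M n v (carrier M)"
  shows "mod_fin_gen R M"
proof -
  interpret M: module R M by fact
  have vc: "v \<in> {..<n} \<rightarrow> carrier M"
    and gen: "\<And>x. x \<in> carrier M \<Longrightarrow> \<exists>c\<in>{..<n} \<rightarrow> carrier R. x = lin_comb M n v c"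
    and ker: "\<And>c i. c \<in> {..<n} \<rightarrow> carrier R \<Longrightarrow> lin_comb M n v c = \<zero>\<^bsub>M\<^esub> \<Longrightarrow> i < n \<Longrightarrow> c i \<in> \<mm>"
    using v by (auto simp: minimally_generates_def index_generates_def)
  have inj: "inj_on v {..<n}"
  proof (rule inj_onI, rule ccontr)
    fix i j assume ij: "i \<in> {..<n}" "j \<in> {..<n}" "v i = v j" "i \<noteq> j"
    let ?c = "\<lambda>l. (if l = i then \<one> else \<zero>) \<ominus> (if l = j then \<one> else \<zero>)"
    have vi: "v i \<in> carrier M" using vc ij by auto
    have "lin_comb M n v ?c = \<one> \<odot>\<^bsub>M\<^esub> v i \<ominus>\<^bsub>M\<^esub> \<one> \<odot>\<^bsub>M\<^esub> v j"
      using ij vc by (subst M.lin_comb_minus) (auto simp: M.lin_comb_delta)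
    then have "lin_comb M n v ?c = \<zero>\<^bsub>M\<^esub>" using ij(3) vi by (simp add: M.M.minus_eq M.M.r_neg)
    then have "?c i \<in> \<mm>" using ij(1) by (intro ker) auto
    then show False using ij(4) one_notin_maximal by (simp add: minus_eq)
  qed
  show ?thesis
    unfolding mod_fin_gen_def
  proof (intro exI[of _ "v ` {..<n}"] conjI ballI)
    fix x assume "x \<in> carrier M"
    then obtain c where c: "c \<in> {..<n} \<rightarrow> carrier R" "x = lin_comb M n v c" using gen by blast
    define d where "d b = c (the_inv_into {..<n} v b)" for b
    have dv: "d (v j) = c j" if "j < n" for j
      using that inj by (auto simp: d_def the_inv_into_f_f)
    then have d: "d \<in> v ` {..<n} \<rightarrow> carrier R" using c(1) by (auto simp: Pi_def)
    have "(\<Oplus>\<^bsub>M\<^esub>b\<in>v ` {..<n}. d b \<odot>\<^bsub>M\<^esub> b) = lin_comb M n v (\<lambda>i. d (v i))"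
      by (rule M.finsum_reindex_lin_comb[OF vc inj d])
    also have "\<dots> = x" unfolding c(2) using vc d dv c by (intro M.lin_comb_cong) auto
    finally show "\<exists>c\<in>v ` {..<n} \<rightarrow> carrier R. x = (\<Oplus>\<^bsub>M\<^esub>a\<in>v ` {..<n}. c a \<odot>\<^bsub>M\<^esub> a)" using d by auto
  qed (use vc in auto)
qed

text \<open>If \<open>Z\<close> is the direct sum of A and B with A isomorphic to the residue field,
  the generator of A is killed by \<mm>, while \<mm>Z = \<mm>B lies in B. So the complement B
  witnesses that this socle element is outside \<mm>Z.\<close>

lemma residue_summand_socle:
  assumes Z: "module R Z" and summand: "direct_summand R (residue_module R \<mm>) Z"
  shows "\<exists>B a. submodule B R Z \<and> a \<in> carrier Z \<and> a \<notin> B \<and> (\<forall>p\<in>\<mm>. p \<odot>\<^bsub>Z\<^esub> a = \<zero>\<^bsub>Z\<^esub>) \<and>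
     (\<forall>p\<in>\<mm>. \<forall>z\<in>carrier Z. p \<odot>\<^bsub>Z\<^esub> z \<in> B)"
proof -
  interpret Z: module R Z by fact
  interpret S: module R "self_module R" by (rule module_self)
  let ?k = "residue_module R \<mm>"
  have sm: "submodule \<mm> R (self_module R)" by (rule ideal_submodule[OF maximal_ideal])
  have k: "module R ?k" unfolding residue_module_def by (rule S.quot_module_is_module[OF sm])
  interpret k: module R ?k by (rule k)
  obtain A B f where AB: "submodule A R Z" "submodule B R Z" "A \<inter> B = {\<zero>\<^bsub>Z\<^esub>}" "A <+>\<^bsub>Z\<^esub> B = carrier Z"
    and f: "f \<in> mod_hom R ?k (Z\<lparr>carrier := A\<rparr>)" "bij_betw f (carrier ?k) A"
    using summand unfolding direct_summand_def mod_iso_def by auto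
  note A = Z.submoduleE[OF AB(1)] and B = Z.submoduleE[OF AB(2)]
  have ZA: "module R (Z\<lparr>carrier := A\<rparr>)" by (rule submodule.submodule_is_module[OF AB(1) Z])
  have mc: "p \<in> carrier R" if "p \<in> \<mm>" for p using that ideal.Icarr[OF maximal_ideal] by blast
  have f0: "f \<zero>\<^bsub>?k\<^esub> = \<zero>\<^bsub>Z\<^esub>" using mod_hom_zero[OF k ZA f(1)] by simp
  have kc: "carrier ?k = (\<lambda>x. \<mm> +>\<^bsub>self_module R\<^esub> x) ` carrier R"
    using S.quot_module_carrier[OF sm] by (simp add: residue_module_def)
  have kz: "\<zero>\<^bsub>?k\<^esub> = \<mm>" by (simp add: residue_module_def quot_module_def)
  have kill: "p \<odot>\<^bsub>?k\<^esub> X = \<zero>\<^bsub>?k\<^esub>" if p: "p \<in> \<mm>" and X: "X \<in> carrier ?k" for p X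
  proof -
    obtain x where x: "x \<in> carrier R" "X = \<mm> +>\<^bsub>self_module R\<^esub> x" using X kc by auto
    have "p \<odot>\<^bsub>?k\<^esub> X = \<mm> +>\<^bsub>self_module R\<^esub> (p \<otimes> x)"
      unfolding x(2) residue_module_def using S.quot_module_smult[OF sm mc[OF p], of x] x(1) by simp
    also have "\<dots> = \<mm>"
      using S.coset_eq_zero_iff[OF sm, of "p \<otimes> x"] x(1) mc[OF p] ideal.I_r_closed[OF maximal_ideal p x(1)] by simp
    finally show ?thesis by (simp add: kz)
  qed
  have killA: "p \<odot>\<^bsub>Z\<^esub> \<alpha> = \<zero>\<^bsub>Z\<^esub>" if p: "p \<in> \<mm>" and \<alpha>: "\<alpha> \<in> A" for p \<alpha>
  proof -
    obtain X where X: "X \<in> carrier ?k" "\<alpha> = f X" using \<alpha> f(2) by (auto simp: bij_betw_def)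
    have "p \<odot>\<^bsub>Z\<^esub> \<alpha> = f (p \<odot>\<^bsub>?k\<^esub> X)" using mod_homD(3)[OF f(1) mc[OF p] X(1)] X(2) by simp
    then show ?thesis using kill[OF p X(1)] f0 by simp
  qed
  define e where "e = \<mm> +>\<^bsub>self_module R\<^esub> \<one>"
  have e: "e \<in> carrier ?k" by (auto simp: e_def kc)
  have "e \<noteq> \<zero>\<^bsub>?k\<^esub>"
    unfolding e_def kz using S.coset_eq_zero_iff[OF sm, of \<one>] one_notin_maximal by simp
  then have ne: "f e \<noteq> \<zero>\<^bsub>Z\<^esub>"
    using f(2) f0 e k.M.zero_closed unfolding bij_betw_def inj_on_def by metis
  have fA: "f e \<in> A" using f(2) e by (auto simp: bij_betw_def)
  have "f e \<notin> B" using fA ne AB(3) by blast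
  moreover have "p \<odot>\<^bsub>Z\<^esub> z \<in> B" if p: "p \<in> \<mm>" and z: "z \<in> carrier Z" for p z
  proof -
    obtain \<alpha> \<beta> where h: "\<alpha> \<in> A" "\<beta> \<in> B" "z = \<alpha> \<oplus>\<^bsub>Z\<^esub> \<beta>" using z unfolding AB(4)[symmetric] by (auto simp: set_add_def')
    have "p \<odot>\<^bsub>Z\<^esub> z = p \<odot>\<^bsub>Z\<^esub> \<alpha> \<oplus>\<^bsub>Z\<^esub> p \<odot>\<^bsub>Z\<^esub> \<beta>"
      unfolding h(3) using h A(1) B(1) mc[OF p] by (intro Z.smult_r_distr) auto
    also have "\<dots> = p \<odot>\<^bsub>Z\<^esub> \<beta>" using killA[OF p h(1)] B(1) h(2) mc[OF p] by auto
    finally show ?thesis using B(4)[OF mc[OF p] h(2)] by simp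
  qed
  ultimately show ?thesis using AB(2) fA A(1) killA by blast
qed

end

locale generator_cokernel = noetherian_local_ring +
  fixes e :: nat and y :: "nat \<Rightarrow> 'a"
  assumes not_field: "\<not> field R"
    and y: "minimally_generates R \<mm> (self_module R) e y \<mm>"
begin

abbreviation "F \<equiv> free_module R"

definition yv :: "nat \<Rightarrow> 'a" where "yv = restrict y {..<e}"

definition N :: "(nat \<Rightarrow> 'a) set" where "N = (\<lambda>c. c \<odot>\<^bsub>F e\<^esub> yv) ` carrier R"

text \<open>The surjection of R^e onto \<mm>; its kernel is the second syzygy of the residue
  field.\<close>

definition sy :: "(nat \<Rightarrow> 'a) \<Rightarrow> 'a" where "sy = lin_comb (self_module R) e y"

lemma y_max: "i < e \<Longrightarrow> y i \<in> \<mm>"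
  and y_gen: "u \<in> \<mm> \<Longrightarrow> \<exists>c\<in>{..<e} \<rightarrow> carrier R. u = sy c"
  and y_min: "c \<in> {..<e} \<rightarrow> carrier R \<Longrightarrow> sy c = \<zero> \<Longrightarrow> i < e \<Longrightarrow> c i \<in> \<mm>"
  using y by (auto simp: minimally_generates_def index_generates_def sy_def)

lemma max_carrier: "p \<in> \<mm> \<Longrightarrow> p \<in> carrier R"
  using ideal.Icarr[OF maximal_ideal] by blast

lemma y_carrier: "i < e \<Longrightarrow> y i \<in> carrier R"
  using y_max max_carrier by blast

lemma yv_carrier: "yv \<in> carrier (F e)"
  using y_carrier by (auto simp: yv_def)

lemma sy_hom: "sy \<in> mod_hom R (F e) (self_module R)"
  unfolding sy_def using y_carrier by (intro module.lin_comb_mod_hom[OF module_self]) auto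

lemma sy_eq: "sy c = (\<Oplus>i\<in>{..<e}. c i \<otimes> y i)"
  by (simp add: sy_def lin_comb_self_module)

lemma sy_max:
  assumes "c \<in> {..<e} \<rightarrow> carrier R" shows "sy c \<in> \<mm>"
  unfolding sy_eq using assms y_max
  by (intro ideal_finsum_closed[OF maximal_ideal] ideal.I_l_closed[OF maximal_ideal]) auto

text \<open>Otherwise \<mm> would be zero and \<open>R\<close> a field.\<close>

lemma y_nonzero: "\<exists>i<e. y i \<noteq> \<zero>"
proof (rule ccontr)
  assume none: "\<not> (\<exists>i<e. y i \<noteq> \<zero>)"
  have "u = \<zero>" if u: "u \<in> \<mm>" for u
  proof -
    obtain c where c: "c \<in> {..<e} \<rightarrow> carrier R" "u = sy c" using y_gen[OF u] by blast
    have "sy c = (\<Oplus>i\<in>{..<e}. \<zero>)" unfolding sy_eq using none c(1) by (intro finsum_cong') (auto simp: Pi_def)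
    then show ?thesis using c(2) by simp
  qed
  moreover have "\<zero> \<in> \<mm>" using additive_subgroup.zero_closed[OF ideal.axioms(1)[OF maximal_ideal]] .
  ultimately have "\<mm> = {\<zero>}" by blast
  then have "maximalideal {\<zero>} R" using maximal by simp
  then show False using zeromaximalideal_fieldI not_field by blast
qed

text \<open>A unit cannot kill the nonzero vector \<open>y\<close>. This places the socle of
  \<open>R\<close> inside \<mm>.\<close>

lemma annihilator_in_max:
  assumes c: "c \<in> carrier R" and ann: "\<And>i. i < e \<Longrightarrow> c \<otimes> y i = \<zero>"
  shows "c \<in> \<mm>"
proof (rule ccontr)
  assume "c \<notin> \<mm>"
  then obtain u where u: "u \<in> carrier R" "u \<otimes> c = \<one>" using unit_if_notin_maximal[OF c] by blast
  have "y i = \<zero>" if "i < e" for i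
  proof -
    have "y i = u \<otimes> (c \<otimes> y i)" using u c y_carrier[OF that] by (simp flip: m_assoc)
    then show ?thesis using ann[OF that] u by simp
  qed
  then show False using y_nonzero by blast
qed

lemma annihilates_max:
  assumes c: "c \<in> carrier R" and ann: "\<And>i. i < e \<Longrightarrow> c \<otimes> y i = \<zero>" and u: "u \<in> \<mm>"
  shows "c \<otimes> u = \<zero>"
proof -
  obtain d where d: "d \<in> {..<e} \<rightarrow> carrier R" "u = sy d" using y_gen[OF u] by blast
  have "c \<otimes> u = (\<Oplus>i\<in>{..<e}. c \<otimes> (d i \<otimes> y i))"
    unfolding d(2) sy_eq using c d(1) y_carrier by (intro finsum_rdistr) auto
  also have "\<dots> = (\<Oplus>i\<in>{..<e}. \<zero>)"
  proof (rule finsum_cong')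
    fix i assume i: "i \<in> {..<e}"
    then have "c \<otimes> (d i \<otimes> y i) = d i \<otimes> (c \<otimes> y i)"
      using c d(1) y_carrier[of i] by (intro m_lcomm) auto
    then show "c \<otimes> (d i \<otimes> y i) = \<zero>" using ann[of i] d(1) i by (simp add: Pi_def)
  qed auto
  finally show ?thesis by simp
qed

lemma N_submodule: "submodule N R (F e)"
proof -
  interpret Fe: module R "F e" by (rule module_free)
  show ?thesis
  proof (rule Fe.submodule_criterion)
    show "N \<subseteq> carrier (F e)" using Fe.smult_closed yv_carrier unfolding N_def by blast
    show "\<zero>\<^bsub>F e\<^esub> \<in> N" unfolding N_def using Fe.smult_l_null[OF yv_carrier] by (metis image_eqI zero_closed)
    fix a b assume "a \<in> N" "b \<in> N"
    then obtain c d where h: "c \<in> carrier R" "d \<in> carrier R" "a = c \<odot>\<^bsub>F e\<^esub> yv" "b = d \<odot>\<^bsub>F e\<^esub> yv" by (auto simp: N_def)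
    then have "a \<oplus>\<^bsub>F e\<^esub> b = (c \<oplus> d) \<odot>\<^bsub>F e\<^esub> yv" using Fe.smult_l_distr[OF h(1,2) yv_carrier] by simp
    then show "a \<oplus>\<^bsub>F e\<^esub> b \<in> N" using h by (auto simp: N_def)
  next
    fix r a assume r: "r \<in> carrier R" and "a \<in> N"
    then obtain c where h: "c \<in> carrier R" "a = c \<odot>\<^bsub>F e\<^esub> yv" by (auto simp: N_def)
    then have "r \<odot>\<^bsub>F e\<^esub> a = (r \<otimes> c) \<odot>\<^bsub>F e\<^esub> yv" using Fe.smult_assoc1[OF r h(1) yv_carrier] by simp
    then show "r \<odot>\<^bsub>F e\<^esub> a \<in> N" using r h by (auto simp: N_def)
  qed
qed

abbreviation "M \<equiv> quot_module R (F e) N"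

lemma M_module: "module R M"
  by (rule module.quot_module_is_module[OF module_free N_submodule])

lemma proj_hom: "(\<lambda>x. N +>\<^bsub>F e\<^esub> x) \<in> mod_hom R (F e) M"
  by (rule module.coset_mod_hom[OF module_free N_submodule])

lemma proj_surj: "(\<lambda>x. N +>\<^bsub>F e\<^esub> x) ` carrier (F e) = carrier M"
  using module.quot_module_carrier[OF module_free N_submodule] by simp

lemma proj_zero: "x \<in> carrier (F e) \<Longrightarrow> N +>\<^bsub>F e\<^esub> x = \<zero>\<^bsub>M\<^esub> \<longleftrightarrow> x \<in> N"
  using module.coset_eq_zero_iff[OF module_free N_submodule] by (simp add: quot_module_def del: free_module_simps)

lemma M_fin_gen: "mod_fin_gen R M"
proof -
  have "index_generates R M e (\<lambda>i. N +>\<^bsub>F e\<^esub> std_basis R e i) (carrier M)"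
    unfolding index_generates_def
  proof (intro conjI ballI)
    show "(\<lambda>i. N +>\<^bsub>F e\<^esub> std_basis R e i) \<in> {..<e} \<rightarrow> carrier M"
      using proj_surj std_basis_carrier by blast
    fix X assume "X \<in> carrier M"
    then obtain x where x: "x \<in> carrier (F e)" "X = N +>\<^bsub>F e\<^esub> x" using proj_surj by blast
    have xc: "x \<in> {..<e} \<rightarrow> carrier R" using x(1) by auto
    from mod_hom_lin_comb[OF module_free M_module proj_hom _ xc, of "std_basis R e"] std_basis_carrier
    have "X = lin_comb M e (\<lambda>i. N +>\<^bsub>F e\<^esub> std_basis R e i) x"
      using std_basis_expansion[OF x(1)] x(2) by simp
    then show "\<exists>c\<in>{..<e} \<rightarrow> carrier R. X = lin_comb M e (\<lambda>i. N +>\<^bsub>F e\<^esub> std_basis R e i) c" using xc by blast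
  qed
  then obtain n v where "minimally_generates R \<mm> M n v (carrier M)"
    using exists_minimal_generators[OF M_module subset_refl] by blast
  then show ?thesis by (rule minimally_generates_imp_fin_gen[OF M_module])
qed

text \<open>A basis of \<open>M\<close> splits the projection: \<open>e\<^sub>i \<in> s\<^sub>i + u\<^sub>i y\<close> with \<open>\<Sum>\<^sub>i y\<^sub>i s\<^sub>i = 0\<close>. Hence
  \<open>y = (\<Sum>\<^sub>i y\<^sub>i u\<^sub>i) y\<close>, and the scalar lies in the maximal ideal.\<close>

lemma M_not_free: "\<not> fin_free R M"
proof
  assume "fin_free R M"
  interpret Fe: module R "F e" by (rule module_free)
  interpret M: module R M by (rule M_module)
  obtain n v where v: "indexed_basis R M n v"
    using \<open>fin_free R M\<close> M.finite_basis_imp_indexed unfolding fin_free_def by metis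
  then have vc: "v \<in> {..<n} \<rightarrow> carrier M" by (simp add: indexed_basis_def)
  then have "\<forall>l<n. \<exists>w\<in>carrier (F e). v l = N +>\<^bsub>F e\<^esub> w" using proj_surj by blast
  then obtain w where w: "\<And>l. l < n \<Longrightarrow> w l \<in> carrier (F e)" "\<And>l. l < n \<Longrightarrow> v l = N +>\<^bsub>F e\<^esub> w l" by metis
  have wc: "w \<in> {..<n} \<rightarrow> carrier (F e)" using w(1) by blast
  have sbc: "std_basis R e \<in> {..<e} \<rightarrow> carrier (F e)" using std_basis_carrier by blast
  have "\<forall>i. \<exists>c\<in>{..<n} \<rightarrow> carrier R. N +>\<^bsub>F e\<^esub> std_basis R e i = lin_comb M n v c"
  proof
    fix i
    have "N +>\<^bsub>F e\<^esub> std_basis R e i \<in> carrier M" using proj_surj std_basis_carrier by blast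
    then show "\<exists>c\<in>{..<n} \<rightarrow> carrier R. N +>\<^bsub>F e\<^esub> std_basis R e i = lin_comb M n v c"
      using v unfolding indexed_basis_def by simp
  qed
  then obtain C where C: "\<And>i. C i \<in> {..<n} \<rightarrow> carrier R"
    "\<And>i. N +>\<^bsub>F e\<^esub> std_basis R e i = lin_comb M n v (C i)" by metis
  \<comment> \<open>\<open>s i\<close> is the image of the \<open>i\<close>-th standard vector under
    the projection to \<open>M\<close> followed by the splitting that sends \<open>v l\<close> to
    \<open>w l\<close>.\<close>
  define s where "s i = lin_comb (F e) n w (C i)" for i
  have s: "s i \<in> carrier (F e)" for i unfolding s_def by (rule Fe.lin_comb_closed[OF wc C(1)])
  have ps: "N +>\<^bsub>F e\<^esub> s i = N +>\<^bsub>F e\<^esub> std_basis R e i" for i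
  proof -
    have "N +>\<^bsub>F e\<^esub> s i = lin_comb M n (\<lambda>l. N +>\<^bsub>F e\<^esub> w l) (C i)"
      unfolding s_def by (rule mod_hom_lin_comb[OF module_free M_module proj_hom wc C(1)])
    also have "\<dots> = lin_comb M n v (C i)"
      using vc C(1) w(2) by (intro M.lin_comb_cong[symmetric]) auto
    finally show ?thesis using C(2) by simp
  qed
  have "\<exists>u\<in>carrier R. std_basis R e i = s i \<oplus>\<^bsub>F e\<^esub> u \<odot>\<^bsub>F e\<^esub> yv" for i
  proof -
    have "std_basis R e i \<in> N +>\<^bsub>F e\<^esub> s i"
      unfolding ps
      using abelian_subgroup.a_rcos_self[OF Fe.submodule_abelian_subgroup[OF N_submodule]] std_basis_carrier by blast
    then obtain u where u: "u \<in> carrier R" "std_basis R e i = u \<odot>\<^bsub>F e\<^esub> yv \<oplus>\<^bsub>F e\<^esub> s i"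
      by (auto simp: a_r_coset_def r_coset_def N_def)
    then show ?thesis using Fe.M.a_comm[OF Fe.smult_closed[OF u(1) yv_carrier] s] by metis
  qed
  then obtain u where u: "\<And>i. u i \<in> carrier R"
    "\<And>i. std_basis R e i = s i \<oplus>\<^bsub>F e\<^esub> u i \<odot>\<^bsub>F e\<^esub> yv" by metis
  have yP: "yv \<in> {..<e} \<rightarrow> carrier R" using yv_carrier by auto
  have Cc: "C i l \<in> carrier R" if "l < n" for i l using C(1)[of i] that by auto
  define D where "D l = (\<Oplus>i\<in>{..<e}. yv i \<otimes> C i l)" for l
  have Dc: "D \<in> {..<n} \<rightarrow> carrier R" unfolding D_def using yP Cc by (auto intro!: finsum_closed)
  have "N +>\<^bsub>F e\<^esub> yv = lin_comb M e (\<lambda>i. N +>\<^bsub>F e\<^esub> std_basis R e i) yv"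
    using mod_hom_lin_comb[OF module_free M_module proj_hom sbc yP] std_basis_expansion[OF yv_carrier] by simp
  also have "\<dots> = lin_comb M e (\<lambda>i. lin_comb M n v (C i)) yv" by (simp add: C(2))
  also have "\<dots> = lin_comb M n v D" unfolding D_def by (rule M.lin_comb_lin_comb[OF vc yP C(1)])
  finally have "lin_comb M n v D = N +>\<^bsub>F e\<^esub> yv" by simp
  moreover have "yv \<in> N" unfolding N_def using Fe.smult_one[OF yv_carrier] by (metis image_eqI one_closed)
  ultimately have "lin_comb M n v D = \<zero>\<^bsub>M\<^esub>" using proj_zero[OF yv_carrier] by simp
  \<comment> \<open>\<open>D\<close> holds the coordinates of the class of \<open>y\<close>, which
    is zero in \<open>M\<close>.\<close>
  then have D0: "D l = \<zero>" if "l < n" for l using v Dc that unfolding indexed_basis_def by blast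
  have "lin_comb (F e) e s yv = lin_comb (F e) n w D"
    unfolding s_def D_def by (rule Fe.lin_comb_lin_comb[OF wc yP C(1)])
  also have "\<dots> = lin_comb (F e) n w (\<lambda>l. \<zero>)" using wc Dc D0 by (intro Fe.lin_comb_cong) auto
  also have "\<dots> = \<zero>\<^bsub>F e\<^esub>" by (rule Fe.lin_comb_zero[OF wc])
  finally have s0: "lin_comb (F e) e s yv = \<zero>\<^bsub>F e\<^esub>" .
  define r where "r = (\<Oplus>i\<in>{..<e}. yv i \<otimes> u i)"
  have r: "r \<in> \<mm>" unfolding r_def using y_max u(1)
    by (intro ideal_finsum_closed[OF maximal_ideal] ideal.I_r_closed[OF maximal_ideal]) (auto simp: yv_def)
  have "yv = lin_comb (F e) e (std_basis R e) yv" using std_basis_expansion[OF yv_carrier] by simp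
  also have "\<dots> = lin_comb (F e) e (\<lambda>i. s i \<oplus>\<^bsub>F e\<^esub> u i \<odot>\<^bsub>F e\<^esub> yv) yv"
    using sbc yP u(2) by (intro Fe.lin_comb_cong) auto
  also have "\<dots> = lin_comb (F e) e s yv \<oplus>\<^bsub>F e\<^esub> lin_comb (F e) e (\<lambda>i. u i \<odot>\<^bsub>F e\<^esub> yv) yv"
    using s u(1) Fe.smult_closed[OF u(1) yv_carrier] by (intro Fe.lin_comb_add_vectors yP) blast+
  also have "\<dots> = lin_comb (F e) e (\<lambda>i. u i \<odot>\<^bsub>F e\<^esub> yv) yv"
    unfolding s0 using Fe.smult_closed[OF u(1) yv_carrier]
    by (intro Fe.M.l_zero Fe.lin_comb_closed yP) blast
  also have "\<dots> = r \<odot>\<^bsub>F e\<^esub> yv" unfolding r_def using u(1) by (intro Fe.lin_comb_multiples yv_carrier yP) blast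
  finally have yr: "yv = r \<odot>\<^bsub>F e\<^esub> yv" .
  \<comment> \<open>As \<open>r\<close> lies in \<mm>, the scalar 1 - r is a unit and cannot kill
    \<open>y\<close>.\<close>
  have "(\<one> \<ominus> r) \<otimes> y i = \<zero>" if i: "i < e" for i
  proof -
    have "y i = r \<otimes> y i" using arg_cong[OF yr, of "\<lambda>x. x i"] i by (simp add: yv_def)
    moreover have "(\<one> \<ominus> r) \<otimes> y i = y i \<ominus> r \<otimes> y i" using max_carrier[OF r] y_carrier[OF i] by algebra
    ultimately show ?thesis using y_carrier[OF i] by (metis minus_eq r_neg)
  qed
  then have "\<one> \<ominus> r \<in> \<mm>" using max_carrier[OF r] by (intro annihilator_in_max) auto
  then have "(\<one> \<ominus> r) \<oplus> r \<in> \<mm>" using r additive_subgroup.a_closed[OF ideal.axioms(1)[OF maximal_ideal]] by blast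
  moreover have "(\<one> \<ominus> r) \<oplus> r = \<one>" using max_carrier[OF r] by algebra
  ultimately show False using one_notin_maximal by simp
qed

end

section \<open>The fourth syzygy\<close>

lemma PiE_lessThan_change:
  fixes n :: nat
  assumes "x \<in> PiE {..<n} A" "\<And>i. i < n \<Longrightarrow> x i \<in> B"
  shows "x \<in> {..<n} \<rightarrow>\<^sub>E B"
  using assms by (simp add: PiE_def Pi_def)

lemma (in cring) reindex_mod_hom:
  assumes g: "\<And>i. i < n \<Longrightarrow> g i < m"
  shows "(\<lambda>c. \<lambda>i\<in>{..<n}. c (g i)) \<in> mod_hom R (free_module R m) (free_module R n)"
  unfolding mod_hom_def
proof (intro CollectI conjI ballI)
  let ?f = "\<lambda>c. \<lambda>i\<in>{..<n}. c (g i)"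
  show f: "?f \<in> carrier (free_module R m) \<rightarrow> carrier (free_module R n)" using g by auto
  fix x assume x: "x \<in> carrier (free_module R m)"
  { fix y assume y: "y \<in> carrier (free_module R m)"
    show "?f (x \<oplus>\<^bsub>free_module R m\<^esub> y) = ?f x \<oplus>\<^bsub>free_module R n\<^esub> ?f y"
      using g by (auto simp: free_module_def intro!: restrict_ext) }
  fix a assume a: "a \<in> carrier R"
  show "?f (a \<odot>\<^bsub>free_module R m\<^esub> x) = a \<odot>\<^bsub>free_module R n\<^esub> ?f x"
    using g by (auto simp: free_module_def intro!: restrict_ext)
qed

context noetherian_local_ring begin

text \<open>Any minimal beginning of a resolution can be continued: each kernel receives a minimal
  cover, and dependent choice strings the covers together.\<close>

lemma resolution_tail:
  assumes d: "d \<in> mod_hom R (free_module R b) (free_module R t)"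
    and ker: "\<forall>c\<in>carrier (free_module R b). d c = \<zero>\<^bsub>free_module R t\<^esub> \<longrightarrow> (\<forall>i<b. c i \<in> \<mm>)"
  shows "\<exists>B D. B 0 = b \<and> D 0 = d \<and>
    (\<forall>n. D (Suc n) \<in> mod_hom R (free_module R (B (Suc n))) (free_module R (B n))) \<and>
    D 1 ` carrier (free_module R (B 1)) = {x \<in> carrier (free_module R b). d x = \<zero>\<^bsub>free_module R t\<^esub>} \<and>
    (\<forall>n. D (Suc (Suc n)) ` carrier (free_module R (B (Suc (Suc n)))) =
      {x \<in> carrier (free_module R (B (Suc n))). D (Suc n) x = \<zero>\<^bsub>free_module R (B n)\<^esub>}) \<and>
    (\<forall>n. D (Suc n) ` carrier (free_module R (B (Suc n))) \<subseteq> {..<B n} \<rightarrow>\<^sub>E \<mm>)"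
proof -
  let ?F = "free_module R"
  \<comment> \<open>A state consists of a rank, a map and the rank of its target. The clause for
    \<open>n = 0\<close> pins the first state to the given map, since dependent choice alone would
    start at some arbitrary valid state.\<close>
  define P where "P n s \<longleftrightarrow> (case s of (b', d', t') \<Rightarrow> d' \<in> mod_hom R (?F b') (?F t') \<and>
      (\<forall>c\<in>carrier (?F b'). d' c = \<zero>\<^bsub>?F t'\<^esub> \<longrightarrow> (\<forall>i<b'. c i \<in> \<mm>)) \<and> (n = 0 \<longrightarrow> s = (b, d, t)))" for n :: nat and s
  define Q where "Q s s' \<longleftrightarrow> (case s of (b', d', t') \<Rightarrow> case s' of (b'', d'', t'') \<Rightarrow> t'' = b' \<and>
      d'' ` carrier (?F b'') = {x \<in> carrier (?F b'). d' x = \<zero>\<^bsub>?F t'\<^esub>})" for s s'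
  have "\<exists>f. \<forall>n. P n (f n) \<and> Q (f n) (f (Suc n))"
  proof (rule dependent_nat_choice)
    show "\<exists>s. P 0 s" using d ker by (auto simp: P_def intro!: exI[of _ "(b, d, t)"])
    fix s n assume s: "P n s"
    obtain b' d' t' where s': "s = (b', d', t')" by (cases s) auto
    have "d' \<in> mod_hom R (?F b') (?F t')" using s by (simp add: P_def s')
    from minimal_cover[OF mod_hom_kernel_submodule[OF module_free module_free this]]
    obtain b'' d'' where "d'' \<in> mod_hom R (?F b'') (?F b')"
      "d'' ` carrier (?F b'') = {x \<in> carrier (?F b'). d' x = \<zero>\<^bsub>?F t'\<^esub>}"
      "\<forall>c\<in>carrier (?F b''). d'' c = \<zero>\<^bsub>?F b'\<^esub> \<longrightarrow> (\<forall>i<b''. c i \<in> \<mm>)"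
      by (elim exE conjE)
    then show "\<exists>s'. P (Suc n) s' \<and> Q s s'" by (intro exI[of _ "(b'', d'', b')"]) (simp add: P_def Q_def s')
  qed
  then obtain f where f: "\<And>n. P n (f n)" "\<And>n. Q (f n) (f (Suc n))" by blast
  define B D T where "B n = fst (f n)" and "D n = fst (snd (f n))" and "T n = snd (snd (f n))" for n
  have fBDT: "f n = (B n, D n, T n)" for n by (simp add: B_def D_def T_def)
  have f0: "B 0 = b" "D 0 = d" "T 0 = t" using f(1)[of 0] by (auto simp: P_def fBDT)
  have hom: "D n \<in> mod_hom R (?F (B n)) (?F (T n))"
    and kerD: "c \<in> carrier (?F (B n)) \<Longrightarrow> D n c = \<zero>\<^bsub>?F (T n)\<^esub> \<Longrightarrow> i < B n \<Longrightarrow> c i \<in> \<mm>" for n c i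
    using f(1)[of n] by (auto simp: P_def fBDT)
  have T: "T (Suc n) = B n"
    and im: "D (Suc n) ` carrier (?F (B (Suc n))) = {x \<in> carrier (?F (B n)). D n x = \<zero>\<^bsub>?F (T n)\<^esub>}" for n
    using f(2)[of n] by (auto simp: Q_def fBDT)
  show ?thesis
  proof (intro exI[of _ B] exI[of _ D] conjI allI)
    fix n
    show "D (Suc n) ` carrier (?F (B (Suc n))) \<subseteq> {..<B n} \<rightarrow>\<^sub>E \<mm>"
      unfolding im
    proof
      fix x assume "x \<in> {x \<in> carrier (?F (B n)). D n x = \<zero>\<^bsub>?F (T n)\<^esub>}"
      then have x: "x \<in> carrier (?F (B n))" "D n x = \<zero>\<^bsub>?F (T n)\<^esub>" by blast+
      show "x \<in> {..<B n} \<rightarrow>\<^sub>E \<mm>" using PiE_lessThan_change[of x "B n" "\<lambda>_. carrier R" \<mm>] x(1) kerD[OF x] by simp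
    qed
    show "D (Suc n) \<in> mod_hom R (?F (B (Suc n))) (?F (B n))" using hom[of "Suc n"] T by simp
    show "D (Suc (Suc n)) ` carrier (?F (B (Suc (Suc n)))) =
        {x \<in> carrier (?F (B (Suc n))). D (Suc n) x = \<zero>\<^bsub>?F (B n)\<^esub>}" using im[of "Suc n"] T by simp
  qed (use im[of 0] f0 in simp_all)
qed

end

context generator_cokernel begin

text \<open>The free module of rank \<open>r * e\<close> is read as \<open>r\<close> copies of R^e,
  with coordinate \<open>j * e + i\<close> for entry \<open>i\<close> of block \<open>j\<close>. The
  maps \<open>blk j\<close> are the projections, the maps \<open>emb r j\<close> the
  inclusions.\<close>

definition blk :: "nat \<Rightarrow> (nat \<Rightarrow> 'a) \<Rightarrow> nat \<Rightarrow> 'a" where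
  "blk j c = (\<lambda>i\<in>{..<e}. c (j * e + i))"

definition emb :: "nat \<Rightarrow> nat \<Rightarrow> (nat \<Rightarrow> 'a) \<Rightarrow> nat \<Rightarrow> 'a" where
  "emb r j z = (\<lambda>k\<in>{..<r * e}. if k div e = j then z (k mod e) else \<zero>)"

text \<open>The kernel of \<open>r\<close> copies of \<open>sy\<close>, that is, \<open>r\<close>
  copies of the second syzygy of the residue field.\<close>

definition blk_kernel :: "nat \<Rightarrow> (nat \<Rightarrow> 'a) set" where
  "blk_kernel r = {c \<in> carrier (F (r * e)). \<forall>j<r. sy (blk j c) = \<zero>}"

lemma carrier_in_max:
  assumes "x \<in> carrier (F n)" "\<And>i. i < n \<Longrightarrow> x i \<in> \<mm>"
  shows "x \<in> {..<n} \<rightarrow>\<^sub>E \<mm>"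
  using PiE_lessThan_change[of x n "\<lambda>_. carrier R" \<mm>] assms by simp

lemma blk_index: "j < r \<Longrightarrow> i < e \<Longrightarrow> j * e + i < r * e"
  by (metis add_mult_distrib2 add.commute less_le_trans mult.commute mult_Suc mult_le_mono1 nat_add_left_cancel_less Suc_leI)

lemma index_div_mod:
  assumes "k < r * e" shows "k div e < r" "k mod e < e" "k div e * e + k mod e = k"
proof -
  have "e > 0" using assms by (cases e) auto
  then show "k div e < r" "k mod e < e" "k div e * e + k mod e = k"
    using assms by (auto simp: less_mult_imp_div_less)
qed

lemma blk_hom: "j < r \<Longrightarrow> blk j \<in> mod_hom R (F (r * e)) (F e)"
  unfolding blk_def[abs_def] by (rule reindex_mod_hom) (rule blk_index)

lemma emb_hom: "emb r j \<in> mod_hom R (F e) (F (r * e))"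
  unfolding mod_hom_def
proof (intro CollectI conjI ballI)
  show "emb r j \<in> carrier (F e) \<rightarrow> carrier (F (r * e))"
    using index_div_mod by (auto simp: emb_def)
  fix x assume x: "x \<in> carrier (F e)"
  { fix z assume z: "z \<in> carrier (F e)"
    show "emb r j (x \<oplus>\<^bsub>F e\<^esub> z) = emb r j x \<oplus>\<^bsub>F (r * e)\<^esub> emb r j z"
      using index_div_mod by (auto simp: emb_def free_module_def intro!: restrict_ext) }
  fix a assume a: "a \<in> carrier R"
  show "emb r j (a \<odot>\<^bsub>F e\<^esub> x) = a \<odot>\<^bsub>F (r * e)\<^esub> emb r j x"
    using index_div_mod a by (auto simp: emb_def free_module_def intro!: restrict_ext)
qed

lemma blk_emb:
  assumes "j < r" "l < r" "z \<in> carrier (F e)"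
  shows "blk l (emb r j z) = (if l = j then z else \<zero>\<^bsub>F e\<^esub>)"
proof -
  interpret Fe: module R "F e" by (rule module_free)
  show ?thesis
  proof (rule PiE_lessThan_ext)
    show "blk l (emb r j z) \<in> {..<e} \<rightarrow>\<^sub>E carrier R"
      using mod_homD(1)[OF blk_hom[OF assms(2)]] mod_homD(1)[OF emb_hom[of r j]] assms(3) by auto
    show "(if l = j then z else \<zero>\<^bsub>F e\<^esub>) \<in> {..<e} \<rightarrow>\<^sub>E carrier R" using assms(3) Fe.M.zero_closed by simp
    fix i assume i: "i < e"
    then show "blk l (emb r j z) i = (if l = j then z else \<zero>\<^bsub>F e\<^esub>) i"
      using blk_index[OF assms(2) i] by (auto simp: blk_def emb_def)
  qed
qed

lemma lin_comb_one:
  assumes "module R M'" "v 0 \<in> carrier M'" "c 0 \<in> carrier R"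
  shows "lin_comb M' 1 v c = c 0 \<odot>\<^bsub>M'\<^esub> v 0"
proof -
  interpret M': module R M' by fact
  show ?thesis using assms(2,3) by (simp add: lin_comb_def lessThan_Suc)
qed

text \<open>The resolution ends in R^(re) -> R^r -> R -> R^e. The socle is killed by \<mm>, so its
  minimal cover by R^r has kernel exactly \<mm>R^r, and this is covered by \<open>r\<close> copies
  of \<open>sy\<close>. The fourth syzygy is the kernel of that cover.\<close>

lemma fourth_syzygy: "\<exists>r. is_syzygy R \<mm> 4 M ((F (r * e))\<lparr>carrier := blk_kernel r\<rparr>)"
proof -
  interpret Fe: module R "F e" by (rule module_free)
  interpret F1: module R "F 1" by (rule module_free)
  define d1 where "d1 = lin_comb (F e) 1 (\<lambda>_. yv)"
  have d1: "d1 \<in> mod_hom R (F 1) (F e)" unfolding d1_def using yv_carrier by (intro Fe.lin_comb_mod_hom) blast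
  have d1_eq: "d1 c = c 0 \<odot>\<^bsub>F e\<^esub> yv" if "c 0 \<in> carrier R" for c
    unfolding d1_def using lin_comb_one[OF module_free, of "\<lambda>_. yv" e c] yv_carrier that by blast
  have d1_im: "d1 ` carrier (F 1) = N"
  proof
    show "d1 ` carrier (F 1) \<subseteq> N"
    proof clarify
      fix c assume "c \<in> carrier (F 1)"
      then have "c 0 \<in> carrier R" by auto
      then show "d1 c \<in> N" using d1_eq by (simp add: N_def)
    qed
    show "N \<subseteq> d1 ` carrier (F 1)"
    proof
      fix x assume "x \<in> N"
      then obtain c where c: "c \<in> carrier R" "x = c \<odot>\<^bsub>F e\<^esub> yv" by (auto simp: N_def)
      then have "x = d1 (\<lambda>i\<in>{..<1}. c)" using d1_eq[of "\<lambda>i\<in>{..<1}. c"] by simp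
      then show "x \<in> d1 ` carrier (F 1)" using c(1) by auto
    qed
  qed
  have d1_max: "d1 ` carrier (F 1) \<subseteq> {..<e} \<rightarrow>\<^sub>E \<mm>"
  proof
    fix x assume "x \<in> d1 ` carrier (F 1)"
    then obtain c where c: "c \<in> carrier R" "x = c \<odot>\<^bsub>F e\<^esub> yv" unfolding d1_im by (auto simp: N_def)
    then have "x \<in> carrier (F e)" using Fe.smult_closed yv_carrier by blast
    moreover have "x i \<in> \<mm>" if "i < e" for i
      using c that y_max ideal.I_l_closed[OF maximal_ideal] by (simp add: yv_def)
    ultimately show "x \<in> {..<e} \<rightarrow>\<^sub>E \<mm>" by (rule carrier_in_max)
  qed
  \<comment> \<open>The socle of \<open>R\<close>, seen inside the free module of rank one.\<close>
  define K1 where "K1 = {c \<in> carrier (F 1). d1 c = \<zero>\<^bsub>F e\<^esub>}"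
  have K1: "submodule K1 R (F 1)" unfolding K1_def by (rule mod_hom_kernel_submodule[OF module_free module_free d1])
  have K1_ann: "c 0 \<otimes> y i = \<zero>" and K1_c: "c 0 \<in> carrier R" if "c \<in> K1" "i < e" for c i
  proof -
    show c0: "c 0 \<in> carrier R" using that(1) by (auto simp: K1_def)
    have "d1 c i = \<zero>" using that by (simp add: K1_def)
    then show "c 0 \<otimes> y i = \<zero>" using d1_eq[of c, OF c0] that(2) by (simp add: yv_def)
  qed
  obtain r d2 where d2: "d2 \<in> mod_hom R (F r) (F 1)" "d2 ` carrier (F r) = K1"
    "\<And>c i. c \<in> carrier (F r) \<Longrightarrow> d2 c = \<zero>\<^bsub>F 1\<^esub> \<Longrightarrow> i < r \<Longrightarrow> c i \<in> \<mm>"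
    using minimal_cover[OF K1] by (elim exE conjE) blast
  have e0: "0 < e" using y_nonzero by auto
  have d2_max: "d2 ` carrier (F r) \<subseteq> {..<1} \<rightarrow>\<^sub>E \<mm>"
  proof
    fix x assume "x \<in> d2 ` carrier (F r)"
    then have x: "x \<in> K1" using d2(2) by simp
    then have x0: "x 0 \<in> \<mm>" using K1_ann[OF x] K1_c[OF x e0] by (intro annihilator_in_max)
    have "x \<in> carrier (F 1)" using x by (simp add: K1_def)
    then show "x \<in> {..<1} \<rightarrow>\<^sub>E \<mm>" by (rule carrier_in_max) (simp add: x0)
  qed
  have d2_ker: "{c \<in> carrier (F r). d2 c = \<zero>\<^bsub>F 1\<^esub>} = {..<r} \<rightarrow>\<^sub>E \<mm>"
  proof
    show "{c \<in> carrier (F r). d2 c = \<zero>\<^bsub>F 1\<^esub>} \<subseteq> {..<r} \<rightarrow>\<^sub>E \<mm>" using d2(3) carrier_in_max by blast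
    show "{..<r} \<rightarrow>\<^sub>E \<mm> \<subseteq> {c \<in> carrier (F r). d2 c = \<zero>\<^bsub>F 1\<^esub>}"
    proof
      fix c assume c: "c \<in> {..<r} \<rightarrow>\<^sub>E \<mm>"
      then have cF: "c \<in> carrier (F r)" using PiE_lessThan_change[of c r "\<lambda>_. \<mm>" "carrier R"] max_carrier by auto
      have cP: "c \<in> {..<r} \<rightarrow> carrier R" using cF by auto
      have "d2 c = lin_comb (F 1) r (\<lambda>i. d2 (std_basis R r i)) c"
        using mod_hom_lin_comb[OF module_free module_free d2(1) _ cP, of "std_basis R r"] std_basis_carrier
          std_basis_expansion[OF cF] by auto
      also have "\<dots> \<in> {\<zero>\<^bsub>F 1\<^esub>}"
      proof (rule F1.lin_comb_submodule)
        show "submodule {\<zero>\<^bsub>F 1\<^esub>} R (F 1)" by (rule F1.submodule_criterion) (auto simp del: free_module_simps One_nat_def)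
        fix i assume i: "i < r"
        have K: "d2 (std_basis R r i) \<in> K1" using d2(2) std_basis_carrier by blast
        have ci: "c i \<in> \<mm>" using c i by auto
        have "c i \<odot>\<^bsub>F 1\<^esub> d2 (std_basis R r i) = \<zero>\<^bsub>F 1\<^esub>"
        proof (rule PiE_lessThan_ext)
          show "c i \<odot>\<^bsub>F 1\<^esub> d2 (std_basis R r i) \<in> {..<1} \<rightarrow>\<^sub>E carrier R"
            using F1.smult_closed[OF max_carrier[OF ci], of "d2 (std_basis R r i)"] K by (simp add: K1_def del: One_nat_def)
          show "\<zero>\<^bsub>F 1\<^esub> \<in> {..<1} \<rightarrow>\<^sub>E carrier R" using F1.M.zero_closed by (simp del: One_nat_def)
          fix k :: nat assume "k < 1"
          then show "(c i \<odot>\<^bsub>F 1\<^esub> d2 (std_basis R r i)) k = \<zero>\<^bsub>F 1\<^esub> k"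
            using annihilates_max[OF K1_c[OF K e0] K1_ann[OF K] ci] max_carrier[OF ci] K1_c[OF K e0]
            by (simp add: m_comm)
        qed
        then show "c i \<odot>\<^bsub>F 1\<^esub> d2 (std_basis R r i) \<in> {\<zero>\<^bsub>F 1\<^esub>}" by simp
      qed
      finally show "c \<in> {c \<in> carrier (F r). d2 c = \<zero>\<^bsub>F 1\<^esub>}" using cF by simp
    qed
  qed
  define d3 where "d3 c = (\<lambda>j\<in>{..<r}. sy (blk j c))" for c
  have blkc: "blk j c \<in> carrier (F e)" if "j < r" "c \<in> carrier (F (r * e))" for j c
    using mod_homD(1)[OF blk_hom[OF that(1)]] that(2) by blast
  have syc: "sy z \<in> carrier R" if "z \<in> carrier (F e)" for z using mod_homD(1)[OF sy_hom] that by auto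
  have d3: "d3 \<in> mod_hom R (F (r * e)) (F r)"
    unfolding mod_hom_def
  proof (intro CollectI conjI ballI)
    show "d3 \<in> carrier (F (r * e)) \<rightarrow> carrier (F r)"
      using syc[OF blkc] by (auto simp: d3_def simp del: free_module_simps(1)) (simp add: free_module_simps(1))
    fix x assume x: "x \<in> carrier (F (r * e))"
    { fix z assume z: "z \<in> carrier (F (r * e))"
      have "sy (blk j (x \<oplus>\<^bsub>F (r * e)\<^esub> z)) = sy (blk j x) \<oplus> sy (blk j z)" if "j < r" for j
        using mod_homD(2)[OF blk_hom[OF that] x z] mod_homD(2)[OF sy_hom blkc[OF that x] blkc[OF that z]] by simp
      then show "d3 (x \<oplus>\<^bsub>F (r * e)\<^esub> z) = d3 x \<oplus>\<^bsub>F r\<^esub> d3 z"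
        unfolding d3_def by (auto simp: free_module_def[of R r] intro!: restrict_ext) }
    fix a assume a: "a \<in> carrier R"
    have "sy (blk j (a \<odot>\<^bsub>F (r * e)\<^esub> x)) = a \<otimes> sy (blk j x)" if "j < r" for j
      using mod_homD(3)[OF blk_hom[OF that] a x] mod_homD(3)[OF sy_hom a blkc[OF that x]] by simp
    then show "d3 (a \<odot>\<^bsub>F (r * e)\<^esub> x) = a \<odot>\<^bsub>F r\<^esub> d3 x"
      unfolding d3_def by (auto simp: free_module_def[of R r] intro!: restrict_ext)
  qed
  have d3_im: "d3 ` carrier (F (r * e)) = {..<r} \<rightarrow>\<^sub>E \<mm>"
  proof
    show "d3 ` carrier (F (r * e)) \<subseteq> {..<r} \<rightarrow>\<^sub>E \<mm>"
    proof clarify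
      fix c assume c: "c \<in> carrier (F (r * e))"
      have "sy (blk j c) \<in> \<mm>" if "j < r" for j using blkc[OF that c] by (intro sy_max) auto
      then show "d3 c \<in> {..<r} \<rightarrow>\<^sub>E \<mm>" by (auto simp: d3_def)
    qed
    show "{..<r} \<rightarrow>\<^sub>E \<mm> \<subseteq> d3 ` carrier (F (r * e))"
    proof
      fix v assume v: "v \<in> {..<r} \<rightarrow>\<^sub>E \<mm>"
      then have "\<forall>j<r. \<exists>z\<in>{..<e} \<rightarrow> carrier R. v j = sy z" using y_gen by auto
      then obtain z where z: "\<And>j. j < r \<Longrightarrow> z j \<in> {..<e} \<rightarrow> carrier R" "\<And>j. j < r \<Longrightarrow> v j = sy (z j)" by metis
      define c where "c = (\<lambda>k\<in>{..<r * e}. z (k div e) (k mod e))"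
      have zc: "z j i \<in> carrier R" if "j < r" "i < e" for j i using z(1)[OF that(1)] that(2) by auto
      have c: "c \<in> carrier (F (r * e))" using zc[OF index_div_mod(1,2)] by (simp add: c_def)
      have "v = d3 c"
      proof (rule PiE_lessThan_ext[OF v])
        show "d3 c \<in> {..<r} \<rightarrow>\<^sub>E carrier R" using mod_homD(1)[OF d3] c by auto
        fix j assume j: "j < r"
        have "sy (z j) = sy (blk j c)" unfolding sy_eq
          using z(1)[OF j] y_carrier blk_index[OF j]
          by (intro finsum_cong') (auto simp: blk_def c_def Pi_def)
        then show "v j = d3 c j" using z(2)[OF j] j by (simp add: d3_def)
      qed
      then show "v \<in> d3 ` carrier (F (r * e))" using c by blast
    qed
  qed
  have d3_ker: "{c \<in> carrier (F (r * e)). d3 c = \<zero>\<^bsub>F r\<^esub>} = blk_kernel r"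
  proof -
    have "d3 c = \<zero>\<^bsub>F r\<^esub> \<longleftrightarrow> (\<forall>j<r. sy (blk j c) = \<zero>)" for c
    proof
      assume "d3 c = \<zero>\<^bsub>F r\<^esub>"
      then show "\<forall>j<r. sy (blk j c) = \<zero>" by (metis d3_def free_module_simps(2) lessThan_iff restrict_apply')
    next
      assume "\<forall>j<r. sy (blk j c) = \<zero>"
      then show "d3 c = \<zero>\<^bsub>F r\<^esub>" by (auto simp: d3_def free_module_def[of R r] intro!: restrict_ext)
    qed
    then show ?thesis by (simp add: blk_kernel_def)
  qed
  have d3_min: "\<forall>c\<in>carrier (F (r * e)). d3 c = \<zero>\<^bsub>F r\<^esub> \<longrightarrow> (\<forall>k<r * e. c k \<in> \<mm>)"
  proof (intro ballI impI allI)
    fix c k assume c: "c \<in> carrier (F (r * e))" "d3 c = \<zero>\<^bsub>F r\<^esub>" and k: "k < r * e"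
    note dm = index_div_mod[OF k]
    have "c \<in> blk_kernel r" using c d3_ker by blast
    then have "sy (blk (k div e) c) = \<zero>" using dm(1) by (simp add: blk_kernel_def)
    moreover have "blk (k div e) c \<in> {..<e} \<rightarrow> carrier R" using blkc[OF dm(1) c(1)] by auto
    ultimately have "blk (k div e) c (k mod e) \<in> \<mm>" using dm(2) by (intro y_min)
    then show "c k \<in> \<mm>" using dm(2,3) by (simp add: blk_def)
  qed
  from resolution_tail[OF d3 d3_min] obtain B D where tail0: "B 0 = r * e" "D 0 = d3"
    "\<forall>n. D (Suc n) \<in> mod_hom R (F (B (Suc n))) (F (B n))"
    "D 1 ` carrier (F (B 1)) = {x \<in> carrier (F (r * e)). d3 x = \<zero>\<^bsub>F r\<^esub>}"
    "\<forall>n. D (Suc (Suc n)) ` carrier (F (B (Suc (Suc n)))) =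
       {x \<in> carrier (F (B (Suc n))). D (Suc n) x = \<zero>\<^bsub>F (B n)\<^esub>}"
    "\<forall>n. D (Suc n) ` carrier (F (B (Suc n))) \<subseteq> {..<B n} \<rightarrow>\<^sub>E \<mm>"
    by (elim exE conjE)
  note tail = tail0(1,2) spec[OF tail0(3)] tail0(4) spec[OF tail0(5)] spec[OF tail0(6)]
  \<comment> \<open>The tail starts at \<open>d3\<close>, so its degrees are shifted by three:
    \<open>B 0\<close> is the rank in degree 3 and \<open>D 0\<close> is the differential from there
    to degree 2.\<close>
  define b where "b n = (if n = 0 then e else if n = 1 then 1 else if n = 2 then r else B (n - 3))" for n :: nat
  define d where "d n = (if n = 1 then d1 else if n = 2 then d2 else D (n - 3))" for n :: nat
  have bs: "b 0 = e" "b (Suc 0) = 1" "b (Suc (Suc 0)) = r" "b (Suc (Suc (Suc n))) = B n" for n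
    by (simp_all add: b_def)
  have ds: "d (Suc 0) = d1" "d (Suc (Suc 0)) = d2" "d (Suc (Suc (Suc n))) = D n" for n
    by (simp_all add: d_def)
  have "minimal_free_resolution R \<mm> M b (\<lambda>x. N +>\<^bsub>F e\<^esub> x) d"
    unfolding minimal_free_resolution_def Let_def
  proof (intro conjI allI)
    show "(\<lambda>x. N +>\<^bsub>F e\<^esub> x) \<in> mod_hom R (F (b 0)) M" using proj_hom by (simp only: bs)
    show "(\<lambda>x. N +>\<^bsub>F e\<^esub> x) ` carrier (F (b 0)) = carrier M" using proj_surj by (simp only: bs)
    show "d 1 ` carrier (F (b 1)) = {x \<in> carrier (F (b 0)). N +>\<^bsub>F e\<^esub> x = \<zero>\<^bsub>M\<^esub>}"
    proof -
      have "{x \<in> carrier (F e). N +>\<^bsub>F e\<^esub> x = \<zero>\<^bsub>M\<^esub>} = N"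
        using proj_zero module.submoduleE(1)[OF module_free N_submodule] by blast
      then show ?thesis using d1_im by (simp only: One_nat_def bs ds)
    qed
    fix i
    consider "i = 0" | "i = Suc 0" | "i = Suc (Suc 0)" | n where "i = Suc (Suc (Suc n))"
      by (metis not0_implies_Suc)
    note cases = this
    show "d (Suc i) \<in> mod_hom R (F (b (Suc i))) (F (b i))"
      by (cases rule: cases) (use d1 d2(1) d3 tail(1-3) in \<open>simp_all only: bs ds One_nat_def\<close>)
    show "d (Suc i) ` carrier (F (b (Suc i))) \<subseteq> {..<b i} \<rightarrow>\<^sub>E \<mm>"
      by (cases rule: cases)
        (use d1_max d2_max equalityD1[OF d3_im] tail(1,2,6) in \<open>simp_all only: bs ds One_nat_def\<close>)
    show "d (Suc (Suc i)) ` carrier (F (b (Suc (Suc i)))) = {x \<in> carrier (F (b (Suc i))). d (Suc i) x = \<zero>\<^bsub>F (b i)\<^esub>}"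
      by (cases rule: cases)
        (use d2(2) d2_ker d3_im tail(1,2,4,5) in \<open>simp_all only: bs ds One_nat_def K1_def\<close>)
  qed
  moreover have "b (4 - 1) = r * e" "d 4 ` carrier (F (b 4)) = blk_kernel r"
    using tail(1,4) d3_ker by (auto simp: b_def d_def)
  ultimately show ?thesis unfolding is_syzygy_def by metis
qed

text \<open>The summand lives in \<open>r\<close> copies of the second syzygy of the residue field.
  A socle element outside the complement is the sum of its embedded blocks, so one of these is
  outside too, and pulling the complement back along that inclusion leaves a statement about a
  single R^e.\<close>

lemma syzygy_socle_element:
  assumes "\<And>Z. is_syzygy R \<mm> 4 M Z \<Longrightarrow> direct_summand R (residue_module R \<mm>) Z"
  shows "\<exists>B a. submodule B R (F e) \<and> a \<in> carrier (F e) \<and> a \<notin> B \<and>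
    (\<forall>p\<in>\<mm>. p \<odot>\<^bsub>F e\<^esub> a = \<zero>\<^bsub>F e\<^esub>) \<and>
    (\<forall>p\<in>\<mm>. \<forall>z\<in>carrier (F e). sy z = \<zero> \<longrightarrow> p \<odot>\<^bsub>F e\<^esub> z \<in> B)"
proof -
  obtain r where r: "is_syzygy R \<mm> 4 M ((F (r * e))\<lparr>carrier := blk_kernel r\<rparr>)" using fourth_syzygy by blast
  let ?G = "F (r * e)" and ?Z = "(F (r * e))\<lparr>carrier := blk_kernel r\<rparr>"
  interpret G: module R ?G by (rule module_free)
  interpret Fe: module R "F e" by (rule module_free)
  have blkc: "blk j c \<in> carrier (F e)" if "j < r" "c \<in> carrier ?G" for j c
    using mod_homD(1)[OF blk_hom[OF that(1)]] that(2) by blast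
  have embc: "emb r j z \<in> carrier ?G" if "z \<in> carrier (F e)" for j z
    using mod_homD(1)[OF emb_hom] that by blast
  have K: "submodule (blk_kernel r) R ?G"
  proof (rule G.submodule_criterion)
    show "blk_kernel r \<subseteq> carrier ?G" by (auto simp: blk_kernel_def)
    show "\<zero>\<^bsub>?G\<^esub> \<in> blk_kernel r"
      using mod_hom_zero[OF module_free module_free blk_hom] mod_hom_zero[OF module_free module_self sy_hom]
        G.M.zero_closed by (simp add: blk_kernel_def del: free_module_simps)
    { fix u w assume "u \<in> blk_kernel r" "w \<in> blk_kernel r"
      then have h: "u \<in> carrier ?G" "w \<in> carrier ?G" "\<forall>j<r. sy (blk j u) = \<zero>" "\<forall>j<r. sy (blk j w) = \<zero>"
        unfolding blk_kernel_def by blast+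
      have "sy (blk j (u \<oplus>\<^bsub>?G\<^esub> w)) = \<zero>" if j: "j < r" for j
        using mod_homD(2)[OF blk_hom[OF j] h(1,2)] mod_homD(2)[OF sy_hom blkc[OF j h(1)] blkc[OF j h(2)]] h(3,4) j by simp
      then show "u \<oplus>\<^bsub>?G\<^esub> w \<in> blk_kernel r" using G.M.a_closed[OF h(1,2)] unfolding blk_kernel_def by blast }
    fix a u assume a: "a \<in> carrier R" and "u \<in> blk_kernel r"
    then have h: "u \<in> carrier ?G" "\<forall>j<r. sy (blk j u) = \<zero>" unfolding blk_kernel_def by blast+
    have "sy (blk j (a \<odot>\<^bsub>?G\<^esub> u)) = \<zero>" if j: "j < r" for j
      using mod_homD(3)[OF blk_hom[OF j] a h(1)] mod_homD(3)[OF sy_hom a blkc[OF j h(1)]] h(2) j a by simp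
    then show "a \<odot>\<^bsub>?G\<^esub> u \<in> blk_kernel r" using G.smult_closed[OF a h(1)] unfolding blk_kernel_def by blast
  qed
  have Z: "module R ?Z" by (rule submodule.submodule_is_module[OF K module_free])
  interpret Z: module R ?Z by (rule Z)
  obtain B a where B: "submodule B R ?Z" and a: "a \<in> carrier ?Z" "a \<notin> B" "\<And>p. p \<in> \<mm> \<Longrightarrow> p \<odot>\<^bsub>?Z\<^esub> a = \<zero>\<^bsub>?Z\<^esub>"
    and mB: "\<And>p z. p \<in> \<mm> \<Longrightarrow> z \<in> carrier ?Z \<Longrightarrow> p \<odot>\<^bsub>?Z\<^esub> z \<in> B"
    using residue_summand_socle[OF Z assms[OF r]] by blast
  note BE = Z.submoduleE[OF B]
  have B0: "\<zero>\<^bsub>?G\<^esub> \<in> B" using Z.submodule_zero_closed[OF B] by simp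
  have BK: "B \<subseteq> blk_kernel r" using BE(1) by simp
  have KG: "blk_kernel r \<subseteq> carrier ?G" by (rule G.submoduleE(1)[OF K])
  have Badd: "u \<oplus>\<^bsub>?G\<^esub> w \<in> B" if "u \<in> B" "w \<in> B" for u w using BE(5)[OF that] by simp
  have Bsm: "c \<odot>\<^bsub>?G\<^esub> u \<in> B" if "c \<in> carrier R" "u \<in> B" for c u using BE(4)[OF that] by simp
  have BG: "submodule B R ?G"
    by (rule G.submodule_criterion) (use BK KG B0 Badd Bsm in blast)+
  have aK: "a \<in> blk_kernel r" using a(1) by simp
  then have aG: "a \<in> carrier ?G" using KG by blast
  have "\<exists>j<r. emb r j (blk j a) \<notin> B"
  proof (rule ccontr)
    assume none: "\<not> (\<exists>j<r. emb r j (blk j a) \<notin> B)"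
    have "lin_comb ?G r (\<lambda>j. emb r j (blk j a)) (\<lambda>_. \<one>) \<in> B"
    proof (rule G.lin_comb_submodule[OF BG])
      fix j assume "j < r"
      then show "\<one> \<odot>\<^bsub>?G\<^esub> emb r j (blk j a) \<in> B" using none Bsm[OF one_closed] by blast
    qed
    moreover have "lin_comb ?G r (\<lambda>j. emb r j (blk j a)) (\<lambda>_. \<one>) = a"
    proof (rule PiE_lessThan_ext)
      have v: "(\<lambda>j. emb r j (blk j a)) \<in> {..<r} \<rightarrow> carrier ?G" using embc[OF blkc[OF _ aG]] by blast
      show "lin_comb ?G r (\<lambda>j. emb r j (blk j a)) (\<lambda>_. \<one>) \<in> {..<r * e} \<rightarrow>\<^sub>E carrier R"
        using G.lin_comb_closed[OF v, of "\<lambda>_. \<one>"] by simp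
      show "a \<in> {..<r * e} \<rightarrow>\<^sub>E carrier R" using aG by simp
      fix k assume k: "k < r * e"
      note dm = index_div_mod[OF k]
      have ac: "a k \<in> carrier R" using aG k by auto
      have "lin_comb ?G r (\<lambda>j. emb r j (blk j a)) (\<lambda>_. \<one>) k = (\<Oplus>j\<in>{..<r}. \<one> \<otimes> emb r j (blk j a) k)"
        using free_module_lin_comb_coord[OF v _ k, of "\<lambda>_. \<one>"] by simp
      also have "\<dots> = (\<Oplus>j\<in>{..<r}. if k div e = j then a k else \<zero>)"
        using k dm ac by (intro finsum_cong') (auto simp: emb_def blk_def)
      also have "\<dots> = a k" using dm(1) ac by (intro finsum_singleton) auto
      finally show "lin_comb ?G r (\<lambda>j. emb r j (blk j a)) (\<lambda>_. \<one>) k = a k" .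
    qed
    ultimately show False using a(2) by simp
  qed
  then obtain j where j: "j < r" "emb r j (blk j a) \<notin> B" by blast
  define B' where "B' = {z \<in> carrier (F e). emb r j z \<in> B}"
  have "submodule B' R (F e)"
  proof (rule Fe.submodule_criterion)
    show "\<zero>\<^bsub>F e\<^esub> \<in> B'"
      using mod_hom_zero[OF module_free module_free emb_hom, of r j] B0 Fe.M.zero_closed
      by (simp add: B'_def del: free_module_simps)
  qed (auto simp: B'_def mod_homD(2,3)[OF emb_hom] Badd Bsm simp del: free_module_simps)
  moreover have "blk j a \<in> carrier (F e)" by (rule blkc[OF j(1) aG])
  moreover have "blk j a \<notin> B'" using j(2) by (simp add: B'_def)
  moreover have "p \<odot>\<^bsub>F e\<^esub> blk j a = \<zero>\<^bsub>F e\<^esub>" if p: "p \<in> \<mm>" for p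
  proof -
    have "p \<odot>\<^bsub>?G\<^esub> a = \<zero>\<^bsub>?G\<^esub>" using a(3)[OF p] by simp
    then show ?thesis
      using mod_homD(3)[OF blk_hom[OF j(1)] max_carrier[OF p] aG] mod_hom_zero[OF module_free module_free blk_hom[OF j(1)]] by simp
  qed
  moreover have "p \<odot>\<^bsub>F e\<^esub> z \<in> B'" if p: "p \<in> \<mm>" and z: "z \<in> carrier (F e)" "sy z = \<zero>" for p z
  proof -
    have "sy (blk l (emb r j z)) = \<zero>" if "l < r" for l
      using blk_emb[OF j(1) that z(1)] z(2) mod_hom_zero[OF module_free module_self sy_hom] by simp
    then have "emb r j z \<in> carrier ?Z" using embc[OF z(1)] by (simp add: blk_kernel_def)
    then have "p \<odot>\<^bsub>?G\<^esub> emb r j z \<in> B" using mB[OF p] by simp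
    then show ?thesis
      using mod_homD(3)[OF emb_hom max_carrier[OF p] z(1)] Fe.smult_closed[OF max_carrier[OF p] z(1)]
      by (simp add: B'_def del: free_module_simps)
  qed
  ultimately show ?thesis by blast
qed

end

section \<open>Completion and presentations\<close>

context noetherian_local_ring begin

lemma ideal_power_1: "ideal_power R \<mm> 1 = \<mm>"
  using ideal_prod_one[OF maximal_ideal] ideal_prod_commute[OF oneideal maximal_ideal] by simp

lemma power_ideal: "ideal (ideal_power R \<mm> n) R"
  by (rule ideal_power_ideal[OF maximal_ideal])

text \<open>The coefficients can be kept in \<open>A\<close>, because only the second factor of each
  product is expanded in the generators.\<close>

lemma ideal_prod_max_generators:
  assumes A: "ideal A R" and y: "y \<in> {..<e} \<rightarrow> \<mm>"
    and gen: "\<And>u. u \<in> \<mm> \<Longrightarrow> \<exists>c\<in>{..<e} \<rightarrow> carrier R. u = (\<Oplus>i\<in>{..<e::nat}. c i \<otimes> y i)"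
    and u: "u \<in> A \<cdot>\<^bsub>R\<^esub> \<mm>"
  shows "\<exists>c\<in>{..<e} \<rightarrow> A. u = (\<Oplus>i\<in>{..<e}. c i \<otimes> y i)"
  using u
proof (induct rule: ideal_prod.induct)
  interpret A: ideal A R by fact
  have yc: "y i \<in> carrier R" if "i < e" for i using y that ideal.Icarr[OF maximal_ideal] by auto
  case (prod a v)
  obtain c where c: "c \<in> {..<e} \<rightarrow> carrier R" "v = (\<Oplus>i\<in>{..<e}. c i \<otimes> y i)" using gen[OF prod(2)] by blast
  have ac: "a \<in> carrier R" using prod(1) by (rule A.Icarr)
  have "a \<otimes> v = (\<Oplus>i\<in>{..<e}. a \<otimes> (c i \<otimes> y i))"
    unfolding c(2) using c(1) yc ac by (intro finsum_rdistr) auto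
  also have "\<dots> = (\<Oplus>i\<in>{..<e}. (a \<otimes> c i) \<otimes> y i)"
    using c(1) yc ac by (intro finsum_cong') (auto simp: m_assoc Pi_def)
  finally have "a \<otimes> v = (\<Oplus>i\<in>{..<e}. (a \<otimes> c i) \<otimes> y i)" .
  moreover have "(\<lambda>i. a \<otimes> c i) \<in> {..<e} \<rightarrow> A" using c(1) A.I_r_closed[OF prod(1)] by auto
  ultimately show ?case by (intro bexI[of _ "\<lambda>i. a \<otimes> c i"])
next
  interpret A: ideal A R by fact
  have yc: "y i \<in> carrier R" if "i < e" for i using y that ideal.Icarr[OF maximal_ideal] by auto
  case (sum v w)
  then obtain c d where c: "c \<in> {..<e} \<rightarrow> A" "v = (\<Oplus>i\<in>{..<e}. c i \<otimes> y i)"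
    and d: "d \<in> {..<e} \<rightarrow> A" "w = (\<Oplus>i\<in>{..<e}. d i \<otimes> y i)" by blast
  have cc: "c i \<in> carrier R" and dc: "d i \<in> carrier R" if "i < e" for i
    using c(1) d(1) that by (simp_all add: Pi_def A.Icarr)
  have "v \<oplus> w = (\<Oplus>i\<in>{..<e}. c i \<otimes> y i \<oplus> d i \<otimes> y i)"
    unfolding c(2) d(2) using cc dc yc by (intro finsum_addf[symmetric]) auto
  also have "\<dots> = (\<Oplus>i\<in>{..<e}. (c i \<oplus> d i) \<otimes> y i)"
    using cc dc yc by (intro finsum_cong') (auto simp: l_distr)
  finally have "v \<oplus> w = (\<Oplus>i\<in>{..<e}. (c i \<oplus> d i) \<otimes> y i)" .
  moreover have "(\<lambda>i. c i \<oplus> d i) \<in> {..<e} \<rightarrow> A" using c(1) d(1) by auto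
  ultimately show ?case by (intro bexI[of _ "\<lambda>i. c i \<oplus> d i"])
qed

abbreviation "C \<equiv> adic_completion R \<mm>"

lemma power_coset_mem:
  assumes "r \<in> carrier R"
  shows "r' \<in> ideal_power R \<mm> n +> r \<longleftrightarrow> r' \<in> carrier R \<and> r' \<ominus> r \<in> ideal_power R \<mm> n"
proof -
  interpret P: ideal "ideal_power R \<mm> n" R by (rule power_ideal)
  show ?thesis
  proof
    assume "r' \<in> ideal_power R \<mm> n +> r"
    then obtain p where p: "p \<in> ideal_power R \<mm> n" "r' = p \<oplus> r" by (auto simp: a_r_coset_def r_coset_def)
    then have "p \<in> carrier R" by (intro P.Icarr)
    then have "r' \<ominus> r = p" using assms unfolding p(2) by (simp add: minus_eq a_assoc r_neg)
    then show "r' \<in> carrier R \<and> r' \<ominus> r \<in> ideal_power R \<mm> n" using p \<open>p \<in> carrier R\<close> assms by simp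
  next
    assume r': "r' \<in> carrier R \<and> r' \<ominus> r \<in> ideal_power R \<mm> n"
    then have "r' = (r' \<ominus> r) \<oplus> r" using assms by (simp add: minus_eq a_assoc l_neg)
    then show "r' \<in> ideal_power R \<mm> n +> r" using r' by (auto simp: a_r_coset_def r_coset_def)
  qed
qed

lemma power_coset_eq:
  assumes "r \<in> carrier R" "r' \<in> ideal_power R \<mm> n +> r"
  shows "ideal_power R \<mm> n +> r' = ideal_power R \<mm> n +> r"
  using a_repr_independence[OF assms(2,1)] additive_subgroup.a_subgroup[OF ideal.axioms(1)[OF power_ideal]] by simp

lemma completion_carrier:
  "f \<in> carrier C \<longleftrightarrow> (\<forall>n. (\<exists>r\<in>carrier R. f n = ideal_power R \<mm> n +> r) \<and> f (Suc n) \<subseteq> f n)"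
  by (auto simp: adic_completion_def Let_def FactRing_def A_RCOSETS_def')

lemma completion_rep:
  assumes "f \<in> carrier C"
  shows "\<exists>r\<in>carrier R. r \<in> f n"
    and "r \<in> f n \<Longrightarrow> r \<in> carrier R"
    and "r \<in> f n \<Longrightarrow> f n = ideal_power R \<mm> n +> r"
proof -
  interpret P: ideal "ideal_power R \<mm> n" R by (rule power_ideal)
  obtain s where s: "s \<in> carrier R" "f n = ideal_power R \<mm> n +> s"
    using assms unfolding completion_carrier by blast
  show "\<exists>r\<in>carrier R. r \<in> f n" using s P.a_rcos_self[OF s(1)] by auto
  show "r \<in> f n \<Longrightarrow> r \<in> carrier R" using s(2) power_coset_mem[OF s(1)] by simp
  show "r \<in> f n \<Longrightarrow> f n = ideal_power R \<mm> n +> r" using s power_coset_eq[OF s(1)] by simp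
qed

lemma completion_mono:
  assumes "f \<in> carrier C" "n \<le> n'"
  shows "f n' \<subseteq> f n"
  using lift_Suc_antimono_le[of f n n'] assms by (auto simp: completion_carrier)

lemma completion_mult_coset:
  assumes "f \<in> carrier C" "g \<in> carrier C" "r \<in> f n" "r' \<in> g n"
  shows "(f \<otimes>\<^bsub>C\<^esub> g) n = ideal_power R \<mm> n +> (r \<otimes> r')"
    and "(f \<oplus>\<^bsub>C\<^esub> g) n = ideal_power R \<mm> n +> (r \<oplus> r')"
proof -
  interpret P: ideal "ideal_power R \<mm> n" R by (rule power_ideal)
  have "r \<in> carrier R" "r' \<in> carrier R" "f n = ideal_power R \<mm> n +> r" "g n = ideal_power R \<mm> n +> r'"
    using assms completion_rep(2,3) by blast+
  then show "(f \<otimes>\<^bsub>C\<^esub> g) n = ideal_power R \<mm> n +> (r \<otimes> r')" "(f \<oplus>\<^bsub>C\<^esub> g) n = ideal_power R \<mm> n +> (r \<oplus> r')"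
    by (simp_all add: adic_completion_def Let_def FactRing_def P.rcoset_mult_add P.a_rcos_sum)
qed

lemma completion_of_reps:
  assumes r: "\<And>n. r n \<in> carrier R" "\<And>n. r (Suc n) \<ominus> r n \<in> ideal_power R \<mm> n"
  shows "(\<lambda>n. ideal_power R \<mm> n +> r n) \<in> carrier C"
  unfolding completion_carrier
proof (intro allI conjI bexI)
  fix n
  interpret P: ideal "ideal_power R \<mm> n" R by (rule power_ideal)
  show "ideal_power R \<mm> (Suc n) +> r (Suc n) \<subseteq> ideal_power R \<mm> n +> r n"
  proof
    fix s assume "s \<in> ideal_power R \<mm> (Suc n) +> r (Suc n)"
    then have s: "s \<in> carrier R" "s \<ominus> r (Suc n) \<in> ideal_power R \<mm> n"
      using power_coset_mem[OF r(1)] ideal_power_Suc_subset[OF maximal_ideal] by blast+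
    have "s \<ominus> r n = (s \<ominus> r (Suc n)) \<oplus> (r (Suc n) \<ominus> r n)" using s(1) r(1)[of n] r(1)[of "Suc n"] by algebra
    then have "s \<ominus> r n \<in> ideal_power R \<mm> n" using s(2) r(2) by simp
    then show "s \<in> ideal_power R \<mm> n +> r n" using power_coset_mem[OF r(1)] s(1) by blast
  qed
qed (use r in auto)

lemma completion_op_closed:
  assumes "f \<in> carrier C" "g \<in> carrier C"
  shows "f \<otimes>\<^bsub>C\<^esub> g \<in> carrier C" "f \<oplus>\<^bsub>C\<^esub> g \<in> carrier C"
proof -
  obtain r where r: "\<And>n. r n \<in> f n" using completion_rep(1)[OF assms(1)] by metis
  obtain r' where r': "\<And>n. r' n \<in> g n" using completion_rep(1)[OF assms(2)] by metis
  have rc: "r n \<in> carrier R" "r' n \<in> carrier R" for n using r r' completion_rep(2) assms by blast+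
  have d: "r (Suc n) \<ominus> r n \<in> ideal_power R \<mm> n" for n
    using r[of "Suc n"] completion_mono[OF assms(1), of n "Suc n"] completion_rep(3)[OF assms(1) r[of n]]
      power_coset_mem[OF rc(1)] by auto
  have d': "r' (Suc n) \<ominus> r' n \<in> ideal_power R \<mm> n" for n
    using r'[of "Suc n"] completion_mono[OF assms(2), of n "Suc n"] completion_rep(3)[OF assms(2) r'[of n]]
      power_coset_mem[OF rc(2)] by auto
  have "f \<otimes>\<^bsub>C\<^esub> g = (\<lambda>n. ideal_power R \<mm> n +> (r n \<otimes> r' n))" "f \<oplus>\<^bsub>C\<^esub> g = (\<lambda>n. ideal_power R \<mm> n +> (r n \<oplus> r' n))"
    using completion_mult_coset[OF assms r r'] by auto
  moreover have "(\<lambda>n. ideal_power R \<mm> n +> (r n \<otimes> r' n)) \<in> carrier C"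
  proof (rule completion_of_reps)
    fix n
    interpret P: ideal "ideal_power R \<mm> n" R by (rule power_ideal)
    have "r (Suc n) \<otimes> r' (Suc n) \<ominus> r n \<otimes> r' n =
        (r (Suc n) \<ominus> r n) \<otimes> r' (Suc n) \<oplus> r n \<otimes> (r' (Suc n) \<ominus> r' n)"
      using rc[of n] rc[of "Suc n"] by algebra
    also have "\<dots> \<in> ideal_power R \<mm> n"
      using P.I_r_closed[OF d rc(2)] P.I_l_closed[OF d' rc(1)] by (intro P.a_closed)
    finally show "r (Suc n) \<otimes> r' (Suc n) \<ominus> r n \<otimes> r' n \<in> ideal_power R \<mm> n" .
  qed (use rc in simp)
  moreover have "(\<lambda>n. ideal_power R \<mm> n +> (r n \<oplus> r' n)) \<in> carrier C"
  proof (rule completion_of_reps)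
    fix n
    interpret P: ideal "ideal_power R \<mm> n" R by (rule power_ideal)
    have "(r (Suc n) \<oplus> r' (Suc n)) \<ominus> (r n \<oplus> r' n) = (r (Suc n) \<ominus> r n) \<oplus> (r' (Suc n) \<ominus> r' n)"
      using rc[of n] rc[of "Suc n"] by algebra
    also have "\<dots> \<in> ideal_power R \<mm> n" using d d' by (intro P.a_closed)
    finally show "(r (Suc n) \<oplus> r' (Suc n)) \<ominus> (r n \<oplus> r' n) \<in> ideal_power R \<mm> n" .
  qed (use rc in simp)
  ultimately show "f \<otimes>\<^bsub>C\<^esub> g \<in> carrier C" "f \<oplus>\<^bsub>C\<^esub> g \<in> carrier C" by simp_all
qed

text \<open>The coefficients of the successive differences of \<open>f\<close> sum up to Cauchy sequences.\<close>

lemma completion_max_generators: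
  assumes y: "y \<in> {..<e} \<rightarrow> \<mm>"
    and gen: "\<And>u. u \<in> \<mm> \<Longrightarrow> \<exists>c\<in>{..<e} \<rightarrow> carrier R. u = (\<Oplus>i\<in>{..<e::nat}. c i \<otimes> y i)"
    and f: "f \<in> carrier C" "f 1 \<subseteq> \<mm>"
  shows "\<exists>g. (\<forall>i<e. (\<lambda>n. ideal_power R \<mm> n +> g i n) \<in> carrier C \<and> (\<forall>n. g i n \<in> carrier R)) \<and>
     (\<forall>n. (\<Oplus>i\<in>{..<e}. g i n \<otimes> y i) \<in> f n)"
proof -
  obtain r where r: "\<And>n. r n \<in> f n" using completion_rep(1)[OF f(1)] by metis
  have rc: "r n \<in> carrier R" for n using r completion_rep(2)[OF f(1)] by blast
  have yc: "y i \<in> carrier R" if "i < e" for i using y that ideal.Icarr[OF maximal_ideal] by auto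
  \<comment> \<open>One index is spent on the generators: a difference in \<mm>^(n+1) has
    coefficients in \<mm>^n. Hence the partial sums \<open>g i n\<close> produce
    \<open>r (Suc n)\<close> and not \<open>r n\<close>, which still lies in
    \<open>f n\<close>.\<close>
  have d: "r (Suc (Suc n)) \<ominus> r (Suc n) \<in> ideal_power R \<mm> n \<cdot>\<^bsub>R\<^esub> \<mm>" for n
  proof -
    have "r (Suc (Suc n)) \<in> f (Suc n)"
      using r[of "Suc (Suc n)"] completion_mono[OF f(1), of "Suc n" "Suc (Suc n)"] by auto
    then have "r (Suc (Suc n)) \<in> ideal_power R \<mm> (Suc n) +> r (Suc n)"
      using completion_rep(3)[OF f(1) r[of "Suc n"]] by simp
    then show ?thesis using power_coset_mem[OF rc[of "Suc n"], of _ "Suc n"] by simp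
  qed
  have "\<forall>n. \<exists>c\<in>{..<e} \<rightarrow> ideal_power R \<mm> n. r (Suc (Suc n)) \<ominus> r (Suc n) = (\<Oplus>i\<in>{..<e}. c i \<otimes> y i)"
    using ideal_prod_max_generators[OF power_ideal y gen d] by blast
  then obtain c where c: "\<And>n. c n \<in> {..<e} \<rightarrow> ideal_power R \<mm> n"
    "\<And>n. r (Suc (Suc n)) \<ominus> r (Suc n) = (\<Oplus>i\<in>{..<e}. c n i \<otimes> y i)" by metis
  obtain c0 where c0: "c0 \<in> {..<e} \<rightarrow> carrier R" "r 1 = (\<Oplus>i\<in>{..<e}. c0 i \<otimes> y i)"
    using gen[of "r 1"] r[of 1] f(2) by blast
  define g where "g i = rec_nat (c0 i) (\<lambda>n v. v \<oplus> c n i)" for i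
  have g0: "g i 0 = c0 i" and gS: "g i (Suc n) = g i n \<oplus> c n i" for i n by (simp_all add: g_def)
  have cc: "c n i \<in> carrier R" if "i < e" for n i using c(1)[of n] that ideal.Icarr[OF power_ideal] by auto
  have gc: "g i n \<in> carrier R" if "i < e" for i n
    using c0(1) cc that by (induct n) (auto simp: g0 gS)
  have "(\<lambda>n. ideal_power R \<mm> n +> g i n) \<in> carrier C" if i: "i < e" for i
  proof (rule completion_of_reps)
    fix n
    have "g i (Suc n) \<ominus> g i n = c n i" unfolding gS using gc[OF i] cc[OF i] by algebra
    then show "g i (Suc n) \<ominus> g i n \<in> ideal_power R \<mm> n" using c(1)[of n] i by auto
  qed (rule gc[OF i])
  moreover have s: "(\<Oplus>i\<in>{..<e}. g i n \<otimes> y i) = r (Suc n)" for n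
  proof (induct n)
    case 0
    have "(\<Oplus>i\<in>{..<e}. g i 0 \<otimes> y i) = (\<Oplus>i\<in>{..<e}. c0 i \<otimes> y i)" by (simp add: g0)
    then show ?case using c0(2) by simp
  next
    case (Suc n)
    have "(\<Oplus>i\<in>{..<e}. g i (Suc n) \<otimes> y i) = (\<Oplus>i\<in>{..<e}. g i n \<otimes> y i \<oplus> c n i \<otimes> y i)"
      using gc cc yc by (intro finsum_cong') (auto simp: gS l_distr)
    also have "\<dots> = (\<Oplus>i\<in>{..<e}. g i n \<otimes> y i) \<oplus> (\<Oplus>i\<in>{..<e}. c n i \<otimes> y i)"
      using gc cc yc by (intro finsum_addf) auto
    also have "\<dots> = r (Suc n) \<oplus> (r (Suc (Suc n)) \<ominus> r (Suc n))" by (simp only: Suc c(2))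
    also have "\<dots> = r (Suc (Suc n))" using rc[of "Suc n"] rc[of "Suc (Suc n)"] by algebra
    finally show ?case .
  qed
  moreover have "r (Suc n) \<in> f n" for n using r[of "Suc n"] completion_mono[OF f(1), of n "Suc n"] by auto
  ultimately show ?thesis using gc by (intro exI[of _ g]) simp
qed

end

section \<open>The map from \<open>S\<close> onto the completion, level by level\<close>

locale completion_presentation = R: noetherian_local_ring R \<mm> + S: noetherian_local_ring S \<nn>
  for R :: "('a, 'b) ring_scheme" (structure) and \<mm> and S :: "('s, 't) ring_scheme" and \<nn> +
  fixes I h
  assumes I: "ideal I S"
    and h: "h \<in> ring_iso (adic_completion R \<mm>) (S Quot I)"
begin

text \<open>The map from \<open>S\<close> onto the completion, through S/I and the inverse of
  \<open>h\<close>. That its kernel is \<open>I\<close> is the content of \<open>rep_ideal\<close>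
  and \<open>rep_separated\<close>.\<close>

definition psi :: "'s \<Rightarrow> nat \<Rightarrow> 'a set" where
  "psi s = inv_into (carrier R.C) h (I +>\<^bsub>S\<^esub> s)"

text \<open>\<open>r\<close> and \<open>s\<close> have the same image in \<open>R/\<mm>\<^sup>n\<close>.\<close>

definition rep :: "nat \<Rightarrow> 's \<Rightarrow> 'a \<Rightarrow> bool" where
  "rep n s r \<longleftrightarrow> r \<in> psi s n"

lemma quot_carrier: "s \<in> carrier S \<Longrightarrow> I +>\<^bsub>S\<^esub> s \<in> carrier (S Quot I)"
  by (auto simp: FactRing_def A_RCOSETS_def')

lemma h_bij: "bij_betw h (carrier R.C) (carrier (S Quot I))"
  and h_mult: "f \<in> carrier R.C \<Longrightarrow> g \<in> carrier R.C \<Longrightarrow> h (f \<otimes>\<^bsub>R.C\<^esub> g) = h f \<otimes>\<^bsub>S Quot I\<^esub> h g"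
  and h_add: "f \<in> carrier R.C \<Longrightarrow> g \<in> carrier R.C \<Longrightarrow> h (f \<oplus>\<^bsub>R.C\<^esub> g) = h f \<oplus>\<^bsub>S Quot I\<^esub> h g"
  and h_one: "h \<one>\<^bsub>R.C\<^esub> = \<one>\<^bsub>S Quot I\<^esub>"
  using h by (auto simp: ring_iso_def ring_hom_def)

lemma psi_carrier: "s \<in> carrier S \<Longrightarrow> psi s \<in> carrier R.C"
  and h_psi: "s \<in> carrier S \<Longrightarrow> h (psi s) = I +>\<^bsub>S\<^esub> s"
  using quot_carrier[of s] h_bij unfolding psi_def bij_betw_def
  by (metis inv_into_into) (metis f_inv_into_f quot_carrier h_bij bij_betw_def)

lemma psi_eqI: "f \<in> carrier R.C \<Longrightarrow> h f = I +>\<^bsub>S\<^esub> s \<Longrightarrow> psi s = f"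
  using h_bij unfolding psi_def bij_betw_def by (metis inv_into_f_f)

lemma psi_mult: "s \<in> carrier S \<Longrightarrow> s' \<in> carrier S \<Longrightarrow> psi (s \<otimes>\<^bsub>S\<^esub> s') = psi s \<otimes>\<^bsub>R.C\<^esub> psi s'"
  by (rule psi_eqI)
    (simp_all add: R.completion_op_closed psi_carrier h_mult h_psi FactRing_def ideal.rcoset_mult_add[OF I])

lemma psi_add: "s \<in> carrier S \<Longrightarrow> s' \<in> carrier S \<Longrightarrow> psi (s \<oplus>\<^bsub>S\<^esub> s') = psi s \<oplus>\<^bsub>R.C\<^esub> psi s'"
  by (rule psi_eqI)
    (simp_all add: R.completion_op_closed psi_carrier h_add h_psi FactRing_def ideal.a_rcos_sum[OF I])

lemma psi_surj:
  assumes "f \<in> carrier R.C" shows "\<exists>s\<in>carrier S. psi s = f"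
proof -
  have "h f \<in> carrier (S Quot I)" using assms h_bij by (auto simp: bij_betw_def)
  then obtain s where "s \<in> carrier S" "h f = I +>\<^bsub>S\<^esub> s" by (auto simp: FactRing_def A_RCOSETS_def')
  then show ?thesis using psi_eqI[OF assms] by blast
qed

lemma rep_carrier: "s \<in> carrier S \<Longrightarrow> rep n s r \<Longrightarrow> r \<in> carrier R"
  unfolding rep_def using R.completion_rep(2)[OF psi_carrier] .

lemma rep_total: "s \<in> carrier S \<Longrightarrow> \<exists>r\<in>carrier R. rep n s r"
  unfolding rep_def using R.completion_rep(1)[OF psi_carrier] .

lemma rep_iff:
  assumes "s \<in> carrier S" "rep n s r"
  shows "rep n s r' \<longleftrightarrow> r' \<in> carrier R \<and> r' \<ominus> r \<in> ideal_power R \<mm> n"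
proof -
  have "psi s n = ideal_power R \<mm> n +> r"
    using R.completion_rep(3)[OF psi_carrier[OF assms(1)]] assms(2) unfolding rep_def .
  then show ?thesis using R.power_coset_mem[OF rep_carrier[OF assms]] by (simp add: rep_def)
qed

lemma rep_mono: "s \<in> carrier S \<Longrightarrow> rep n' s r \<Longrightarrow> n \<le> n' \<Longrightarrow> rep n s r"
  unfolding rep_def using R.completion_mono[OF psi_carrier] by blast

lemma rep_mult_add:
  assumes "s \<in> carrier S" "s' \<in> carrier S" "rep n s r" "rep n s' r'"
  shows "rep n (s \<otimes>\<^bsub>S\<^esub> s') (r \<otimes> r')" "rep n (s \<oplus>\<^bsub>S\<^esub> s') (r \<oplus> r')"
proof -
  interpret P: ideal "ideal_power R \<mm> n" R by (rule R.power_ideal)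
  have c: "r \<in> carrier R" "r' \<in> carrier R" using rep_carrier assms by blast+
  show "rep n (s \<otimes>\<^bsub>S\<^esub> s') (r \<otimes> r')" "rep n (s \<oplus>\<^bsub>S\<^esub> s') (r \<oplus> r')"
    using R.completion_mult_coset[OF psi_carrier[OF assms(1)] psi_carrier[OF assms(2)], of r n r'] assms c
      P.a_rcos_self[of "r \<otimes> r'"] P.a_rcos_self[of "r \<oplus> r'"]
    by (simp_all add: rep_def psi_mult psi_add)
qed

text \<open>The constant sequence of an element of \<open>R\<close> lies in the completion, and
  \<open>psi\<close> is onto. So elements of \<open>R\<close> lift to \<open>S\<close> without any
  error.\<close>

lemma rep_const:
  assumes "r \<in> carrier R"
  shows "\<exists>s\<in>carrier S. \<forall>n. rep n s r"
proof -
  have "(\<lambda>n. ideal_power R \<mm> n +> r) \<in> carrier R.C"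
    using assms additive_subgroup.zero_closed[OF ideal.axioms(1)[OF R.power_ideal]]
    by (intro R.completion_of_reps) (simp_all add: R.minus_eq R.r_neg)
  from psi_surj[OF this] obtain s where s: "s \<in> carrier S" "psi s = (\<lambda>n. ideal_power R \<mm> n +> r)" by blast
  have "rep n s r" for n
    unfolding rep_def s(2)
    using R.power_coset_mem[OF assms] assms additive_subgroup.zero_closed[OF ideal.axioms(1)[OF R.power_ideal]]
    by (simp add: R.minus_eq R.r_neg)
  then show ?thesis using s(1) by blast
qed

text \<open>\<open>ring_iso\<close> speaks of sums, products and one only. The image of zero is
  recognized as an element of S/I that equals its own double.\<close>

lemma psi_zero: "psi \<zero>\<^bsub>S\<^esub> = (\<lambda>n. ideal_power R \<mm> n)"
proof (rule psi_eqI)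
  let ?z = "\<lambda>n. ideal_power R \<mm> n"
  have z: "?z = (\<lambda>n. ideal_power R \<mm> n +> \<zero>)"
  proof
    fix n interpret P: ideal "ideal_power R \<mm> n" R by (rule R.power_ideal)
    show "?z n = ideal_power R \<mm> n +> \<zero>" using P.a_rcos_const[OF P.zero_closed] by simp
  qed
  have zn: "\<zero> \<in> ?z n" for n using additive_subgroup.zero_closed[OF ideal.axioms(1)[OF R.power_ideal]] .
  have "(\<lambda>n. ideal_power R \<mm> n +> \<zero>) \<in> carrier R.C"
    using zn by (intro R.completion_of_reps) (simp_all add: R.minus_eq R.r_neg)
  then show zc: "?z \<in> carrier R.C" by (rule ssubst[OF z])
  have "?z \<oplus>\<^bsub>R.C\<^esub> ?z = ?z"
  proof
    fix n show "(?z \<oplus>\<^bsub>R.C\<^esub> ?z) n = ?z n"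
      using R.completion_mult_coset(2)[OF zc zc zn zn, of n] fun_cong[OF z, of n] by simp
  qed
  then have "h ?z \<oplus>\<^bsub>S Quot I\<^esub> h ?z = h ?z" using h_add[OF zc zc] by simp
  moreover interpret Q: ring "S Quot I" by (rule ideal.quotient_is_ring[OF I])
  have "h ?z \<in> carrier (S Quot I)" using zc h_bij by (auto simp: bij_betw_def)
  ultimately have "h ?z = \<zero>\<^bsub>S Quot I\<^esub>" by (simp add: Q.add.l_cancel_one')
  then show "h ?z = I +>\<^bsub>S\<^esub> \<zero>\<^bsub>S\<^esub>"
    using S.a_rcos_zero[OF I] additive_subgroup.zero_closed[OF ideal.axioms(1)[OF I]] by (simp add: FactRing_def)
qed

lemma rep_zero: "rep n \<zero>\<^bsub>S\<^esub> \<zero>"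
  unfolding rep_def psi_zero using additive_subgroup.zero_closed[OF ideal.axioms(1)[OF R.power_ideal]] .

lemma rep_ideal:
  assumes "s \<in> I" shows "rep n s \<zero>"
proof -
  have "I +>\<^bsub>S\<^esub> s = I +>\<^bsub>S\<^esub> \<zero>\<^bsub>S\<^esub>"
    using S.a_rcos_zero[OF I] assms additive_subgroup.zero_closed[OF ideal.axioms(1)[OF I]] by simp
  then have "psi s = psi \<zero>\<^bsub>S\<^esub>" by (simp add: psi_def)
  then show ?thesis using rep_zero by (simp add: rep_def)
qed

text \<open>An element of the inverse limit is determined by its levels, so an element that vanishes
  at all levels vanishes in S/I.\<close>

lemma rep_separated:
  assumes s: "s \<in> carrier S" and z: "\<And>n. rep n s \<zero>"
  shows "s \<in> I"
proof -
  have "psi s = psi \<zero>\<^bsub>S\<^esub>"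
  proof
    fix n interpret P: ideal "ideal_power R \<mm> n" R by (rule R.power_ideal)
    show "psi s n = psi \<zero>\<^bsub>S\<^esub> n"
      using R.completion_rep(3)[OF psi_carrier[OF s], of \<zero> n] z[of n] P.a_rcos_const[OF P.zero_closed]
      by (simp add: rep_def psi_zero)
  qed
  then have "I +>\<^bsub>S\<^esub> s = I +>\<^bsub>S\<^esub> \<zero>\<^bsub>S\<^esub>" using h_psi[OF s] h_psi[OF S.zero_closed] by simp
  then have "I +>\<^bsub>S\<^esub> s = I"
    using S.a_rcos_zero[OF I] additive_subgroup.zero_closed[OF ideal.axioms(1)[OF I]] by simp
  then show ?thesis using ideal.rcos_const_imp_mem[OF I s] by simp
qed

lemma rep_one: "rep n \<one>\<^bsub>S\<^esub> \<one>"
proof -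
  have oc: "\<one>\<^bsub>R.C\<^esub> = (\<lambda>n. ideal_power R \<mm> n +> \<one>)" by (simp add: adic_completion_def Let_def FactRing_def)
  have z: "\<zero> \<in> ideal_power R \<mm> n" for n using additive_subgroup.zero_closed[OF ideal.axioms(1)[OF R.power_ideal]] .
  have "(\<lambda>n. ideal_power R \<mm> n +> \<one>) \<in> carrier R.C"
    using z by (intro R.completion_of_reps) (simp_all add: R.minus_eq R.r_neg)
  then have "psi \<one>\<^bsub>S\<^esub> = (\<lambda>n. ideal_power R \<mm> n +> \<one>)"
    using h_one unfolding oc by (intro psi_eqI) (simp_all add: FactRing_def)
  then show ?thesis unfolding rep_def using R.power_coset_mem[of \<one> \<one> n] z[of n] by (simp add: R.minus_eq R.r_neg)
qed

lemma rep_neg: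
  assumes "s \<in> carrier S" "rep n s r" shows "rep n (\<ominus>\<^bsub>S\<^esub> s) (\<ominus> r)"
proof -
  have rc: "r \<in> carrier R" using rep_carrier assms .
  obtain r' where r': "r' \<in> carrier R" "rep n (\<ominus>\<^bsub>S\<^esub> s) r'" using rep_total[of "\<ominus>\<^bsub>S\<^esub> s" n] assms(1) by blast
  have "rep n \<zero>\<^bsub>S\<^esub> (r \<oplus> r')" using rep_mult_add(2)[OF assms(1) _ assms(2) r'(2)] assms(1) by (simp add: S.r_neg)
  then have "(r \<oplus> r') \<ominus> \<zero> \<in> ideal_power R \<mm> n" using rep_iff[OF _ rep_zero] by simp
  then have "\<ominus> ((r \<oplus> r') \<ominus> \<zero>) \<in> ideal_power R \<mm> n"
    using additive_subgroup.a_inv_closed[OF ideal.axioms(1)[OF R.power_ideal]] by blast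
  moreover have "\<ominus> ((r \<oplus> r') \<ominus> \<zero>) = (\<ominus> r) \<ominus> r'" using rc r'(1) by algebra
  ultimately show ?thesis using rep_iff[OF _ r'(2)] assms(1) rc by simp
qed

lemma rep_sum:
  assumes "c \<in> {..<n::nat} \<rightarrow> carrier S" "x \<in> {..<n} \<rightarrow> carrier S" "\<And>i. i < n \<Longrightarrow> rep k (c i) (r i)" "\<And>i. i < n \<Longrightarrow> rep k (x i) (y i)"
  shows "rep k (\<Oplus>\<^bsub>S\<^esub>i\<in>{..<n}. c i \<otimes>\<^bsub>S\<^esub> x i) (\<Oplus>i\<in>{..<n}. r i \<otimes> y i)"
  using assms
proof (induct n)
  case (Suc n)
  have c: "c i \<in> carrier S" and x: "x i \<in> carrier S" if "i < Suc n" for i using Suc(2,3) that by auto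
  have r: "r i \<in> carrier R" and y: "y i \<in> carrier R" if "i < Suc n" for i
    using rep_carrier[OF c] rep_carrier[OF x] Suc(4,5) that by blast+
  have "rep k (\<Oplus>\<^bsub>S\<^esub>i\<in>{..<n}. c i \<otimes>\<^bsub>S\<^esub> x i) (\<Oplus>i\<in>{..<n}. r i \<otimes> y i)"
    using Suc(1,4,5) c x by (simp add: Pi_def)
  moreover have "rep k (c n \<otimes>\<^bsub>S\<^esub> x n) (r n \<otimes> y n)" using Suc(4,5)[of n] c x by (intro rep_mult_add) auto
  moreover have "(\<Oplus>\<^bsub>S\<^esub>i\<in>{..<n}. c i \<otimes>\<^bsub>S\<^esub> x i) \<in> carrier S" using c x by (intro S.finsum_closed) auto
  moreover have "c n \<otimes>\<^bsub>S\<^esub> x n \<in> carrier S" using c x by simp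
  ultimately have "rep k ((\<Oplus>\<^bsub>S\<^esub>i\<in>{..<n}. c i \<otimes>\<^bsub>S\<^esub> x i) \<oplus>\<^bsub>S\<^esub> c n \<otimes>\<^bsub>S\<^esub> x n) ((\<Oplus>i\<in>{..<n}. r i \<otimes> y i) \<oplus> r n \<otimes> y n)"
    using rep_mult_add(2) by blast
  moreover have "(\<Oplus>\<^bsub>S\<^esub>i\<in>{..<Suc n}. c i \<otimes>\<^bsub>S\<^esub> x i) = (\<Oplus>\<^bsub>S\<^esub>i\<in>{..<n}. c i \<otimes>\<^bsub>S\<^esub> x i) \<oplus>\<^bsub>S\<^esub> c n \<otimes>\<^bsub>S\<^esub> x n"
    using c x by (intro S.finsum_lessThan_Suc) auto
  moreover have "(\<Oplus>i\<in>{..<Suc n}. r i \<otimes> y i) = (\<Oplus>i\<in>{..<n}. r i \<otimes> y i) \<oplus> r n \<otimes> y n"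
    using r y by (intro R.finsum_lessThan_Suc) auto
  ultimately show ?case by simp
qed (simp add: rep_zero)

text \<open>Level 0 is excluded because R/\<mm>^0 is the zero ring. The elements of \<open>S\<close>
  that vanish at level 1 form a proper ideal, hence lie in \<nn>; this gives one direction. If
  \<open>r\<close> were a unit, a lift s' of its inverse would make 1 - s' s vanish at level 1, and
  \<open>s\<close> in \<nn> would put 1 into \<nn>.\<close>

lemma rep_max:
  assumes s: "s \<in> carrier S" and r: "rep (Suc n) s r"
  shows "s \<in> \<nn> \<longleftrightarrow> r \<in> \<mm>"
proof -
  interpret m: ideal \<mm> R by (rule R.maximal_ideal)
  interpret n: ideal \<nn> S by (rule S.maximal_ideal)
  have p1: "ideal_power R \<mm> 1 = \<mm>" by (rule R.ideal_power_1)
  define K where "K = {s \<in> carrier S. rep 1 s \<zero>}"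
  have "ideal K S"
  proof (rule S.ideal_criterion)
    show "K \<subseteq> carrier S" by (auto simp: K_def)
    show "\<zero>\<^bsub>S\<^esub> \<in> K" by (simp add: K_def rep_zero)
    fix a b assume "a \<in> K" "b \<in> K"
    then show "a \<oplus>\<^bsub>S\<^esub> b \<in> K" using rep_mult_add(2)[of a b 1 \<zero> \<zero>] by (simp add: K_def)
  next
    fix a b assume "a \<in> K" and b: "b \<in> carrier S"
    then have a: "a \<in> carrier S" "rep 1 a \<zero>" by (simp_all add: K_def)
    obtain t where t: "t \<in> carrier R" "rep 1 b t" using rep_total[OF b] by blast
    then show "b \<otimes>\<^bsub>S\<^esub> a \<in> K" using rep_mult_add(1)[OF b a(1) t(2) a(2)] a b by (simp add: K_def)
  qed
  moreover have "K \<noteq> carrier S"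
  proof
    assume "K = carrier S"
    then have "\<one>\<^bsub>S\<^esub> \<in> K" by simp
    then have "rep 1 \<one>\<^bsub>S\<^esub> \<zero>" by (simp add: K_def)
    then have "\<one> \<ominus> \<zero> \<in> \<mm>" using rep_iff[of "\<one>\<^bsub>S\<^esub>" 1 \<zero> \<one>] rep_one[of 1] p1 by simp
    then show False using R.one_notin_maximal by (simp add: R.minus_eq)
  qed
  ultimately have Kn: "K \<subseteq> \<nn>" by (rule S.proper_ideal_subset_maximal)
  have r1: "rep 1 s r" using rep_mono[OF s r] by simp
  have rc: "r \<in> carrier R" using rep_carrier[OF s r] .
  show ?thesis
  proof
    assume "r \<in> \<mm>"
    then have "rep 1 s \<zero>" using rep_iff[OF s r1, of \<zero>] p1 rc by (simp add: R.minus_eq)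
    then show "s \<in> \<nn>" using Kn s by (auto simp: K_def)
  next
    assume sn: "s \<in> \<nn>"
    show "r \<in> \<mm>"
    proof (rule ccontr)
      assume "r \<notin> \<mm>"
      then obtain u where u: "u \<in> carrier R" "u \<otimes> r = \<one>" using R.unit_if_notin_maximal[OF rc] by blast
      obtain s' where s': "s' \<in> carrier S" "\<forall>n. rep n s' u" using rep_const[OF u(1)] by blast
      have us: "rep 1 (s' \<otimes>\<^bsub>S\<^esub> s) \<one>" using rep_mult_add(1)[OF s'(1) s _ r1] s'(2) u(2) by metis
      have ss: "s' \<otimes>\<^bsub>S\<^esub> s \<in> carrier S" using s' s by simp
      have "rep 1 (\<one>\<^bsub>S\<^esub> \<oplus>\<^bsub>S\<^esub> \<ominus>\<^bsub>S\<^esub> (s' \<otimes>\<^bsub>S\<^esub> s)) (\<one> \<oplus> \<ominus> \<one>)"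
        using ss rep_neg[OF ss us] rep_one by (intro rep_mult_add(2)) auto
      then have "\<one>\<^bsub>S\<^esub> \<oplus>\<^bsub>S\<^esub> \<ominus>\<^bsub>S\<^esub> (s' \<otimes>\<^bsub>S\<^esub> s) \<in> \<nn>" using Kn ss by (auto simp: K_def R.r_neg)
      moreover have "s' \<otimes>\<^bsub>S\<^esub> s \<in> \<nn>" using n.I_l_closed[OF sn s'(1)] .
      ultimately have "(\<one>\<^bsub>S\<^esub> \<oplus>\<^bsub>S\<^esub> \<ominus>\<^bsub>S\<^esub> (s' \<otimes>\<^bsub>S\<^esub> s)) \<oplus>\<^bsub>S\<^esub> (s' \<otimes>\<^bsub>S\<^esub> s) \<in> \<nn>" by (rule n.a_closed)
      moreover have "(\<one>\<^bsub>S\<^esub> \<oplus>\<^bsub>S\<^esub> \<ominus>\<^bsub>S\<^esub> (s' \<otimes>\<^bsub>S\<^esub> s)) \<oplus>\<^bsub>S\<^esub> (s' \<otimes>\<^bsub>S\<^esub> s) = \<one>\<^bsub>S\<^esub>"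
        using ss by (simp add: S.a_assoc S.l_neg)
      ultimately show False using S.one_notin_maximal by simp
    qed
  qed
qed

end

section \<open>The Burch index\<close>

context generator_cokernel begin

text \<open>The Koszul relations \<open>y\<^sub>n e\<^sub>l - y\<^sub>l e\<^sub>n\<close> are syzygies of \<open>y\<close>.\<close>

lemma koszul_combination_in:
  assumes B: "submodule B R (F e)"
    and syz: "\<And>p z. p \<in> \<mm> \<Longrightarrow> z \<in> carrier (F e) \<Longrightarrow> sy z = \<zero> \<Longrightarrow> p \<odot>\<^bsub>F e\<^esub> z \<in> B"
    and r: "\<And>i l. i < e \<Longrightarrow> l < e \<Longrightarrow> r i l \<in> \<mm>"
    and anti: "\<And>i l. i < e \<Longrightarrow> l < e \<Longrightarrow> r l i = \<ominus> r i l" and diag: "\<And>i. i < e \<Longrightarrow> r i i = \<zero>"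
  shows "(\<lambda>i\<in>{..<e}. \<Oplus>l\<in>{..<e}. r i l \<otimes> y l) \<in> B"
proof -
  interpret Fe: module R "F e" by (rule module_free)
  define k where "k l n = y n \<odot>\<^bsub>F e\<^esub> std_basis R e l \<oplus>\<^bsub>F e\<^esub> (\<ominus> y l) \<odot>\<^bsub>F e\<^esub> std_basis R e n" for l n
  have rc: "r i l \<in> carrier R" if "i < e" "l < e" for i l using r that max_carrier by blast
  have sb: "c \<odot>\<^bsub>F e\<^esub> std_basis R e l \<in> carrier (F e)" if "c \<in> carrier R" for c l
    using Fe.smult_closed[OF that std_basis_carrier] .
  have k: "k l n \<in> carrier (F e)" if "l < e" "n < e" for l n
    unfolding k_def using y_carrier that by (intro Fe.M.a_closed sb) auto
  have sy_std: "sy (std_basis R e l) = y l" if "l < e" for l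
  proof -
    have "sy (std_basis R e l) = (\<Oplus>i\<in>{..<e}. if l = i then y i else \<zero>)"
      unfolding sy_eq using y_carrier by (intro finsum_cong') (auto simp: std_basis_def)
    also have "\<dots> = y l" using that y_carrier by (intro finsum_singleton) auto
    finally show ?thesis .
  qed
  have sy_k: "sy (k l n) = \<zero>" if "l < e" "n < e" for l n
  proof -
    have "sy (k l n) = y n \<otimes> y l \<oplus> (\<ominus> y l) \<otimes> y n"
      unfolding k_def
      using mod_homD(2)[OF sy_hom sb sb] mod_homD(3)[OF sy_hom _ std_basis_carrier] y_carrier that sy_std
      by simp
    also have "\<dots> = \<zero>" using y_carrier[OF that(1)] y_carrier[OF that(2)] by algebra
    finally show ?thesis .
  qed
  have k_coord: "k l n i = (if i = l then y n else if i = n then \<ominus> y l else \<zero>)"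
    if "l < n" "n < e" "i < e" for l n i
    using that y_carrier by (auto simp: k_def std_basis_def)
  \<comment> \<open>\<open>z n\<close> uses only the upper left n by n block of the matrix. Passing
    to \<open>Suc n\<close> adds row and column \<open>n\<close>, which antisymmetry and the zero
    diagonal turn into a combination of the relations \<open>k l n\<close> with coefficients in
    \<mm>.\<close>
  define z where "z n = (\<lambda>i\<in>{..<e}. if i < n then \<Oplus>l\<in>{..<n}. r i l \<otimes> y l else \<zero>)" for n
  have z: "z n \<in> carrier (F e)" if "n \<le> e" for n
    using rc y_carrier that by (auto simp: z_def intro!: finsum_closed)
  have "n \<le> e \<Longrightarrow> z n \<in> B" for n
  proof (induct n)
    case 0
    have "z 0 = \<zero>\<^bsub>F e\<^esub>" by (auto simp: z_def free_module_def intro!: restrict_ext)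
    then show ?case using Fe.submodule_zero_closed[OF B] by simp
  next
    case (Suc n)
    then have n: "n < e" by simp
    have kP: "(\<lambda>l. k l n) \<in> {..<n} \<rightarrow> carrier (F e)" using k n by auto
    have rP: "(\<lambda>l. r l n) \<in> {..<n} \<rightarrow> carrier R" using rc n by auto
    define w where "w = lin_comb (F e) n (\<lambda>l. k l n) (\<lambda>l. r l n)"
    have w: "w \<in> B" unfolding w_def
      by (rule Fe.lin_comb_submodule[OF B]) (use syz r k sy_k n in simp)
    have wc: "w \<in> carrier (F e)" unfolding w_def by (rule Fe.lin_comb_closed[OF kP rP])
    have "z (Suc n) = z n \<oplus>\<^bsub>F e\<^esub> w"
    proof (rule PiE_lessThan_ext)
      show "z (Suc n) \<in> {..<e} \<rightarrow>\<^sub>E carrier R" using z Suc(2) by simp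
      show "z n \<oplus>\<^bsub>F e\<^esub> w \<in> {..<e} \<rightarrow>\<^sub>E carrier R" using Fe.M.a_closed[OF z wc] n by simp
      fix i assume i: "i < e"
      have wi: "w i = (\<Oplus>l\<in>{..<n}. r l n \<otimes> k l n i)"
        unfolding w_def by (rule free_module_lin_comb_coord[OF kP rP i])
      consider "i < n" | "i = n" | "i > n" by linarith
      then show "z (Suc n) i = (z n \<oplus>\<^bsub>F e\<^esub> w) i"
      proof cases
        case 1
        have "w i = (\<Oplus>l\<in>{..<n}. if i = l then r l n \<otimes> y n else \<zero>)"
          unfolding wi using rc y_carrier n i 1 by (intro finsum_cong') (auto simp: k_coord)
        also have "\<dots> = r i n \<otimes> y n" using 1 rc y_carrier n by (intro finsum_singleton) auto
        finally have "w i = r i n \<otimes> y n" .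
        moreover have "(\<Oplus>l\<in>{..<Suc n}. r i l \<otimes> y l) = (\<Oplus>l\<in>{..<n}. r i l \<otimes> y l) \<oplus> r i n \<otimes> y n"
          using rc[OF i] y_carrier n by (intro finsum_lessThan_Suc) auto
        ultimately show ?thesis using i 1 by (simp add: z_def)
      next
        case 2
        have "w i = (\<Oplus>l\<in>{..<n}. r n l \<otimes> y l)"
          unfolding wi
        proof (rule finsum_cong')
          fix l assume "l \<in> {..<n}"
          then have l: "l < n" "l < e" using n by auto
          have "r l n \<otimes> k l n i = r l n \<otimes> (\<ominus> y l)" using k_coord[OF l(1) n i] l 2 by simp
          also have "\<dots> = r n l \<otimes> y l"
            using anti[OF l(2) n] rc[OF l(2) n] y_carrier[OF l(2)] by (simp add: l_minus r_minus)
          finally show "r l n \<otimes> k l n i = r n l \<otimes> y l" .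
        qed (use rc y_carrier n in auto)
        moreover have "(\<Oplus>l\<in>{..<Suc n}. r n l \<otimes> y l) = (\<Oplus>l\<in>{..<n}. r n l \<otimes> y l) \<oplus> r n n \<otimes> y n"
          using rc[OF n] y_carrier n by (intro finsum_lessThan_Suc) auto
        moreover have "(\<Oplus>l\<in>{..<n}. r n l \<otimes> y l) \<in> carrier R"
          using rc[OF n] y_carrier n by (intro finsum_closed) auto
        ultimately show ?thesis using i 2 diag[OF n] y_carrier[OF n] by (simp add: z_def)
      next
        case 3
        have "w i = (\<Oplus>l\<in>{..<n}. \<zero>)"
          unfolding wi using rc n i 3 by (intro finsum_cong') (auto simp: k_coord)
        then show ?thesis using i 3 by (simp add: z_def)
      qed
    qed
    then show ?case using Fe.submoduleE(5)[OF B Suc(1) w] n by simp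
  qed
  then have "z e \<in> B" by simp
  moreover have "z e = (\<lambda>i\<in>{..<e}. \<Oplus>l\<in>{..<e}. r i l \<otimes> y l)" by (auto simp: z_def intro!: restrict_ext)
  ultimately show ?thesis by simp
qed

end

text \<open>\<open>x\<close> lifts \<open>y\<close> at every level at once, so no error arises from
  the generators. The assumptions \<open>regular\<close> and \<open>I_sub\<close> express regularity
  of \<open>S\<close> and minimality of the presentation.\<close>

locale regular_presentation = completion_presentation R \<mm> S \<nn> I h + G: generator_cokernel R \<mm> e y
  for R :: "('a, 'b) ring_scheme" (structure) and \<mm> and S :: "('s, 't) ring_scheme" and \<nn> I h e y +
  fixes x :: "nat \<Rightarrow> 's"
  assumes regular: "krull_dim S = enat (dim_max_quot S \<nn> (ideal_power S \<nn> 2))"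
    and I_sub: "I \<subseteq> ideal_power S \<nn> 2"
    and x_carrier: "i < e \<Longrightarrow> x i \<in> carrier S"
    and x_rep: "i < e \<Longrightarrow> rep n (x i) (y i)"
begin

abbreviation "sx c \<equiv> (\<Oplus>\<^bsub>S\<^esub>i\<in>{..<e}. c i \<otimes>\<^bsub>S\<^esub> x i)"

abbreviation "nn \<equiv> \<nn> \<cdot>\<^bsub>S\<^esub> \<nn>"

sublocale In: ideal I S by (rule I)
sublocale nI: ideal \<nn> S by (rule S.maximal_ideal)
sublocale nn: ideal nn S by (rule S.ideal_prod_is_ideal[OF S.maximal_ideal S.maximal_ideal])

lemma power_2: "ideal_power S \<nn> 2 = nn" "ideal_power R \<mm> 2 = \<mm> \<cdot>\<^bsub>R\<^esub> \<mm>"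
  using S.ideal_power_1 R.ideal_power_1 by (simp_all add: numeral_2_eq_2)

lemma I_nn: "I \<subseteq> nn"
  using I_sub by (simp add: power_2)

lemma x_max: "i < e \<Longrightarrow> x i \<in> \<nn>"
  using rep_max[OF x_carrier x_rep] G.y_max by blast

lemma x_Pi: "x \<in> {..<e} \<rightarrow> carrier S"
  using x_carrier by blast

lemma sx_carrier: "c \<in> {..<e} \<rightarrow> carrier S \<Longrightarrow> sx c \<in> carrier S"
  using x_carrier by (intro S.finsum_closed) auto

lemma x_span_subset: "genideal S (x ` {..<e}) \<subseteq> \<nn>"
  using x_max by (intro S.genideal_minimal S.maximal_ideal) auto

text \<open>Coefficients for an element of \<nn> are found in the completion and lifted to
  \<open>S\<close>. The error lies in \<open>I\<close>, hence in \<nn>^2 because the presentation is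
  minimal, and Nakayama's lemma absorbs it.\<close>

lemma x_generates: "genideal S (x ` {..<e}) = \<nn>"
proof
  have sub: "x ` {..<e} \<subseteq> carrier S" using x_carrier by auto
  note span = S.genideal_image_lessThan[OF x_Pi]
  have id: "ideal (genideal S (x ` {..<e})) S" by (rule S.genideal_ideal[OF sub])
  have "\<nn> \<subseteq> genideal S (x ` {..<e}) <+>\<^bsub>S\<^esub> nn"
  proof
    fix u assume u: "u \<in> \<nn>"
    have uc: "u \<in> carrier S" using u by (rule nI.Icarr)
    have "psi u 1 \<subseteq> \<mm>"
    proof
      fix r assume "r \<in> psi u 1"
      then have "rep (Suc 0) u r" by (simp add: rep_def)
      then show "r \<in> \<mm>" using rep_max[OF uc] u by blast
    qed
    moreover have "y \<in> {..<e} \<rightarrow> \<mm>" using G.y_max by blast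
    ultimately have "\<exists>g. (\<forall>i<e. (\<lambda>n. ideal_power R \<mm> n +> g i n) \<in> carrier R.C \<and> (\<forall>n. g i n \<in> carrier R)) \<and>
        (\<forall>n. (\<Oplus>i\<in>{..<e}. g i n \<otimes> y i) \<in> psi u n)"
      using G.y_gen psi_carrier[OF uc] unfolding G.sy_eq by (intro R.completion_max_generators)
    then obtain g where "\<forall>i<e. (\<lambda>n. ideal_power R \<mm> n +> g i n) \<in> carrier R.C \<and> (\<forall>n. g i n \<in> carrier R)"
      and "\<forall>n. (\<Oplus>i\<in>{..<e}. g i n \<otimes> y i) \<in> psi u n" by (elim exE conjE)
    then have g: "\<And>i. i < e \<Longrightarrow> (\<lambda>n. ideal_power R \<mm> n +> g i n) \<in> carrier R.C"
      "\<And>i n. i < e \<Longrightarrow> g i n \<in> carrier R" "\<And>n. (\<Oplus>i\<in>{..<e}. g i n \<otimes> y i) \<in> psi u n" by simp_all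
    have "\<forall>i<e. \<exists>s\<in>carrier S. psi s = (\<lambda>n. ideal_power R \<mm> n +> g i n)" using psi_surj[OF g(1)] by blast
    then obtain s where s: "\<And>i. i < e \<Longrightarrow> s i \<in> carrier S"
      "\<And>i. i < e \<Longrightarrow> psi (s i) = (\<lambda>n. ideal_power R \<mm> n +> g i n)" by metis
    have srep: "rep n (s i) (g i n)" if "i < e" for i n
    proof -
      interpret P: ideal "ideal_power R \<mm> n" R by (rule R.power_ideal)
      show ?thesis unfolding rep_def s(2)[OF that] by (rule P.a_rcos_self[OF g(2)[OF that]])
    qed
    have sP: "s \<in> {..<e} \<rightarrow> carrier S" using s(1) by blast
    define v where "v = sx s"
    have vc: "v \<in> carrier S" unfolding v_def by (rule sx_carrier[OF sP])
    have vrep: "rep n v (\<Oplus>i\<in>{..<e}. g i n \<otimes> y i)" for n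
      unfolding v_def by (rule rep_sum[OF sP x_Pi srep x_rep])
    have "rep n (u \<oplus>\<^bsub>S\<^esub> \<ominus>\<^bsub>S\<^esub> v) \<zero>" for n
    proof -
      let ?r = "\<Oplus>i\<in>{..<e}. g i n \<otimes> y i"
      have "rep n (u \<oplus>\<^bsub>S\<^esub> \<ominus>\<^bsub>S\<^esub> v) (?r \<oplus> \<ominus> ?r)"
        using uc vc g(3)[of n] rep_neg[OF vc vrep] by (intro rep_mult_add(2)) (auto simp: rep_def)
      moreover have "?r \<in> carrier R" using rep_carrier[OF vc vrep] .
      ultimately show ?thesis by (simp add: R.r_neg)
    qed
    then have "u \<oplus>\<^bsub>S\<^esub> \<ominus>\<^bsub>S\<^esub> v \<in> I" using uc vc by (intro rep_separated) auto
    then have "u \<oplus>\<^bsub>S\<^esub> \<ominus>\<^bsub>S\<^esub> v \<in> nn" using I_nn by blast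
    moreover have "v \<in> genideal S (x ` {..<e})" unfolding span v_def using sP by blast
    moreover have "u = v \<oplus>\<^bsub>S\<^esub> (u \<oplus>\<^bsub>S\<^esub> \<ominus>\<^bsub>S\<^esub> v)" using uc vc by (simp add: S.a_lcomm S.r_neg)
    ultimately show "u \<in> genideal S (x ` {..<e}) <+>\<^bsub>S\<^esub> nn" unfolding S.ideal_add_mem by blast
  qed
  then show "\<nn> \<subseteq> genideal S (x ` {..<e})" by (rule S.nakayama[OF id S.maximal_ideal])
qed (rule x_span_subset)

lemma x_gen:
  assumes "u \<in> \<nn>" shows "\<exists>c\<in>{..<e} \<rightarrow> carrier S. u = sx c"
proof -
  have "u \<in> genideal S (x ` {..<e})" using assms by (simp only: x_generates)
  then obtain c where "c \<in> {..<e} \<rightarrow> carrier S" "u = sx c"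
    unfolding S.genideal_image_lessThan[OF x_Pi] by (elim CollectE exE conjE)
  then show ?thesis by (intro bexI)
qed

lemma x_gen_prod: "ideal A S \<Longrightarrow> u \<in> A \<cdot>\<^bsub>S\<^esub> \<nn> \<Longrightarrow> \<exists>c\<in>{..<e} \<rightarrow> A. u = sx c"
  by (rule S.ideal_prod_max_generators[of A x e u]) (use x_max x_gen in blast)+

lemma sx_in_prod:
  assumes "ideal A S" "c \<in> {..<e} \<rightarrow> A" shows "sx c \<in> A \<cdot>\<^bsub>S\<^esub> \<nn>"
  using assms(2) x_max
  by (intro S.ideal_finsum_closed[OF S.ideal_prod_is_ideal[OF assms(1) S.maximal_ideal]] ideal_prod.prod) auto

lemma rep_nn: "v \<in> nn \<Longrightarrow> \<exists>r\<in>\<mm> \<cdot>\<^bsub>R\<^esub> \<mm>. rep 2 v r"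
proof (induct rule: ideal_prod.induct)
  case (prod u v)
  have c: "u \<in> carrier S" "v \<in> carrier S" using prod by (auto intro: nI.Icarr)
  obtain r r' where r: "rep 2 u r" "rep 2 v r'" using rep_total[of u 2] rep_total[of v 2] c by blast
  have "r \<in> \<mm>" "r' \<in> \<mm>" using rep_max[of u 1 r] rep_max[of v 1 r'] r prod c by (simp_all add: numeral_2_eq_2)
  then show ?case by (intro bexI[of _ "r \<otimes> r'"] rep_mult_add(1)[OF c r] ideal_prod.prod)
next
  case (sum u v)
  then obtain r r' where r: "r \<in> \<mm> \<cdot>\<^bsub>R\<^esub> \<mm>" "r' \<in> \<mm> \<cdot>\<^bsub>R\<^esub> \<mm>" "rep 2 u r" "rep 2 v r'" by blast
  have c: "u \<in> carrier S" "v \<in> carrier S" using sum nn.Icarr by auto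
  show ?case by (intro bexI[of _ "r \<oplus> r'"] rep_mult_add(2)[OF c r(3,4)] ideal_prod.sum[OF r(1,2)])
qed

text \<open>At level 2 this becomes a statement about \<open>R\<close>: a combination of
  \<open>y\<close> that lies in \<mm>^2 has its coefficients in \<mm>, by minimality of
  \<open>y\<close>.\<close>

lemma x_independent:
  assumes c: "c \<in> {..<e} \<rightarrow> carrier S" and sum: "sx c \<in> nn" and i: "i < e"
  shows "c i \<in> \<nn>"
proof -
  have "\<forall>i<e. \<exists>r\<in>carrier R. rep 2 (c i) r" using rep_total c by auto
  then obtain r where r: "\<And>i. i < e \<Longrightarrow> r i \<in> carrier R" "\<And>i. i < e \<Longrightarrow> rep 2 (c i) (r i)" by metis
  have rP: "r \<in> {..<e} \<rightarrow> carrier R" using r(1) by blast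
  have "rep 2 (sx c) (G.sy r)" unfolding G.sy_eq by (rule rep_sum[OF c x_Pi r(2) x_rep])
  moreover obtain v where v: "v \<in> \<mm> \<cdot>\<^bsub>R\<^esub> \<mm>" "rep 2 (sx c) v"
    using rep_nn[OF sum] by (elim bexE)
  ultimately have "G.sy r \<ominus> v \<in> \<mm> \<cdot>\<^bsub>R\<^esub> \<mm>" using rep_iff[OF sx_carrier[OF c] v(2)] by (simp add: power_2)
  interpret mm: ideal "\<mm> \<cdot>\<^bsub>R\<^esub> \<mm>" R by (rule R.ideal_prod_is_ideal[OF R.maximal_ideal R.maximal_ideal])
  interpret m: ideal \<mm> R by (rule R.maximal_ideal)
  have vc: "v \<in> carrier R" using v(1) by (rule mm.Icarr)
  have src: "G.sy r \<in> carrier R" using m.Icarr[OF G.sy_max[OF rP]] .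
  have "(G.sy r \<ominus> v) \<oplus> v \<in> \<mm> \<cdot>\<^bsub>R\<^esub> \<mm>" using \<open>G.sy r \<ominus> v \<in> _\<close> v(1) by (rule mm.a_closed)
  moreover have "(G.sy r \<ominus> v) \<oplus> v = G.sy r" using src vc by algebra
  ultimately have "G.sy r \<in> \<mm> \<cdot>\<^bsub>R\<^esub> \<mm>" by simp
  then have "\<exists>p\<in>{..<e} \<rightarrow> \<mm>. G.sy r = (\<Oplus>i\<in>{..<e}. p i \<otimes> y i)"
    using G.y_max G.y_gen unfolding G.sy_eq
    by (intro R.ideal_prod_max_generators[OF R.maximal_ideal]) blast+
  then obtain p where p: "p \<in> {..<e} \<rightarrow> \<mm>" "G.sy r = (\<Oplus>i\<in>{..<e}. p i \<otimes> y i)" by (elim bexE)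
  have pP: "p \<in> {..<e} \<rightarrow> carrier R" using p(1) by (simp add: Pi_def m.Icarr)
  have "G.sy (\<lambda>i. r i \<ominus> p i) = \<zero>"
  proof -
    interpret L: module R "self_module R" by (rule R.module_self)
    have "G.sy (\<lambda>i. r i \<ominus> p i) = G.sy r \<ominus>\<^bsub>self_module R\<^esub> G.sy p"
      unfolding G.sy_def using G.y_carrier rP pP by (intro L.lin_comb_minus) auto
    also have "G.sy p = G.sy r" using p(2) by (simp add: G.sy_eq)
    also have "G.sy r \<ominus>\<^bsub>self_module R\<^esub> G.sy r = \<zero>" using L.M.r_neg[of "G.sy r"] src by (simp add: L.M.minus_eq)
    finally show ?thesis .
  qed
  moreover have "(\<lambda>i. r i \<ominus> p i) \<in> {..<e} \<rightarrow> carrier R" using r(1) pP by auto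
  ultimately have "r i \<ominus> p i \<in> \<mm>" using G.y_min i by blast
  moreover have "p i \<in> \<mm>" using p(1) i by auto
  ultimately have "(r i \<ominus> p i) \<oplus> p i \<in> \<mm>" by (rule m.a_closed)
  moreover have "(r i \<ominus> p i) \<oplus> p i = r i" using r(1)[OF i] m.Icarr[OF \<open>p i \<in> \<mm>\<close>] by algebra
  ultimately have "r i \<in> \<mm>" by simp
  then show ?thesis using rep_max[of "c i" 1 "r i"] r(2)[OF i] c i by (auto simp: numeral_2_eq_2)
qed

text \<open>Here regularity of \<open>S\<close> enters: the number of the generators
  \<open>x\<close> is the dimension of \<open>S\<close>, which makes them a regular
  sequence.\<close>

lemma krull_dim_eq: "krull_dim S = enat e"
proof -
  have "dim_max_quot S \<nn> nn = e"
  proof (rule S.dim_max_quot_eqI)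
    show "ideal nn S" by (rule nn.is_ideal)
    show "nn \<subseteq> \<nn>" using S.ideal_prod_inter[OF S.maximal_ideal S.maximal_ideal] by simp
    show "a \<otimes>\<^bsub>S\<^esub> b \<in> nn" if "a \<in> \<nn>" "b \<in> \<nn>" for a b using that by (rule ideal_prod.prod)
    show "x \<in> {..<e} \<rightarrow> \<nn>" using x_max by blast
    fix u assume "u \<in> \<nn>"
    then obtain c where c: "c \<in> {..<e} \<rightarrow> carrier S" "u = sx c" using x_gen by blast
    then have "u = \<zero>\<^bsub>S\<^esub> \<oplus>\<^bsub>S\<^esub> sx c" using sx_carrier by simp
    then show "\<exists>c\<in>{..<e} \<rightarrow> carrier S. \<exists>j\<in>nn. u = j \<oplus>\<^bsub>S\<^esub> sx c" using c(1) nn.zero_closed by blast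
  qed (rule x_independent)
  then show ?thesis using regular by (simp add: power_2)
qed

lemma x_koszul:
  assumes c: "c \<in> {..<e} \<rightarrow> carrier S" and sum: "sx c = \<zero>\<^bsub>S\<^esub>"
  shows "\<exists>g. (\<forall>i<e. \<forall>l<e. g i l \<in> carrier S \<and> g l i = \<ominus>\<^bsub>S\<^esub> g i l) \<and> (\<forall>i<e. g i i = \<zero>\<^bsub>S\<^esub>) \<and>
     (\<forall>i<e. c i = sx (g i))"
  using S.regular_imp_koszul[OF x_Pi _ c sum] S.regular_generators_regular[OF krull_dim_eq x_Pi x_generates] by blast

context
  assumes not_burch: "\<nn> \<subseteq> ideal_colon S (I \<cdot>\<^bsub>S\<^esub> \<nn>) (ideal_colon S I \<nn>)"
begin

lemma colon_max_prod:
  assumes "s \<in> ideal_colon S I \<nn>" "u \<in> \<nn>" shows "s \<otimes>\<^bsub>S\<^esub> u \<in> I \<cdot>\<^bsub>S\<^esub> \<nn>"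
proof -
  have "u \<otimes>\<^bsub>S\<^esub> s \<in> I \<cdot>\<^bsub>S\<^esub> \<nn>" using not_burch assms by (auto simp: ideal_colon_def)
  moreover have "s \<in> carrier S" "u \<in> carrier S" using assms nI.Icarr by (auto simp: ideal_colon_def)
  ultimately show ?thesis by (simp add: S.m_comm)
qed

text \<open>Write s as the sum of the q_i x_i, and s x_l as a combination of \<open>x\<close> with
  coefficients b_i in \<open>I\<close>. The difference is a Koszul relation, so b_l - s is the sum
  of the g_li x_i with g_ll = 0. Hence the coefficients q_i + g_li combine to b_l, an element of
  \<nn>^2, and therefore all lie in \<nn>; the one with i = l is q_l.\<close>

lemma socle_in_square:
  assumes s: "s \<in> ideal_colon S I \<nn>" "s \<in> \<nn>"
  shows "s \<in> nn"
proof -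
  have sc: "s \<in> carrier S" using s(2) by (rule nI.Icarr)
  obtain q where q: "q \<in> {..<e} \<rightarrow> carrier S" "s = sx q" using x_gen[OF s(2)] by blast
  have "q l \<in> \<nn>" if l: "l < e" for l
  proof -
    obtain b where b: "b \<in> {..<e} \<rightarrow> I" "s \<otimes>\<^bsub>S\<^esub> x l = sx b"
      using x_gen_prod[OF I colon_max_prod[OF s(1) x_max[OF l]]] by blast
    have bc: "b i \<in> carrier S" if "i < e" for i using b(1) that by (simp add: Pi_def In.Icarr)
    define c where "c i = b i \<oplus>\<^bsub>S\<^esub> (if i = l then \<ominus>\<^bsub>S\<^esub> s else \<zero>\<^bsub>S\<^esub>)" for i
    have cP: "c \<in> {..<e} \<rightarrow> carrier S" using bc sc by (auto simp: c_def)
    interpret L: module S "self_module S" by (rule S.module_self)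
    have dP: "(\<lambda>i. if i = l then \<ominus>\<^bsub>S\<^esub> s else \<zero>\<^bsub>S\<^esub>) \<in> {..<e} \<rightarrow> carrier S" using sc by auto
    have "sx c = sx b \<oplus>\<^bsub>S\<^esub> \<ominus>\<^bsub>S\<^esub> s \<otimes>\<^bsub>S\<^esub> x l"
      using L.lin_comb_add[of x e b "\<lambda>i. if i = l then \<ominus>\<^bsub>S\<^esub> s else \<zero>\<^bsub>S\<^esub>"] x_Pi bc dP
        L.lin_comb_delta[of x e l "\<ominus>\<^bsub>S\<^esub> s"] l sc by (simp add: lin_comb_self_module c_def Pi_def)
    also have "\<dots> = \<zero>\<^bsub>S\<^esub>" unfolding b(2)[symmetric] using sc x_carrier[OF l] by (simp add: S.l_minus S.r_neg)
    finally obtain g where g: "\<forall>i<e. \<forall>l<e. g i l \<in> carrier S \<and> g l i = \<ominus>\<^bsub>S\<^esub> g i l"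
      "\<forall>i<e. g i i = \<zero>\<^bsub>S\<^esub>" "\<forall>i<e. c i = sx (g i)" using x_koszul[OF cP] by blast
    have gP: "g l \<in> {..<e} \<rightarrow> carrier S" using g(1) l by blast
    have "c l = sx (g l)" using g(3) l by blast
    then have cl: "b l \<oplus>\<^bsub>S\<^esub> \<ominus>\<^bsub>S\<^esub> s = sx (g l)" by (simp add: c_def)
    have "sx (\<lambda>i. q i \<oplus>\<^bsub>S\<^esub> g l i) = s \<oplus>\<^bsub>S\<^esub> sx (g l)"
      using L.lin_comb_add[of x e q "g l"] x_Pi q gP by (simp add: lin_comb_self_module)
    also have "\<dots> = b l" unfolding cl[symmetric]
      using bc[OF l] sc S.a_lcomm[OF sc bc[OF l], of "\<ominus>\<^bsub>S\<^esub> s"] by (simp add: S.r_neg)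
    also have "b l \<in> nn" using b(1) l I_nn by auto
    finally have "q l \<oplus>\<^bsub>S\<^esub> g l l \<in> \<nn>" using q(1) gP l by (intro x_independent) auto
    then show ?thesis using g(2) l q(1) by (simp add: Pi_def)
  qed
  then show ?thesis unfolding q(2) using sx_in_prod[OF S.maximal_ideal, of q] by auto
qed

lemma socle_vector_in:
  assumes B: "submodule B R (G.F e)" and a: "a \<in> carrier (G.F e)"
    and soc: "\<And>p. p \<in> \<mm> \<Longrightarrow> p \<odot>\<^bsub>G.F e\<^esub> a = \<zero>\<^bsub>G.F e\<^esub>"
    and syz: "\<And>p z. p \<in> \<mm> \<Longrightarrow> z \<in> carrier (G.F e) \<Longrightarrow> G.sy z = \<zero> \<Longrightarrow> p \<odot>\<^bsub>G.F e\<^esub> z \<in> B"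
    and t: "\<And>v. v \<in> carrier (G.F e) \<Longrightarrow> \<forall>i<e. v i \<in> ideal_power R \<mm> t \<Longrightarrow> v \<in> B"
  shows "a \<in> B"
proof -
  interpret m: ideal \<mm> R by (rule R.maximal_ideal)
  interpret Fe: module R "G.F e" by (rule R.module_free)
  have ac: "a i \<in> carrier R" if "i < e" for i using a that by auto
  have asoc: "a i \<otimes> p = \<zero>" if i: "i < e" and p: "p \<in> \<mm>" for i p
  proof -
    have "p \<otimes> a i = \<zero>" using arg_cong[OF soc[OF p], of "\<lambda>v. v i"] i by simp
    then show ?thesis using ac[OF i] m.Icarr[OF p] by (simp add: R.m_comm)
  qed
  have am: "a i \<in> \<mm>" if "i < e" for i
    using ac[OF that] asoc[OF that G.y_max] by (rule G.annihilator_in_max)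
  have "\<forall>i<e. \<exists>s\<in>carrier S. \<forall>n. rep n s (a i)" using rep_const ac by blast
  then obtain s where sc: "\<And>i. i < e \<Longrightarrow> s i \<in> carrier S" and srep: "\<And>i n. i < e \<Longrightarrow> rep n (s i) (a i)" by metis
  \<comment> \<open>The product with an element of \<nn> vanishes at every level, and the levels
    separate points modulo \<open>I\<close>.\<close>
  have scolon: "s i \<in> ideal_colon S I \<nn>" if i: "i < e" for i
  proof -
    have "s i \<otimes>\<^bsub>S\<^esub> u \<in> I" if u: "u \<in> \<nn>" for u
    proof (rule rep_separated)
      have uc: "u \<in> carrier S" using u by (rule nI.Icarr)
      show su: "s i \<otimes>\<^bsub>S\<^esub> u \<in> carrier S" using sc[OF i] uc by simp
      fix n
      obtain r where r: "rep (Suc n) u r" using rep_total[OF uc] by blast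
      then have "r \<in> \<mm>" using rep_max[OF uc r] u by simp
      then have "rep (Suc n) (s i \<otimes>\<^bsub>S\<^esub> u) \<zero>"
        using rep_mult_add(1)[OF sc[OF i] uc srep[OF i] r] asoc[OF i] by simp
      then show "rep n (s i \<otimes>\<^bsub>S\<^esub> u) \<zero>" using rep_mono[OF su] by simp
    qed
    then show ?thesis using sc[OF i] by (simp add: ideal_colon_def)
  qed
  have sn: "s i \<in> nn" if "i < e" for i
    using socle_in_square[OF scolon[OF that]] rep_max[OF sc[OF that] srep[OF that]] am[OF that] by blast
  \<comment> \<open>Each product of \<open>s i\<close> and \<open>x i\<close> lies in I\<nn> and not
    merely in \<open>I\<close>. Here the assumed failure of the Burch condition produces
    coefficients \<open>b i\<close> in \<open>I\<close>.\<close>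
  have "sx s \<in> I \<cdot>\<^bsub>S\<^esub> \<nn>"
    using colon_max_prod[OF scolon x_max]
    by (intro S.ideal_finsum_closed[OF S.ideal_prod_is_ideal[OF I S.maximal_ideal]]) auto
  then obtain b where b: "b \<in> {..<e} \<rightarrow> I" "sx s = sx b" using x_gen_prod[OF I] by blast
  have bc: "b i \<in> carrier S" if "i < e" for i using b(1) that by (simp add: Pi_def In.Icarr)
  interpret L: module S "self_module S" by (rule S.module_self)
  have sP: "s \<in> {..<e} \<rightarrow> carrier S" and bP: "b \<in> {..<e} \<rightarrow> carrier S" using sc bc by auto
  define c where "c i = s i \<ominus>\<^bsub>S\<^esub> b i" for i
  have cP: "c \<in> {..<e} \<rightarrow> carrier S" using sc bc by (auto simp: c_def)
  have "sx c = sx s \<ominus>\<^bsub>self_module S\<^esub> sx b"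
    using L.lin_comb_minus[OF _ sP bP, of x] x_Pi by (simp add: lin_comb_self_module c_def)
  also have "\<dots> = \<zero>\<^bsub>S\<^esub>"
    unfolding b(2) using L.M.r_neg[of "sx b"] sx_carrier[OF bP] by (simp add: L.M.minus_eq)
  finally obtain g where g: "\<forall>i<e. \<forall>l<e. g i l \<in> carrier S \<and> g l i = \<ominus>\<^bsub>S\<^esub> g i l"
      "\<forall>i<e. g i i = \<zero>\<^bsub>S\<^esub>" "\<forall>i<e. c i = sx (g i)" using x_koszul[OF cP] by blast
  have gP: "g i \<in> {..<e} \<rightarrow> carrier S" if "i < e" for i using g(1) that by blast
  have gn: "g i l \<in> \<nn>" if i: "i < e" and l: "l < e" for i l
  proof -
    have "b i \<in> nn" using b(1) i I_nn by auto
    then have "c i \<in> nn" unfolding c_def by (rule S.ideal_minus_closed[OF nn.is_ideal sn[OF i]])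
    then have "sx (g i) \<in> nn" using g(3) i by simp
    then show ?thesis by (rule x_independent[OF gP[OF i] _ l])
  qed
  \<comment> \<open>The level is t + 1 because for t = 0 membership in \<nn> and in \<mm> could not
    be compared at level t.\<close>
  have "\<forall>i<e. \<forall>l<e. \<exists>r. rep (Suc t) (g i l) r" using rep_total g(1) by blast
  then obtain r0 where r0: "\<And>i l. i < e \<Longrightarrow> l < e \<Longrightarrow> rep (Suc t) (g i l) (r0 i l)" by metis
  \<comment> \<open>Arbitrary representatives of an alternating matrix are alternating only up to
    \<mm>^(t+1). Reflecting the upper triangle makes the matrix over \<open>R\<close> exactly
    alternating, as the Koszul relations require.\<close>
  define r where "r i l = (if i < l then r0 i l else if l < i then \<ominus> r0 l i else \<zero>)" for i l
  have gc: "g i l \<in> carrier S" if "i < e" "l < e" for i l using g(1) that by blast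
  have rrep: "rep (Suc t) (g i l) (r i l)" if i: "i < e" and l: "l < e" for i l
  proof -
    consider "i < l" | "l < i" | "i = l" by linarith
    then show ?thesis
    proof cases
      case 1 then show ?thesis using r0[OF i l] by (simp add: r_def)
    next
      case 2
      have "g i l = \<ominus>\<^bsub>S\<^esub> g l i" using g(1) i l by blast
      then show ?thesis using 2 rep_neg[OF gc[OF l i] r0[OF l i]] by (simp add: r_def)
    next
      case 3 then show ?thesis using g(2) i rep_zero by (simp add: r_def)
    qed
  qed
  have rm: "r i l \<in> \<mm>" if "i < e" "l < e" for i l using rep_max[OF gc rrep] gn that by blast
  have r0c: "r0 i l \<in> carrier R" if "i < e" "l < e" for i l using rep_carrier[OF gc r0] that by blast
  define z where "z = (\<lambda>i\<in>{..<e}. \<Oplus>l\<in>{..<e}. r i l \<otimes> y l)"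
  have zB: "z \<in> B" unfolding z_def
  proof (rule G.koszul_combination_in[OF B syz rm])
    fix i l assume "i < e" "l < e"
    then show "r l i = \<ominus> r i l" using r0c by (auto simp: r_def)
  qed (auto simp: r_def)
  have zc: "z \<in> carrier (G.F e)" using zB Fe.submoduleE(1)[OF B] by blast
  \<comment> \<open>The error of the comparison. Both \<open>a i\<close> and \<open>z i\<close>
    represent \<open>s i\<close> modulo \<mm>^t, because \<open>b i\<close> lies in \<open>I\<close>
    and vanishes in the completion.\<close>
  define v where "v = a \<oplus>\<^bsub>G.F e\<^esub> \<ominus>\<^bsub>G.F e\<^esub> z"
  have vc: "v \<in> carrier (G.F e)" unfolding v_def using Fe.M.a_closed[OF a Fe.M.a_inv_closed[OF zc]] .
  have "v i \<in> ideal_power R \<mm> t" if i: "i < e" for i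
  proof -
    have zi: "z i \<in> carrier R" using zc i by auto
    have vi: "v i = a i \<ominus> z i"
    proof -
      have "\<ominus>\<^bsub>G.F e\<^esub> z = (\<ominus> \<one>) \<odot>\<^bsub>G.F e\<^esub> z" using zc by (simp add: Fe.smult_l_minus)
      then show ?thesis unfolding v_def using i zi by (simp add: R.minus_eq R.l_minus)
    qed
    have grep: "rep t (g i l) (r i l)" if "l < e" for l using rep_mono[OF gc rrep] i that by simp
    have "rep t (sx (g i)) (z i)"
      using rep_sum[OF gP[OF i] x_Pi grep x_rep] i by (simp add: z_def)
    then have "rep t (c i) (z i)" using g(3) i by simp
    then have "rep t (c i \<oplus>\<^bsub>S\<^esub> b i) (z i \<oplus> \<zero>)"
      using rep_ideal[of "b i"] b(1) bc cP i by (intro rep_mult_add(2)) auto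
    moreover have "c i \<oplus>\<^bsub>S\<^esub> b i = s i" unfolding c_def using sc[OF i] bc[OF i] by (simp add: S.minus_eq S.a_assoc S.l_neg)
    ultimately have "rep t (s i) (z i)" using zi by simp
    then have "a i \<ominus> z i \<in> ideal_power R \<mm> t" using rep_iff[OF sc[OF i]] srep[OF i] by blast
    then show ?thesis using vi by simp
  qed
  then have vB: "v \<in> B" using t[OF vc] by blast
  have "a = v \<oplus>\<^bsub>G.F e\<^esub> z"
    unfolding v_def using Fe.M.a_assoc[OF a Fe.M.a_inv_closed[OF zc] zc] a zc by (simp only: Fe.M.l_neg Fe.M.r_zero)
  then show ?thesis using Fe.submoduleE(5)[OF B vB zB] by simp
qed

end
end

text \<open>Every element of \<mm> kills the nonzero element \<open>c\<close>, so none can be the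
  first member of a regular sequence.\<close>

lemma (in noetherian_local_ring) ring_depth_zero:
  assumes c: "c \<in> carrier R" "c \<noteq> \<zero>" "\<And>p. p \<in> \<mm> \<Longrightarrow> p \<otimes> c = \<zero>"
  shows "ring_depth R \<mm> = 0"
proof -
  have "xs = []" if xs: "set xs \<subseteq> \<mm>" "regular_sequence R xs" for xs
  proof (rule ccontr)
    assume "xs \<noteq> []"
    then have "xs ! 0 \<in> \<mm>" "0 < length xs" using xs(1) nth_mem[of 0 xs] by auto
    then have "xs ! 0 \<otimes> c \<in> Idl (set (take 0 xs))"
      using c(3) additive_subgroup.zero_closed[OF ideal.axioms(1)[OF genideal_ideal[of "{}"]]] by simp
    then have "c \<in> Idl (set (take 0 xs))" using xs(2) \<open>0 < length xs\<close> c(1) unfolding regular_sequence_def by blast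
    then show False using genideal_minimal[OF zeroideal, of "{}"] c(2) by auto
  qed
  then have "{enat (length xs) | xs. set xs \<subseteq> \<mm> \<and> regular_sequence R xs} \<subseteq> {0}" by (auto simp: zero_enat_def)
  then have "ring_depth R \<mm> \<le> Sup {0}" unfolding ring_depth_def by (rule Sup_subset_mono)
  then show ?thesis by simp
qed

text \<open>The dimension is computed only for ideals between \<mm>^2 and \<mm>. The colon ideal is
  proper by hypothesis, hence inside \<mm>, and the identity (p q) s = (s p) q shows that it
  contains all products of two elements of \<mm>.\<close>

lemma (in noetherian_local_ring) burch_index_pos:
  assumes I: "ideal I R" and burch: "\<not> \<mm> \<subseteq> ideal_colon R (I \<cdot>\<^bsub>R\<^esub> \<mm>) (ideal_colon R I \<mm>)"
  shows "burch_index R \<mm> I \<ge> 1"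
proof -
  let ?J = "ideal_colon R (I \<cdot>\<^bsub>R\<^esub> \<mm>) (ideal_colon R I \<mm>)"
  have mc: "p \<in> carrier R" if "p \<in> \<mm>" for p using that ideal.Icarr[OF maximal_ideal] by blast
  have J: "ideal ?J R"
    by (rule ideal_colon_ideal[OF ideal_prod_is_ideal[OF I maximal_ideal]]) (auto simp: ideal_colon_def)
  have "?J \<noteq> carrier R" using burch mc by blast
  then have "?J \<subseteq> \<mm>" by (rule proper_ideal_subset_maximal[OF J])
  moreover have "p \<otimes> q \<in> ?J" if pq: "p \<in> \<mm>" "q \<in> \<mm>" for p q
  proof -
    have "(p \<otimes> q) \<otimes> s \<in> I \<cdot>\<^bsub>R\<^esub> \<mm>" if s: "s \<in> ideal_colon R I \<mm>" for s
    proof -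
      have sc: "s \<in> carrier R" "s \<otimes> p \<in> I" using s pq by (auto simp: ideal_colon_def)
      have "(p \<otimes> q) \<otimes> s = (s \<otimes> p) \<otimes> q" using sc mc pq by (simp add: m_ac)
      then show ?thesis using ideal_prod.prod[OF sc(2) pq(2)] by simp
    qed
    then show ?thesis using mc pq by (simp add: ideal_colon_def)
  qed
  ultimately show ?thesis
    unfolding burch_index_def
    using dim_max_quot_pos[OF J] ideal_index_generates[OF maximal_ideal] burch by blast
qed

theorem theorem2p5:
  fixes R :: "('a, 'b) ring_scheme" and \<mm> :: "'a set"
  assumes "noetherian_local_ring R \<mm>"
    and "\<not> field R"
    and "\<And>(M :: ('a, (nat \<Rightarrow> 'a) set) module) Z.
      \<lbrakk>module R M; mod_fin_gen R M; \<not> fin_free R M; is_syzygy R \<mm> 4 M Z\<rbrakk>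
      \<Longrightarrow> direct_summand R (residue_module R \<mm>) Z"
  shows "burch_ring TYPE('s) R \<mm> \<and> ring_depth R \<mm> = 0"
proof -
  interpret R: noetherian_local_ring R \<mm> by (rule assms(1))
  obtain e y where y: "minimally_generates R \<mm> (self_module R) e y \<mm>"
    using R.exists_minimal_generators[OF R.module_self _ R.ideal_index_generates[OF R.maximal_ideal]]
      ideal.Icarr[OF R.maximal_ideal] by auto
  interpret G: generator_cokernel R \<mm> e y using assms(2) y by unfold_locales
  obtain B a where B: "submodule B R (G.F e)" and a: "a \<in> carrier (G.F e)" "a \<notin> B"
    and soc: "\<And>p. p \<in> \<mm> \<Longrightarrow> p \<odot>\<^bsub>G.F e\<^esub> a = \<zero>\<^bsub>G.F e\<^esub>"
    and syz: "\<And>p z. p \<in> \<mm> \<Longrightarrow> z \<in> carrier (G.F e) \<Longrightarrow> G.sy z = \<zero>\<^bsub>R\<^esub> \<Longrightarrow> p \<odot>\<^bsub>G.F e\<^esub> z \<in> B"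
    using G.syzygy_socle_element[OF assms(3)[OF G.M_module G.M_fin_gen G.M_not_free]] by blast
  interpret Fe: module R "G.F e" by (rule R.module_free)
  have depth: "ring_depth R \<mm> = 0"
  proof -
    \<comment> \<open>A vector outside a submodule is nonzero, so one of its entries is a nonzero
      socle element of \<open>R\<close>.\<close>
    have "a \<noteq> \<zero>\<^bsub>G.F e\<^esub>" using a(2) Fe.submodule_zero_closed[OF B] by blast
    then have "\<exists>i<e. a i \<noteq> \<zero>\<^bsub>R\<^esub>"
      using PiE_lessThan_ext[of a e "carrier R" "\<zero>\<^bsub>G.F e\<^esub>" "carrier R"] a(1) Fe.M.zero_closed by auto
    then obtain i where i: "i < e" "a i \<noteq> \<zero>\<^bsub>R\<^esub>" by blast
    have "p \<otimes>\<^bsub>R\<^esub> a i = \<zero>\<^bsub>R\<^esub>" if "p \<in> \<mm>" for p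
      using arg_cong[OF soc[OF that], of "\<lambda>v. v i"] i(1) by simp
    moreover have "a i \<in> carrier R" using a(1) i(1) by auto
    ultimately show ?thesis using R.ring_depth_zero i(2) by blast
  qed
  \<comment> \<open>Lifted elements are compared with elements of \<open>R\<close> only modulo a
    power of \<mm>. The enlarged \<open>B'\<close> absorbs an error in \<mm>^t and still avoids
    \<open>a\<close>.\<close>
  obtain B' t where B': "submodule B' R (G.F e)" "B \<subseteq> B'" "a \<notin> B'"
    and t: "\<And>v. v \<in> carrier (G.F e) \<Longrightarrow> \<forall>i<e. v i \<in> ideal_power R \<mm> t \<Longrightarrow> v \<in> B'"
    using R.socle_element_avoided[OF B a soc] by blast
  have "burch_ring TYPE('s) R \<mm>"
    unfolding burch_ring_def
  proof (intro allI impI)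
    fix S :: "'s ring" and \<nn> I
    assume pres: "minimal_cohen_presentation R \<mm> S \<nn> I"
    have S: "noetherian_local_ring S \<nn>" "krull_dim S = enat (dim_max_quot S \<nn> (ideal_power S \<nn> 2))"
      and I: "ideal I S" "I \<subseteq> ideal_power S \<nn> 2" and iso: "adic_completion R \<mm> \<simeq> S Quot I"
      using pres by (simp_all only: minimal_cohen_presentation_def regular_local_ring_def)
    obtain h where h: "h \<in> ring_iso (adic_completion R \<mm>) (S Quot I)" using iso by (auto simp: is_ring_iso_def)
    interpret S: noetherian_local_ring S \<nn> by (rule S(1))
    interpret P: completion_presentation R \<mm> S \<nn> I h
      by (rule completion_presentation.intro[OF assms(1) S(1) completion_presentation_axioms.intro[OF I(1) h]])
    have "\<forall>i<e. \<exists>s\<in>carrier S. \<forall>n. P.rep n s (y i)" using P.rep_const[OF G.y_carrier] by simp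
    then obtain x where x: "\<And>i. i < e \<Longrightarrow> x i \<in> carrier S" "\<And>i n. i < e \<Longrightarrow> P.rep n (x i) (y i)" by metis
    interpret Q: regular_presentation R \<mm> S \<nn> I h e y x
      by (rule regular_presentation.intro[OF P.completion_presentation_axioms G.generator_cokernel_axioms])
        (rule regular_presentation_axioms.intro[OF S(2) I(2) x])
    have "\<not> \<nn> \<subseteq> ideal_colon S (I \<cdot>\<^bsub>S\<^esub> \<nn>) (ideal_colon S I \<nn>)"
    proof
      assume not_burch: "\<nn> \<subseteq> ideal_colon S (I \<cdot>\<^bsub>S\<^esub> \<nn>) (ideal_colon S I \<nn>)"
      have syz': "p \<odot>\<^bsub>G.F e\<^esub> z \<in> B'"
        if "p \<in> \<mm>" "z \<in> carrier (G.F e)" "G.sy z = \<zero>\<^bsub>R\<^esub>" for p z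
        by (rule subsetD[OF B'(2) syz[OF that]])
      have "a \<in> B'" by (rule Q.socle_vector_in[OF not_burch B'(1) a(1) soc syz' t])
      then show False using B'(3) by (rule notE[rotated])
    qed
    then show "burch_index S \<nn> I \<ge> 1" by (rule S.burch_index_pos[OF I(1)])
  qed
  then show ?thesis using depth by blast
qed

end
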